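(* Let $a,b>0$ and let $K$ be either the Gaussian kernel $K(t)=ae^{-bt^2/2}$ or the Ornstein–Uhlenbeck kernel $K(t)=ae^{-b|t|}$. Let $m\le1$ be fixed, let $\Xi\subset\mathbb{R}$ be a nonempty open bounded interval, let $\xi_0\in\Xi$, and consider the drift family $\mu_\xi(t)=\xi(1+t)^m$. Let $h_n\to0$ and $T_n=nh_n\to\infty$. For $m<0$ put $$S_{m,\infty}:=-Z_0-\int_0^\infty m(1+t)^{m-1}Z_t\,dt,\qquad V_{m,\infty}:=\mathrm{Var}(S_{m,\infty}).$$ Then $V_{m,\infty}>0$ for every $m<0$, and the estimator $\widehat{\xi}_n$ defined in the context satisfies, as $n\to\infty$: (i) if $0<m\le1$ and in addition $h_nT_n^m\to0$, then $T_n^{m+1}(\widehat{\xi}_n-\xi_0)\xrightarrow{d}\mathcal{N}\bigl(0,K(0)(2m+1)^2\bigr)$; (ii) if $m=0$, then $T_n(\widehat{\xi}_n-\xi_0)\xrightarrow{d}\mathcal{N}(0,2K(0))$; (iii) if $-1/2<m<0$, then $T_n^{2m+1}(\widehat{\xi}_n-\xi_0)\xrightarrow{d}\mathcal{N}\bigl(0,(2m+1)^2V_{m,\infty}\bigr)$; (iv) if $m=-1/2$, then $(\log T_n)(\widehat{\xi}_n-\xi_0)\xrightarrow{d}\mathcal{N}(0,V_{-1/2,\infty})$; (v) if $m<-1/2$, then the unconstrained estimator $\widetilde{\xi}_n$ converges in $L^2$ to $\xi_0+S_{m,\infty}/A_m(\infty)$, where $A_m(\infty)=\int_0^\infty(1+t)^{2m}\,dt$;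 the constrained estimator $\widehat{\xi}_n$ converges in $L^2$ to the projection of $\xi_0+S_{m,\infty}/A_m(\infty)$ onto $\overline{\Xi}$, and $\widehat{\xi}_n$ is inconsistent (it does not converge to $\xi_0$ in probability).
   Context: $Z=(Z_t)_{t\ge0}$ is a centered stationary Gaussian process with covariance $\mathbb{E}[Z_tZ_s]=K(|t-s|)$; integrals of $Z$ against deterministic functions are understood in the mean-square sense. For the true parameter $\xi_0\in\Xi$ the observed process is $X_t=Z_t+\int_0^t\mu_{\xi_0}(s)\,ds$, $t\ge0$. For each $n$, $X$ is observed at $t_i=ih_n$, $i=0,1,\dots,n$, with $h_n>0$, and $\Delta_i^nX=X_{t_i}-X_{t_{i-1}}$. The contrast function is $$H_n(\xi)=\sum_{i=1}^n\bigl(\Delta_i^nX-\mu_\xi(t_{i-1})h_n\bigr)^2.$$ The (constrained) estimator is $\widehat{\xi}_n\in\arg\min_{\xi\in\overline{\Xi}}H_n(\xi)$, where $\overline{\Xi}$ is the closure of $\Xi$. The unconstrained estimator $\widetilde{\xi}_n$ is the minimizer of $H_n(\xi)$ over $\xi\in\mathbb{R}$, where $\mu_\xi(t)=\xi(1+t)^m$ for all $\xi\in\mathbb{R}$. $\xrightarrow{d}$ denotes convergence in distribution. *)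

theory Defs
  imports "HOL-Probability.Probability"
begin

section \<open>Modes of convergence\<close>

definition L2_rv :: "'w measure \<Rightarrow> ('w \<Rightarrow> real) \<Rightarrow> bool" where
  "L2_rv M Y \<longleftrightarrow> Y \<in> borel_measurable M \<and> integrable M (\<lambda>\<omega>. (Y \<omega>)\<^sup>2)"

text \<open>Square integrability is demanded explicitly because the Bochner integral of a
  non-integrable function is 0.\<close>

definition tendsto_L2 ::
    "'w measure \<Rightarrow> ('i \<Rightarrow> 'w \<Rightarrow> real) \<Rightarrow> ('w \<Rightarrow> real) \<Rightarrow> 'i filter \<Rightarrow> bool" where
  "tendsto_L2 M Y L F \<longleftrightarrow>
     L2_rv M L \<and> (\<forall>\<^sub>F i in F. L2_rv M (Y i)) \<and>
     ((\<lambda>i. LINT \<omega>|M. (Y i \<omega> - L \<omega>)\<^sup>2) \<longlongrightarrow> 0) F"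

definition tendsto_prob ::
    "'w measure \<Rightarrow> ('i \<Rightarrow> 'w \<Rightarrow> real) \<Rightarrow> ('w \<Rightarrow> real) \<Rightarrow> 'i filter \<Rightarrow> bool" where
  "tendsto_prob M Y L F \<longleftrightarrow>
     (\<forall>\<epsilon>>0. ((\<lambda>i. measure M {\<omega> \<in> space M. \<bar>Y i \<omega> - L \<omega>\<bar> > \<epsilon>}) \<longlongrightarrow> 0) F)"

text \<open>The second argument of \<open>normal_law\<close> is the variance, whereas \<^const>\<open>normal_density\<close>
  takes the standard deviation; variance 0 gives a point mass.\<close>

definition normal_law :: "real \<Rightarrow> real \<Rightarrow> real measure" where
  "normal_law c v = (if v = 0 then return borel c else density lborel (normal_density c (sqrt v)))"

definition converges_in_law ::
    "'w measure \<Rightarrow> (nat \<Rightarrow> 'w \<Rightarrow> real) \<Rightarrow> real measure \<Rightarrow> bool" where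
  "converges_in_law M Y N \<longleftrightarrow> weak_conv_m (\<lambda>n. distr M borel (Y n)) N"


section \<open>Gaussian processes on the half-line\<close>

definition gaussian_process :: "'w measure \<Rightarrow> (real \<Rightarrow> 'w \<Rightarrow> real) \<Rightarrow> bool" where
  "gaussian_process M Z \<longleftrightarrow>
     (\<forall>t\<ge>0. Z t \<in> borel_measurable M) \<and>
     (\<forall>I c. finite I \<and> I \<subseteq> {0..} \<longrightarrow>
        (\<exists>\<mu> v. v \<ge> 0 \<and> distr M borel (\<lambda>\<omega>. \<Sum>t\<in>I. c t * Z t \<omega>) = normal_law \<mu> v))"

text \<open>For a Gaussian process, zero mean together with a covariance depending only on the lag
  is stationarity.\<close>

definition centered_stationary_gaussian ::
    "'w measure \<Rightarrow> (real \<Rightarrow> 'w \<Rightarrow> real) \<Rightarrow> (real \<Rightarrow> real) \<Rightarrow> bool" where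
  "centered_stationary_gaussian M Z K \<longleftrightarrow>
     gaussian_process M Z \<and>
     (\<forall>t\<ge>0. (LINT \<omega>|M. Z t \<omega>) = 0) \<and>
     (\<forall>t\<ge>0. \<forall>s\<ge>0. (LINT \<omega>|M. Z t \<omega> * Z s \<omega>) = K \<bar>t - s\<bar>)"


section \<open>Mean-square Riemann integrals\<close>

text \<open>Tagged partitions of an interval, ordered by their mesh. In contrast to
  \<^const>\<open>division_filter\<close>, only constant gauges are allowed, which gives the Riemann integral.\<close>

definition riemann_filter :: "real \<Rightarrow> real \<Rightarrow> (real \<times> real set) set filter" where
  "riemann_filter a b =
     (INF \<delta>\<in>{0<..}. principal {p. p tagged_division_of {a..b} \<and> (\<lambda>x. ball x \<delta>) fine p})"

lemma eventually_riemann_filter: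
  "eventually P (riemann_filter a b) \<longleftrightarrow>
     (\<exists>\<delta>>0. \<forall>p. p tagged_division_of {a..b} \<and> (\<lambda>x. ball x \<delta>) fine p \<longrightarrow> P p)"
proof -
  have "eventually P (riemann_filter a b) \<longleftrightarrow>
      (\<exists>\<delta>\<in>{0<..}. eventually P
         (principal {p. p tagged_division_of {a..b} \<and> (\<lambda>x. ball x \<delta>) fine p}))"
    unfolding riemann_filter_def
  proof (rule eventually_INF_base)
    show "{0::real<..} \<noteq> {}" by auto
    fix d e :: real
    assume "d \<in> {0<..}" "e \<in> {0<..}"
    then show "\<exists>x\<in>{0<..}. principal {p. p tagged_division_of {a..b} \<and> (\<lambda>y. ball y x) fine p}
        \<le> inf (principal {p. p tagged_division_of {a..b} \<and> (\<lambda>x. ball x d) fine p})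
              (principal {p. p tagged_division_of {a..b} \<and> (\<lambda>x. ball x e) fine p})"
      by (intro bexI[of _ "min d e"]) (fastforce simp: fine_def)+
  qed
  then show ?thesis
    by (simp add: eventually_principal Bex_def)
qed

lemma riemann_filter_neq_bot: "riemann_filter a b \<noteq> bot"
proof
  assume "riemann_filter a b = bot"
  then have "eventually (\<lambda>_. False) (riemann_filter a b)"
    by simp
  then obtain d :: real where d: "d > 0"
    "\<And>p. p tagged_division_of {a..b} \<Longrightarrow> (\<lambda>x. ball x d) fine p \<Longrightarrow> False"
    unfolding eventually_riemann_filter by blast
  have "gauge (\<lambda>x::real. ball x d)"
    using d by (simp add: gauge_def)
  then show False
    using fine_division_exists_real d by metis
qed

definition has_ms_integral ::
    "'w measure \<Rightarrow> (real \<Rightarrow> 'w \<Rightarrow> real) \<Rightarrow> real \<Rightarrow> real \<Rightarrow> ('w \<Rightarrow> real) \<Rightarrow> bool" where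
  "has_ms_integral M X a b Y \<longleftrightarrow>
     (\<forall>t\<in>{a..b}. L2_rv M (X t)) \<and>
     tendsto_L2 M (\<lambda>p \<omega>. \<Sum>(x,k)\<in>p. measure lborel k * X x \<omega>) Y (riemann_filter a b)"

definition has_ms_integral_Ici ::
    "'w measure \<Rightarrow> (real \<Rightarrow> 'w \<Rightarrow> real) \<Rightarrow> real \<Rightarrow> ('w \<Rightarrow> real) \<Rightarrow> bool" where
  "has_ms_integral_Ici M X a Y \<longleftrightarrow>
     (\<exists>I. (\<forall>T\<ge>a. has_ms_integral M X a T (I T)) \<and> tendsto_L2 M I Y at_top)"

text \<open>The integral is determined only up to almost sure equality; an arbitrary version is
  chosen.\<close>

definition ms_integral_Ici ::
    "'w measure \<Rightarrow> (real \<Rightarrow> 'w \<Rightarrow> real) \<Rightarrow> real \<Rightarrow> 'w \<Rightarrow> real" where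
  "ms_integral_Ici M X a = (SOME Y. has_ms_integral_Ici M X a Y)"


section \<open>The model\<close>

definition drift :: "real \<Rightarrow> real \<Rightarrow> real \<Rightarrow> real" where
  "drift m \<xi> t = \<xi> * (1 + t) powr m"

definition observed ::
    "(real \<Rightarrow> real \<Rightarrow> real) \<Rightarrow> real \<Rightarrow> (real \<Rightarrow> 'w \<Rightarrow> real) \<Rightarrow> real \<Rightarrow> 'w \<Rightarrow> real" where
  "observed \<mu> \<xi>\<^sub>0 Z t \<omega> = Z t \<omega> + integral {0..t} (\<mu> \<xi>\<^sub>0)"

definition contrast ::
    "(real \<Rightarrow> real \<Rightarrow> real) \<Rightarrow> (real \<Rightarrow> 'w \<Rightarrow> real) \<Rightarrow> (nat \<Rightarrow> real) \<Rightarrow> nat \<Rightarrow> 'w \<Rightarrow> real \<Rightarrow> real" where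
  "contrast \<mu> X h n \<omega> \<xi> =
     (\<Sum>i=1..n. (X (real i * h n) \<omega> - X ((real i - 1) * h n) \<omega>
                 - \<mu> \<xi> ((real i - 1) * h n) * h n)\<^sup>2)"

definition S_inf :: "'w measure \<Rightarrow> (real \<Rightarrow> 'w \<Rightarrow> real) \<Rightarrow> real \<Rightarrow> 'w \<Rightarrow> real" where
  "S_inf M Z m \<omega> =
     - Z 0 \<omega> - ms_integral_Ici M (\<lambda>t \<omega>. m * (1 + t) powr (m - 1) * Z t \<omega>) 0 \<omega>"

definition V_inf :: "'w measure \<Rightarrow> (real \<Rightarrow> 'w \<Rightarrow> real) \<Rightarrow> real \<Rightarrow> real" where
  "V_inf M Z m = prob_space.variance M (S_inf M Z m)"

definition A_inf :: "real \<Rightarrow> real" where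
  "A_inf m = integral {0..} (\<lambda>t. (1 + t) powr (2 * m))"

end

theory Submission
  imports Defs
begin

text \<open>
The contrast is a parabola in \<open>\<xi>\<close>. With the weights \<open>w\<^sub>i = (1 + t\<^sub>i)\<^sup>m\<close>, completing the square shows that
the unconstrained estimator has the error \<open>(N + \<xi>\<^sub>0 B) / A\<close>, where \<open>A = h \<Sum> w\<^sub>i\<^sup>2\<close> (\<open>design_mass\<close>) is
deterministic, \<open>N = \<Sum> w\<^sub>i (Z\<^sub>i\<^sub>+\<^sub>1 - Z\<^sub>i)\<close> (\<open>noise_part\<close>) is a finite linear combination
of values of \<open>Z\<close>, and \<open>B\<close> (\<open>bias_part\<close>) is a deterministic discretisation error with \<open>\<bar>B\<bar> \<le> h max(1, w\<^sub>n)\<^sup>2\<close>.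
The constrained estimator is the projection of the unconstrained one onto the closed interval.

As \<open>N\<close> is exactly centred normal, a limit law only requires the limits of \<open>A\<close>, of
the \<open>L\<^sup>2\<close>-norm of \<open>N\<close>, and of \<open>B\<close>. Both estimators agree unless the unconstrained one leaves a
neighbourhood of \<open>\<xi>\<^sub>0\<close>, which has vanishing probability whenever the rate of convergence tends to
infinity (\<open>hat_limit_law\<close>). The sum \<open>A\<close> is compared with the integral of \<open>(1 + t)\<^sup>2\<^sup>m\<close>, from which
it differs by at most \<open>h\<close> times the variation of the integrand (\<open>weight_sum_trend\<close>).

For \<open>N\<close>, summation by parts gives
\<open>N = w\<^sub>n Z\<^sub>T - Z\<^sub>0 - \<Sum> (w\<^sub>i - w\<^sub>i\<^sub>-\<^sub>1) Z\<^sub>i\<close>. If \<open>m > 0\<close>, the first term dominates: the sum has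
second moment \<open>O(T\<^sup>m)\<close>, because the weights increase by at most \<open>h\<close> per step and the covariance
decays exponentially (\<open>increment_sum_second_moment\<close>). If \<open>m = 0\<close>, the score is the difference of two
asymptotically independent values of \<open>Z\<close>. If \<open>m < 0\<close>, the first term vanishes and
the sum converges in \<open>L\<^sup>2\<close> to the mean-square integral in \<open>S_inf\<close> (\<open>noise_score_near_S_inf\<close>). The same convergence
gives the limit in the inconsistent regime \<open>m < -1/2\<close>, where \<open>A\<close> has a finite limit.

The variance of \<open>S_inf\<close> is positive because \<open>S_inf\<close> is correlated with \<open>Z\<^sub>0\<close>: the kernel
\<open>-p (1 + t)\<^sup>p\<^sup>-\<^sup>1\<close> is a probability density on the half-line, hence the covariance is
an average of \<open>K t - K 0\<close>, which is negative for \<open>t > 0\<close> (\<open>V_inf_pos\<close>).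

Mean-square integrals are handled through a jointly measurable version of \<open>Z\<close>, obtained as
a pointwise limit along dyadic times. Its pathwise Lebesgue integrals exist almost surely, they
can be estimated by Fubini's theorem and the Cauchy-Schwarz inequality, and Riemann sums of
\<open>Z\<close> converge to them in mean square. This exhibits the integrals explicitly,
without an appeal to the completeness of \<open>L\<^sup>2\<close>.
\<close>

section \<open>Square-integrable random variables\<close>

definition l2norm :: "'w measure \<Rightarrow> ('w \<Rightarrow> real) \<Rightarrow> real" where
  "l2norm M Y = sqrt (LINT \<omega>|M. (Y \<omega>)\<^sup>2)"

lemma l2norm_nonneg [simp]: "0 \<le> l2norm M Y"
  by (simp add: l2norm_def)

lemma l2norm_power2: "(l2norm M Y)\<^sup>2 = (LINT \<omega>|M. (Y \<omega>)\<^sup>2)"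
  by (simp add: l2norm_def)

lemma L2_rv_measurable: "L2_rv M Y \<Longrightarrow> Y \<in> borel_measurable M"
  by (simp add: L2_rv_def)

lemma L2_rv_square_integrable: "L2_rv M Y \<Longrightarrow> integrable M (\<lambda>\<omega>. (Y \<omega>)\<^sup>2)"
  by (simp add: L2_rv_def)

lemma L2_rv_mult_integrable:
  assumes "L2_rv M X" "L2_rv M Y"
  shows "integrable M (\<lambda>\<omega>. X \<omega> * Y \<omega>)"
proof (rule Bochner_Integration.integrable_bound)
  show "integrable M (\<lambda>\<omega>. (X \<omega>)\<^sup>2 + (Y \<omega>)\<^sup>2)"
    using assms by (simp add: L2_rv_def)
  show "(\<lambda>\<omega>. X \<omega> * Y \<omega>) \<in> borel_measurable M"
    using assms by (auto simp: L2_rv_def)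
  have "\<bar>x * y\<bar> \<le> x\<^sup>2 + y\<^sup>2" for x y :: real
  proof -
    have "2 * \<bar>x\<bar> * \<bar>y\<bar> \<le> \<bar>x\<bar>\<^sup>2 + \<bar>y\<bar>\<^sup>2" by (rule sum_squares_bound)
    moreover have "0 \<le> \<bar>x\<bar> * \<bar>y\<bar>" by simp
    ultimately show ?thesis unfolding abs_mult by (simp only: power2_abs)
  qed
  then show "AE \<omega> in M. norm (X \<omega> * Y \<omega>) \<le> norm ((X \<omega>)\<^sup>2 + (Y \<omega>)\<^sup>2)"
    by simp
qed

lemma L2_rv_cmult:
  assumes "L2_rv M X" shows "L2_rv M (\<lambda>\<omega>. c * X \<omega>)"
  using assms by (auto simp: L2_rv_def power_mult_distrib)

lemma L2_rv_add:
  assumes "L2_rv M X" "L2_rv M Y"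
  shows "L2_rv M (\<lambda>\<omega>. X \<omega> + Y \<omega>)"
proof -
  have "integrable M (\<lambda>\<omega>. (X \<omega>)\<^sup>2 + (Y \<omega>)\<^sup>2 + 2 * (X \<omega> * Y \<omega>))"
    using assms L2_rv_mult_integrable[OF assms] by (simp add: L2_rv_def)
  then show ?thesis
    using assms by (auto simp: L2_rv_def power2_sum algebra_simps)
qed

lemma L2_rv_diff:
  assumes "L2_rv M X" "L2_rv M Y"
  shows "L2_rv M (\<lambda>\<omega>. X \<omega> - Y \<omega>)"
  using L2_rv_add[OF assms(1) L2_rv_cmult[OF assms(2), of "-1"]] by simp

lemma L2_rv_sum:
  assumes "\<And>i. i \<in> I \<Longrightarrow> L2_rv M (X i)"
  shows "L2_rv M (\<lambda>\<omega>. \<Sum>i\<in>I. X i \<omega>)"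
  using assms
proof (induction I rule: infinite_finite_induct)
  case (insert x F)
  then show ?case by (simp add: L2_rv_add)
qed (simp_all add: L2_rv_def)

lemma L2_rv_AE_cong:
  assumes "AE \<omega> in M. X \<omega> = Y \<omega>" "Y \<in> borel_measurable M" "L2_rv M X"
  shows "L2_rv M Y"
proof -
  have "integrable M (\<lambda>\<omega>. (Y \<omega>)\<^sup>2) \<longleftrightarrow> integrable M (\<lambda>\<omega>. (X \<omega>)\<^sup>2)"
    using assms by (intro integrable_cong_AE) (auto simp: L2_rv_def)
  then show ?thesis using assms by (simp add: L2_rv_def)
qed

lemma l2norm_AE_cong:
  assumes "AE \<omega> in M. X \<omega> = Y \<omega>" "X \<in> borel_measurable M" "Y \<in> borel_measurable M"
  shows "l2norm M X = l2norm M Y"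
  unfolding l2norm_def
  using assms by (intro arg_cong[where f=sqrt] integral_cong_AE) auto

lemma l2norm_cmult: "l2norm M (\<lambda>\<omega>. c * X \<omega>) = \<bar>c\<bar> * l2norm M X"
  by (simp add: l2norm_def power_mult_distrib real_sqrt_mult)

lemma l2norm_minus_commute: "l2norm M (\<lambda>\<omega>. X \<omega> - Y \<omega>) = l2norm M (\<lambda>\<omega>. Y \<omega> - X \<omega>)"
  by (simp add: l2norm_def power2_commute)

lemma integral_add_square:
  assumes "L2_rv M X" "L2_rv M Y"
  shows "(LINT \<omega>|M. (X \<omega> + c * Y \<omega>)\<^sup>2) =
    (LINT \<omega>|M. (X \<omega>)\<^sup>2) + 2 * c * (LINT \<omega>|M. X \<omega> * Y \<omega>) + c\<^sup>2 * (LINT \<omega>|M. (Y \<omega>)\<^sup>2)"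
proof -
  have "(LINT \<omega>|M. (X \<omega> + c * Y \<omega>)\<^sup>2) =
      (LINT \<omega>|M. (X \<omega>)\<^sup>2 + (2 * c) * (X \<omega> * Y \<omega>) + c\<^sup>2 * (Y \<omega>)\<^sup>2)"
    by (intro Bochner_Integration.integral_cong) (auto simp: power2_sum algebra_simps)
  also have "\<dots> = (LINT \<omega>|M. (X \<omega>)\<^sup>2) + (2 * c) * (LINT \<omega>|M. X \<omega> * Y \<omega>)
      + c\<^sup>2 * (LINT \<omega>|M. (Y \<omega>)\<^sup>2)"
    using assms L2_rv_mult_integrable[OF assms] by (simp add: L2_rv_def)
  finally show ?thesis .
qed

text \<open>The measure is arbitrary: the inequality serves both for expectations and for Lebesgue integrals
over time. The proof is the usual one, by non-negativity of the integral of
\<open>(X + c Y)\<^sup>2\<close> for all real \<open>c\<close>.\<close>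

lemma L2_Cauchy_Schwarz:
  assumes "L2_rv M X" "L2_rv M Y"
  shows "(LINT \<omega>|M. X \<omega> * Y \<omega>)\<^sup>2 \<le> (LINT \<omega>|M. (X \<omega>)\<^sup>2) * (LINT \<omega>|M. (Y \<omega>)\<^sup>2)"
proof -
  define A where "A = (LINT \<omega>|M. (X \<omega>)\<^sup>2)"
  define B where "B = (LINT \<omega>|M. (Y \<omega>)\<^sup>2)"
  define D where "D = (LINT \<omega>|M. X \<omega> * Y \<omega>)"
  have A: "0 \<le> A" and B: "0 \<le> B" by (simp_all add: A_def B_def)
  have pos: "0 \<le> A + 2 * c * D + c\<^sup>2 * B" for c
    unfolding A_def B_def D_def integral_add_square[OF assms, symmetric] by simp
  have "D\<^sup>2 \<le> A * B"
  proof (cases "B = 0")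
    case True
    have "D = 0"
    proof (rule ccontr)
      assume "D \<noteq> 0"
      with pos[of "- (A + 1) / (2 * D)"] True show False by (simp add: field_simps)
    qed
    then show ?thesis using True by simp
  next
    case False
    have "0 \<le> B * (A + 2 * (- D / B) * D + (- D / B)\<^sup>2 * B)"
      by (intro mult_nonneg_nonneg B pos)
    also have "\<dots> = A * B - D\<^sup>2"
      using False by (simp add: field_simps power2_eq_square)
    finally show ?thesis by simp
  qed
  then show ?thesis by (simp add: A_def B_def D_def)
qed

lemma l2norm_triangle:
  assumes "L2_rv M X" "L2_rv M Y"
  shows "l2norm M (\<lambda>\<omega>. X \<omega> + Y \<omega>) \<le> l2norm M X + l2norm M Y"
proof -
  let ?x = "l2norm M X" and ?y = "l2norm M Y"
  have "(LINT \<omega>|M. X \<omega> * Y \<omega>)\<^sup>2 \<le> (?x * ?y)\<^sup>2"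
    using L2_Cauchy_Schwarz[OF assms] by (simp add: l2norm_power2 power_mult_distrib)
  then have "(LINT \<omega>|M. X \<omega> * Y \<omega>) \<le> ?x * ?y"
    by (rule power2_le_imp_le) simp
  then have "(l2norm M (\<lambda>\<omega>. X \<omega> + Y \<omega>))\<^sup>2 \<le> (?x + ?y)\<^sup>2"
    using integral_add_square[OF assms, of 1]
    by (simp add: l2norm_power2 power2_sum)
  then show ?thesis by (rule power2_le_imp_le) simp
qed

lemma l2norm_triangle_diff:
  assumes "L2_rv M X" "L2_rv M Y" "L2_rv M W"
  shows "l2norm M (\<lambda>\<omega>. X \<omega> - W \<omega>) \<le> l2norm M (\<lambda>\<omega>. X \<omega> - Y \<omega>) + l2norm M (\<lambda>\<omega>. Y \<omega> - W \<omega>)"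
  using l2norm_triangle[of M "\<lambda>\<omega>. X \<omega> - Y \<omega>" "\<lambda>\<omega>. Y \<omega> - W \<omega>"] assms by (simp add: L2_rv_diff)

lemma l2norm_reverse_triangle:
  assumes "L2_rv M X" "L2_rv M Y"
  shows "\<bar>l2norm M X - l2norm M Y\<bar> \<le> l2norm M (\<lambda>\<omega>. X \<omega> - Y \<omega>)"
  using l2norm_triangle[OF L2_rv_diff[OF assms] assms(2)] l2norm_triangle[OF L2_rv_diff[OF assms(2,1)] assms(1)]
  by (simp add: l2norm_minus_commute[of M Y])

text \<open>Convergence of norms instead of second moments makes the triangle inequality
directly applicable.\<close>

lemma tendsto_L2_iff_l2norm:
  "tendsto_L2 M Y L F \<longleftrightarrow> L2_rv M L \<and> (\<forall>\<^sub>F i in F. L2_rv M (Y i)) \<and>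
     ((\<lambda>i. l2norm M (\<lambda>\<omega>. Y i \<omega> - L \<omega>)) \<longlongrightarrow> 0) F"
proof -
  have "((\<lambda>i. LINT \<omega>|M. (Y i \<omega> - L \<omega>)\<^sup>2) \<longlongrightarrow> 0) F \<longleftrightarrow>
      ((\<lambda>i. l2norm M (\<lambda>\<omega>. Y i \<omega> - L \<omega>)) \<longlongrightarrow> 0) F" (is "?l \<longleftrightarrow> ?r")
  proof
    assume ?l then show ?r
      unfolding l2norm_def using tendsto_real_sqrt[of _ 0] by fastforce
  next
    assume ?r
    from tendsto_power[OF this, of 2] show ?l
      by (simp add: l2norm_power2)
  qed
  then show ?thesis by (simp add: tendsto_L2_def)
qed

lemma tendsto_L2_AE_unique:
  assumes F: "F \<noteq> bot" and 1: "tendsto_L2 M Y L F" and 2: "tendsto_L2 M Y L' F"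
  shows "AE \<omega> in M. L \<omega> = L' \<omega>"
proof -
  have L: "L2_rv M L" "L2_rv M L'" using 1 2 by (auto simp: tendsto_L2_def)
  have "\<forall>\<^sub>F i in F. L2_rv M (Y i)" using 1 by (simp add: tendsto_L2_def)
  then have "\<forall>\<^sub>F i in F. l2norm M (\<lambda>\<omega>. L \<omega> - L' \<omega>)
      \<le> l2norm M (\<lambda>\<omega>. Y i \<omega> - L \<omega>) + l2norm M (\<lambda>\<omega>. Y i \<omega> - L' \<omega>)"
  proof (rule eventually_mono)
    fix i assume "L2_rv M (Y i)"
    then show "l2norm M (\<lambda>\<omega>. L \<omega> - L' \<omega>)
      \<le> l2norm M (\<lambda>\<omega>. Y i \<omega> - L \<omega>) + l2norm M (\<lambda>\<omega>. Y i \<omega> - L' \<omega>)"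
      using l2norm_triangle_diff[of M L "Y i" L'] L by (simp add: l2norm_minus_commute[of M L])
  qed
  moreover have "((\<lambda>i. l2norm M (\<lambda>\<omega>. Y i \<omega> - L \<omega>) + l2norm M (\<lambda>\<omega>. Y i \<omega> - L' \<omega>)) \<longlongrightarrow> 0 + 0) F"
    using 1 2 by (intro tendsto_add) (auto simp: tendsto_L2_iff_l2norm)
  ultimately have "l2norm M (\<lambda>\<omega>. L \<omega> - L' \<omega>) \<le> 0"
    using tendsto_le[OF F _ tendsto_const] by fastforce
  then have "(LINT \<omega>|M. (L \<omega> - L' \<omega>)\<^sup>2) = 0"
    by (metis l2norm_nonneg l2norm_power2 order_antisym zero_eq_power2)
  moreover have "integrable M (\<lambda>\<omega>. (L \<omega> - L' \<omega>)\<^sup>2)"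
    using L2_rv_diff[OF L] by (simp add: L2_rv_def)
  ultimately have "AE \<omega> in M. (L \<omega> - L' \<omega>)\<^sup>2 = 0"
    by (subst (asm) integral_nonneg_eq_0_iff_AE) auto
  then show ?thesis by simp
qed

lemma tendsto_L2_AE_cong:
  assumes Y: "tendsto_L2 M Y L F"
    and eq: "\<forall>\<^sub>F i in F. L2_rv M (Y' i) \<and> (AE \<omega> in M. Y i \<omega> = Y' i \<omega>)"
  shows "tendsto_L2 M Y' L F"
proof -
  have L: "L2_rv M L" and YL: "\<forall>\<^sub>F i in F. L2_rv M (Y i)" using Y by (auto simp: tendsto_L2_def)
  from eq YL have "\<forall>\<^sub>F i in F. l2norm M (\<lambda>\<omega>. Y i \<omega> - L \<omega>) = l2norm M (\<lambda>\<omega>. Y' i \<omega> - L \<omega>)"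
  proof eventually_elim
    case (elim i)
    then show ?case
      using L2_rv_measurable[OF L] L2_rv_measurable[of M "Y i"] L2_rv_measurable[of M "Y' i"]
      by (intro l2norm_AE_cong) auto
  qed
  then have "((\<lambda>i. l2norm M (\<lambda>\<omega>. Y' i \<omega> - L \<omega>)) \<longlongrightarrow> 0) F"
    using Y by (auto simp: tendsto_L2_iff_l2norm intro: Lim_transform_eventually)
  then show ?thesis using L eq by (auto simp: tendsto_L2_iff_l2norm elim: eventually_mono)
qed

lemma (in prob_space) L2_rv_integrable: "L2_rv M X \<Longrightarrow> integrable M X"
  using L2_rv_mult_integrable[of M X "\<lambda>_. 1"] by (simp add: L2_rv_def)

lemma (in prob_space) abs_expectation_le_l2norm:
  assumes "L2_rv M X" shows "\<bar>LINT \<omega>|M. X \<omega>\<bar> \<le> l2norm M X"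
proof -
  have "(LINT \<omega>|M. X \<omega>)\<^sup>2 \<le> (l2norm M X)\<^sup>2"
    using L2_Cauchy_Schwarz[OF assms, of "\<lambda>_. 1"] by (simp add: L2_rv_def l2norm_power2 prob_space)
  then show ?thesis by (metis abs_le_square_iff abs_of_nonneg l2norm_nonneg)
qed

lemma (in prob_space) tendsto_L2_moments:
  assumes "tendsto_L2 M Y L F"
  shows "((\<lambda>i. LINT \<omega>|M. Y i \<omega>) \<longlongrightarrow> (LINT \<omega>|M. L \<omega>)) F"
    and "((\<lambda>i. l2norm M (Y i)) \<longlongrightarrow> l2norm M L) F"
proof -
  have L: "L2_rv M L" and ev: "\<forall>\<^sub>F i in F. L2_rv M (Y i)"
    and lim: "((\<lambda>i. l2norm M (\<lambda>\<omega>. Y i \<omega> - L \<omega>)) \<longlongrightarrow> 0) F"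
    using assms by (auto simp: tendsto_L2_iff_l2norm)
  have "((\<lambda>i. (LINT \<omega>|M. Y i \<omega>) - (LINT \<omega>|M. L \<omega>)) \<longlongrightarrow> 0) F"
  proof (rule Lim_null_comparison[OF _ lim], rule eventually_mono[OF ev])
    fix i assume "L2_rv M (Y i)"
    then show "norm ((LINT \<omega>|M. Y i \<omega>) - (LINT \<omega>|M. L \<omega>)) \<le> l2norm M (\<lambda>\<omega>. Y i \<omega> - L \<omega>)"
      using abs_expectation_le_l2norm[OF L2_rv_diff[OF _ L]] L2_rv_integrable L by simp
  qed
  then show "((\<lambda>i. LINT \<omega>|M. Y i \<omega>) \<longlongrightarrow> (LINT \<omega>|M. L \<omega>)) F"
    by (rule LIM_zero_cancel)
  have "((\<lambda>i. l2norm M (Y i) - l2norm M L) \<longlongrightarrow> 0) F"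
  proof (rule Lim_null_comparison[OF _ lim], rule eventually_mono[OF ev])
    fix i assume Y: "L2_rv M (Y i)"
    show "norm (l2norm M (Y i) - l2norm M L) \<le> l2norm M (\<lambda>\<omega>. Y i \<omega> - L \<omega>)"
      using l2norm_triangle[OF L2_rv_diff[OF Y L] L] l2norm_triangle[OF L2_rv_diff[OF L Y] Y]
      by (simp add: l2norm_minus_commute[of M L])
  qed
  then show "((\<lambda>i. l2norm M (Y i)) \<longlongrightarrow> l2norm M L) F"
    by (rule LIM_zero_cancel)
qed

lemma (in prob_space) prob_abs_ge_le_l2norm:
  assumes W: "L2_rv M W" and r: "0 < r"
  shows "prob {\<omega> \<in> space M. r \<le> \<bar>W \<omega>\<bar>} \<le> (l2norm M W)\<^sup>2 / r\<^sup>2"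
proof -
  have [measurable]: "W \<in> borel_measurable M" using W by (rule L2_rv_measurable)
  let ?A = "{\<omega> \<in> space M. r \<le> \<bar>W \<omega>\<bar>}"
  have A: "?A \<in> events" by measurable
  have "r\<^sup>2 * prob ?A = expectation (\<lambda>\<omega>. r\<^sup>2 * indicator ?A \<omega>)"
    using A by simp
  also have "\<dots> \<le> expectation (\<lambda>\<omega>. (W \<omega>)\<^sup>2)"
  proof (rule integral_mono)
    show "integrable M (\<lambda>\<omega>. r\<^sup>2 * indicator ?A \<omega> :: real)"
      using A by (intro integrable_mult_right integrable_real_indicator) (auto simp: less_top[symmetric])
    show "integrable M (\<lambda>\<omega>. (W \<omega>)\<^sup>2)" using W by (rule L2_rv_square_integrable)
    fix \<omega>
    have "r\<^sup>2 \<le> (W \<omega>)\<^sup>2" if "r \<le> \<bar>W \<omega>\<bar>"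
      using that r by (simp add: abs_le_square_iff[symmetric])
    then show "r\<^sup>2 * indicator ?A \<omega> \<le> (W \<omega>)\<^sup>2" by (auto split: split_indicator)
  qed
  finally show ?thesis using r by (simp add: l2norm_power2 field_simps)
qed

lemma (in prob_space) L2_rv_dominated:
  assumes Y: "L2_rv M Y" and X: "X \<in> borel_measurable M" and le: "\<And>\<omega>. \<omega> \<in> space M \<Longrightarrow> \<bar>X \<omega>\<bar> \<le> \<bar>Y \<omega>\<bar>"
  shows "L2_rv M X" and "l2norm M X \<le> l2norm M Y"
proof -
  have sq: "(X \<omega>)\<^sup>2 \<le> (Y \<omega>)\<^sup>2" if "\<omega> \<in> space M" for \<omega>
    using le[OF that] by (simp add: abs_le_square_iff[symmetric])
  have "integrable M (\<lambda>\<omega>. (X \<omega>)\<^sup>2)"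
    by (rule Bochner_Integration.integrable_bound[OF L2_rv_square_integrable[OF Y]]) (use X sq in auto)
  then show "L2_rv M X" using X by (simp add: L2_rv_def)
  show "l2norm M X \<le> l2norm M Y"
    unfolding l2norm_def using sq \<open>integrable M (\<lambda>\<omega>. (X \<omega>)\<^sup>2)\<close> L2_rv_square_integrable[OF Y]
    by (intro real_sqrt_le_mono integral_mono) auto
qed

lemma l2norm_const: "prob_space M \<Longrightarrow> l2norm M (\<lambda>\<omega>. c) = \<bar>c\<bar>"
  by (simp add: l2norm_def prob_space.prob_space)

section \<open>Pathwise integrals of square-integrable processes\<close>

text \<open>The mean-square norm of a weighted time average is at most the total weight times a
uniform bound for the norms of the averaged variables. Cauchy-Schwarz with respect to the
measure \<open>q dt\<close> bounds the squared integral path by path by \<open>(\<integral> q) (\<integral> q G\<^sup>2)\<close>, and Tonelli evaluates the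
expectation of the second factor. Every estimate of a mean-square integral below is an
instance.\<close>

lemma (in prob_space) weighted_integral_L2:
  fixes q :: "real \<Rightarrow> real" and G :: "real \<Rightarrow> 'a \<Rightarrow> real"
  assumes q: "integrable lborel q" "\<And>t. 0 \<le> q t"
    and G [measurable]: "case_prod G \<in> borel_measurable (lborel \<Otimes>\<^sub>M M)"
    and bnd: "\<And>t. q t \<noteq> 0 \<Longrightarrow> integrable M (\<lambda>\<omega>. (G t \<omega>)\<^sup>2)"
      "\<And>t. q t \<noteq> 0 \<Longrightarrow> (LINT \<omega>|M. (G t \<omega>)\<^sup>2) \<le> C"
    and C: "0 \<le> C"
  shows "AE \<omega> in M. integrable lborel (\<lambda>t. q t * G t \<omega>)"
    and "L2_rv M (\<lambda>\<omega>. LINT t|lborel. q t * G t \<omega>)"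
    and "l2norm M (\<lambda>\<omega>. LINT t|lborel. q t * G t \<omega>) \<le> (LINT t|lborel. q t) * sqrt C"
proof -
  interpret P: pair_sigma_finite lborel M ..
  have qm [measurable]: "q \<in> borel_measurable borel" using q(1) by (auto dest: borel_measurable_integrable)
  let ?Q = "LINT t|lborel. q t"
  have Q: "0 \<le> ?Q" using q by simp
  have Gm': "(\<lambda>(\<omega>, t). G t \<omega>) \<in> borel_measurable (M \<Otimes>\<^sub>M lborel)"
    using measurable_compose[OF measurable_pair_swap' G] by (simp add: split_beta' )
  note [measurable] = Gm'
  have Gs [measurable]: "(\<lambda>\<omega>. G t \<omega>) \<in> borel_measurable M" for t
    using measurable_compose[OF measurable_Pair1' G, of t] by simp
  have Gt [measurable]: "(\<lambda>t. G t \<omega>) \<in> borel_measurable lborel" if "\<omega> \<in> space M" for \<omega>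
    using measurable_compose[OF measurable_Pair2'[OF that] G] by simp
  let ?S = "\<lambda>\<omega>. \<integral>\<^sup>+ t. ennreal (q t * (G t \<omega>)\<^sup>2) \<partial>lborel"
  have Sm [measurable]: "?S \<in> borel_measurable M" by measurable
  have "(\<integral>\<^sup>+ \<omega>. ?S \<omega> \<partial>M) = (\<integral>\<^sup>+ t. (\<integral>\<^sup>+ \<omega>. ennreal (q t * (G t \<omega>)\<^sup>2) \<partial>M) \<partial>lborel)"
    by (rule P.Fubini') measurable
  also have "\<dots> \<le> (\<integral>\<^sup>+ t. ennreal (q t * C) \<partial>lborel)"
  proof (rule nn_integral_mono)
    fix t
    show "(\<integral>\<^sup>+ \<omega>. ennreal (q t * (G t \<omega>)\<^sup>2) \<partial>M) \<le> ennreal (q t * C)"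
    proof (cases "q t = 0")
      case False
      have "(\<integral>\<^sup>+ \<omega>. ennreal (q t * (G t \<omega>)\<^sup>2) \<partial>M) = ennreal (LINT \<omega>|M. q t * (G t \<omega>)\<^sup>2)"
        using bnd(1)[OF False] q(2) by (intro nn_integral_eq_integral) auto
      also have "\<dots> \<le> ennreal (q t * C)"
        using bnd(2)[OF False] q(2) by (intro ennreal_leI) (auto intro!: mult_left_mono)
      finally show ?thesis .
    qed simp
  qed
  also have "\<dots> = ennreal (?Q * C)"
    using q C by (subst nn_integral_eq_integral) (auto)
  finally have tot: "(\<integral>\<^sup>+ \<omega>. ?S \<omega> \<partial>M) \<le> ennreal (?Q * C)" .
  have AEfin: "AE \<omega> in M. ?S \<omega> \<noteq> \<infinity>"
    using tot by (intro nn_integral_noteq_infinite) (auto simp: top_unique)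
  have path: "integrable lborel (\<lambda>t. q t * G t \<omega>) \<and>
      ennreal ((LINT t|lborel. q t * G t \<omega>)\<^sup>2) \<le> ennreal ?Q * ?S \<omega>"
    if fin: "?S \<omega> \<noteq> \<infinity>" and [measurable]: "\<omega> \<in> space M" for \<omega>
  proof -
    have int2: "integrable lborel (\<lambda>t. q t * (G t \<omega>)\<^sup>2)"
      using fin q(2) by (intro integrableI_nonneg) (auto simp: less_top)
    have X: "L2_rv lborel (\<lambda>t. sqrt (q t))"
      using q by (simp add: L2_rv_def)
    have Y: "L2_rv lborel (\<lambda>t. sqrt (q t) * G t \<omega>)"
      using q int2 by (simp add: L2_rv_def power_mult_distrib)
    have eq: "sqrt (q t) * (sqrt (q t) * G t \<omega>) = q t * G t \<omega>" for t
      using q(2)[of t] by (simp add: mult.assoc[symmetric])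
    have i: "integrable lborel (\<lambda>t. q t * G t \<omega>)"
      using L2_rv_mult_integrable[OF X Y] by (simp add: eq)
    have "(LINT t|lborel. q t * G t \<omega>)\<^sup>2 \<le> ?Q * (LINT t|lborel. q t * (G t \<omega>)\<^sup>2)"
      using L2_Cauchy_Schwarz[OF X Y] q(2) by (simp add: eq power_mult_distrib)
    then have "ennreal ((LINT t|lborel. q t * G t \<omega>)\<^sup>2)
        \<le> ennreal (?Q * (LINT t|lborel. q t * (G t \<omega>)\<^sup>2))" by (rule ennreal_leI)
    also have "\<dots> = ennreal ?Q * ?S \<omega>"
      using q int2 Q by (subst nn_integral_eq_integral) (auto simp: ennreal_mult')
    finally show ?thesis using i by blast
  qed
  show "AE \<omega> in M. integrable lborel (\<lambda>t. q t * G t \<omega>)"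
    using AEfin AE_space by eventually_elim (use path in blast)
  let ?J = "\<lambda>\<omega>. LINT t|lborel. q t * G t \<omega>"
  have Jm [measurable]: "?J \<in> borel_measurable M" by measurable
  have "(\<integral>\<^sup>+ \<omega>. ennreal ((?J \<omega>)\<^sup>2) \<partial>M) \<le> (\<integral>\<^sup>+ \<omega>. ennreal ?Q * ?S \<omega> \<partial>M)"
  proof (rule nn_integral_mono_AE)
    show "AE \<omega> in M. ennreal ((?J \<omega>)\<^sup>2) \<le> ennreal ?Q * ?S \<omega>"
      using AEfin AE_space by eventually_elim (use path in blast)
  qed
  also have "\<dots> = ennreal ?Q * (\<integral>\<^sup>+ \<omega>. ?S \<omega> \<partial>M)"
    by (rule nn_integral_cmult) measurable
  also have "\<dots> \<le> ennreal ?Q * ennreal (?Q * C)"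
    using tot by (intro mult_left_mono) auto
  also have "\<dots> = ennreal (?Q\<^sup>2 * C)"
    using Q C by (simp add: ennreal_mult'[symmetric] power2_eq_square mult.assoc)
  finally have le: "(\<integral>\<^sup>+ \<omega>. ennreal ((?J \<omega>)\<^sup>2) \<partial>M) \<le> ennreal (?Q\<^sup>2 * C)" .
  have int: "integrable M (\<lambda>\<omega>. (?J \<omega>)\<^sup>2)"
    using le_less_trans[OF le ennreal_less_top] by (intro integrableI_nonneg) auto
  then show "L2_rv M ?J" by (simp add: L2_rv_def)
  have "ennreal (LINT \<omega>|M. (?J \<omega>)\<^sup>2) \<le> ennreal (?Q\<^sup>2 * C)"
    using le int by (subst (asm) nn_integral_eq_integral) auto
  then have "(LINT \<omega>|M. (?J \<omega>)\<^sup>2) \<le> ?Q\<^sup>2 * C"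
    using C by (simp add: ennreal_le_iff)
  then have "l2norm M ?J \<le> sqrt (?Q\<^sup>2 * C)"
    unfolding l2norm_def by (rule real_sqrt_le_mono)
  then show "l2norm M ?J \<le> ?Q * sqrt C"
    using Q by (simp add: real_sqrt_mult)
qed

section \<open>Normal laws and convergence in law\<close>

lemma normal_law_eq_density:
  "0 < v \<Longrightarrow> normal_law c v = density lborel (normal_density c (sqrt v))"
  by (simp add: normal_law_def)

lemma distributed_normal_law:
  assumes "Y \<in> borel_measurable M" "distr M borel Y = normal_law c v" "0 < v"
  shows "distributed M lborel Y (normal_density c (sqrt v))"
proof -
  have "distr M lborel Y = distr M borel Y" by (rule distr_cong) auto
  then show ?thesis using assms by (simp add: distributed_def normal_law_eq_density)
qed

lemma (in prob_space) normal_law_moments: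
  assumes Y [measurable]: "Y \<in> borel_measurable M"
    and law: "distr M borel Y = normal_law c v" and v: "0 \<le> v"
  shows "L2_rv M Y" and "expectation Y = c" and "variance Y = v"
proof -
  have "L2_rv M Y \<and> expectation Y = c \<and> variance Y = v"
  proof (cases "v = 0")
    case True
    then have d: "distr M borel Y = return borel c"
      using law by (simp add: normal_law_def)
    have "AE y in distr M borel Y. y = c"
      unfolding d by (subst AE_return) auto
    then have ae: "AE \<omega> in M. Y \<omega> = c"
      by (subst (asm) AE_distr_iff) auto
    have "L2_rv M Y"
      by (rule L2_rv_AE_cong[where X="\<lambda>_. c"]) (use ae in \<open>auto simp: L2_rv_def\<close>)
    moreover have e: "expectation Y = c"
      using integral_cong_AE[of Y M "\<lambda>_. c"] ae by (simp add: prob_space)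
    moreover have "variance Y = (LINT \<omega>|M. 0)"
      using ae e by (intro integral_cong_AE) auto
    ultimately show ?thesis using True by simp
  next
    case False
    with v have v: "0 < v" "0 < sqrt v" by auto
    note D = distributed_normal_law[OF Y law v(1)]
    have "integrable M (\<lambda>\<omega>. (Y \<omega> - c) ^ 2)"
      using distributed_integrable[OF D, of "\<lambda>x. (x - c)^2"] integrable_normal_moment[of "sqrt v" c 2] v
      by simp
    then have "L2_rv M (\<lambda>\<omega>. Y \<omega> - c)" by (simp add: L2_rv_def)
    from L2_rv_add[OF this, of "\<lambda>_. c"] have "L2_rv M Y"
      by (simp add: L2_rv_def)
    then show ?thesis
      using normal_distributed_expectation[OF v(2) D] normal_distributed_variance[OF v(2) D] v by simp
  qed
  then show "L2_rv M Y" "expectation Y = c" "variance Y = v" by auto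
qed

abbreviation std_normal_law :: "real measure" where
  "std_normal_law \<equiv> density lborel std_normal_density"

lemma cdf_normal_density:
  assumes "0 < \<sigma>"
  shows "cdf (density lborel (normal_density c \<sigma>)) x = cdf std_normal_law ((x - c) / \<sigma>)"
proof -
  let ?N = "density lborel (normal_density c \<sigma>)"
  interpret N: prob_space ?N using assms by (rule prob_space_normal_density)
  have "distr ?N lborel (\<lambda>x. x) = ?N" by (rule distr_id2) simp
  then have "distributed ?N lborel (\<lambda>x. x) (normal_density c \<sigma>)"
    by (simp add: distributed_def)
  then have "distributed ?N lborel (\<lambda>x. (x - c) / \<sigma>) std_normal_density"
    using N.normal_standard_normal_convert[OF assms, of "\<lambda>x. x" c] by simp
  then have "std_normal_law = distr ?N lborel (\<lambda>x. (x - c) / \<sigma>)"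
    by (simp add: distributed_def)
  then have "cdf std_normal_law ((x - c) / \<sigma>) = measure ?N {y. (y - c) / \<sigma> \<le> (x - c) / \<sigma>}"
    by (simp add: cdf_def measure_distr vimage_def)
  also have "{y. (y - c) / \<sigma> \<le> (x - c) / \<sigma>} = {..x}"
    using assms by (auto simp: divide_right_mono divide_le_cancel)
  finally show ?thesis by (simp add: cdf_def)
qed

lemma isCont_cdf_std_normal: "isCont (cdf std_normal_law) x"
proof -
  interpret prob_space std_normal_law by (rule prob_space_normal_density) simp
  interpret finite_borel_measure std_normal_law by unfold_locales auto
  have "emeasure std_normal_law {x} = 0"
    by (subst emeasure_density) (auto simp: nn_integral_0_iff_AE intro!: AE_mp[OF AE_lborel_singleton[of x]])
  then show ?thesis by (simp add: isCont_cdf measure_def)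
qed

text \<open>A normal distribution function is the standard one composed with an affine map, hence
it depends continuously on mean and variance as long as the variance
stays positive.\<close>

lemma (in prob_space) converges_in_law_affine_normal:
  assumes Y: "\<And>n. Y n \<in> borel_measurable M" "\<And>n. distr M borel (Y n) = normal_law 0 (v n)"
    and v: "\<And>n. 0 \<le> v n" "(\<lambda>n. (\<alpha> n)\<^sup>2 * v n) \<longlonglongrightarrow> V" "0 < V"
    and \<beta>: "\<beta> \<longlonglongrightarrow> 0"
  shows "converges_in_law M (\<lambda>n \<omega>. \<beta> n + \<alpha> n * Y n \<omega>) (normal_law 0 V)"
  unfolding converges_in_law_def weak_conv_m_def weak_conv_def
proof (intro allI impI)
  fix x
  have "\<forall>\<^sub>F n in sequentially. 0 < (\<alpha> n)\<^sup>2 * v n" using v(2,3) by (rule order_tendstoD)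
  then have "\<forall>\<^sub>F n in sequentially. cdf std_normal_law ((x - \<beta> n) / sqrt ((\<alpha> n)\<^sup>2 * v n))
      = cdf (distr M borel (\<lambda>\<omega>. \<beta> n + \<alpha> n * Y n \<omega>)) x"
  proof (rule eventually_mono)
    fix n assume pos: "0 < (\<alpha> n)\<^sup>2 * v n"
    then have \<alpha>: "\<alpha> n \<noteq> 0" and vn: "0 < v n" using v(1)[of n] by (auto simp: zero_less_mult_iff)
    have s: "\<bar>\<alpha> n\<bar> * sqrt (v n) = sqrt ((\<alpha> n)\<^sup>2 * v n)" by (simp add: real_sqrt_mult)
    have "distributed M lborel (\<lambda>\<omega>. \<beta> n + \<alpha> n * Y n \<omega>) (normal_density (\<beta> n) (sqrt ((\<alpha> n)\<^sup>2 * v n)))"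
      using normal_density_affine[OF distributed_normal_law[OF Y vn] _ \<alpha>, of "\<beta> n"] vn s by simp
    moreover have "distr M lborel (\<lambda>\<omega>. \<beta> n + \<alpha> n * Y n \<omega>) = distr M borel (\<lambda>\<omega>. \<beta> n + \<alpha> n * Y n \<omega>)"
      by (rule distr_cong) auto
    ultimately have "distr M borel (\<lambda>\<omega>. \<beta> n + \<alpha> n * Y n \<omega>)
        = density lborel (normal_density (\<beta> n) (sqrt ((\<alpha> n)\<^sup>2 * v n)))"
      by (simp add: distributed_def)
    then show "cdf std_normal_law ((x - \<beta> n) / sqrt ((\<alpha> n)\<^sup>2 * v n))
      = cdf (distr M borel (\<lambda>\<omega>. \<beta> n + \<alpha> n * Y n \<omega>)) x"
      using cdf_normal_density[of "sqrt ((\<alpha> n)\<^sup>2 * v n)" "\<beta> n" x] pos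
      by (metis real_sqrt_gt_0_iff)
  qed
  moreover have "(\<lambda>n. cdf std_normal_law ((x - \<beta> n) / sqrt ((\<alpha> n)\<^sup>2 * v n)))
      \<longlonglongrightarrow> cdf std_normal_law ((x - 0) / sqrt V)"
    using v \<beta> by (intro isCont_tendsto_compose[OF isCont_cdf_std_normal] tendsto_intros) auto
  moreover have "cdf std_normal_law ((x - 0) / sqrt V) = cdf (normal_law 0 V) x"
    using v(3) cdf_normal_density[of "sqrt V" 0 x] by (simp add: normal_law_eq_density)
  ultimately show "(\<lambda>n. cdf (distr M borel (\<lambda>\<omega>. \<beta> n + \<alpha> n * Y n \<omega>)) x) \<longlonglongrightarrow> cdf (normal_law 0 V) x"
    using Lim_transform_eventually by fastforce
qed

text \<open>The distribution functions of two variables differ at every point by at most the probability that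
the variables are different.\<close>

lemma (in prob_space) converges_in_law_eventually_equal:
  assumes Y: "converges_in_law M Y N"
    and meas: "\<forall>\<^sub>F n in sequentially. Y n \<in> borel_measurable M \<and> Y' n \<in> borel_measurable M"
    and neq: "(\<lambda>n. prob {\<omega> \<in> space M. Y n \<omega> \<noteq> Y' n \<omega>}) \<longlonglongrightarrow> 0"
  shows "converges_in_law M Y' N"
  unfolding converges_in_law_def weak_conv_m_def weak_conv_def
proof (intro allI impI)
  fix x assume "isCont (cdf N) x"
  then have lim: "(\<lambda>n. cdf (distr M borel (Y n)) x) \<longlonglongrightarrow> cdf N x"
    using Y by (simp add: converges_in_law_def weak_conv_m_def weak_conv_def)
  have "(\<lambda>n. cdf (distr M borel (Y' n)) x - cdf (distr M borel (Y n)) x) \<longlonglongrightarrow> 0"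
  proof (rule Lim_null_comparison[OF _ neq], rule eventually_mono[OF meas])
    fix n assume "Y n \<in> borel_measurable M \<and> Y' n \<in> borel_measurable M"
    then have [measurable]: "Y n \<in> borel_measurable M" "Y' n \<in> borel_measurable M" by auto
    let ?A = "{\<omega> \<in> space M. Y n \<omega> \<le> x}" and ?B = "{\<omega> \<in> space M. Y' n \<omega> \<le> x}"
      and ?D = "{\<omega> \<in> space M. Y n \<omega> \<noteq> Y' n \<omega>}"
    have ev: "?A \<in> events" "?B \<in> events" "?D \<in> events" by measurable
    have "prob ?A \<le> prob (?B \<union> ?D)" "prob ?B \<le> prob (?A \<union> ?D)"
      using ev by (auto intro!: finite_measure_mono)
    then have "\<bar>prob ?B - prob ?A\<bar> \<le> prob ?D"
      using measure_Un_le[of ?B M ?D] measure_Un_le[of ?A M ?D] ev by linarith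
    moreover have "cdf (distr M borel (Y n)) x = prob ?A" "cdf (distr M borel (Y' n)) x = prob ?B"
      by (auto simp: cdf_def measure_distr vimage_def Int_def intro!: arg_cong[where f=prob])
    ultimately show "norm (cdf (distr M borel (Y' n)) x - cdf (distr M borel (Y n)) x) \<le> prob ?D"
      by simp
  qed
  from tendsto_add[OF this lim] show "(\<lambda>n. cdf (distr M borel (Y' n)) x) \<longlonglongrightarrow> cdf N x" by simp
qed

section \<open>Stationary Gaussian processes and their measurable versions\<close>

text \<open>The variables whose law a Gaussian process prescribes; closure under linear operations places
the noise score among them.\<close>

definition finite_span :: "(real \<Rightarrow> 'w \<Rightarrow> real) \<Rightarrow> ('w \<Rightarrow> real) set" where
  "finite_span Z = {Y. \<exists>I c. finite I \<and> I \<subseteq> {0..} \<and> Y = (\<lambda>\<omega>. \<Sum>t\<in>I. c t * Z t \<omega>)}"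

lemma finite_span_base: "0 \<le> t \<Longrightarrow> Z t \<in> finite_span Z"
  unfolding finite_span_def by (intro CollectI exI[of _ "{t}"] exI[of _ "\<lambda>_. 1"]) auto

lemma finite_span_cmult: "Y \<in> finite_span Z \<Longrightarrow> (\<lambda>\<omega>. r * Y \<omega>) \<in> finite_span Z"
proof -
  assume "Y \<in> finite_span Z"
  then obtain I c where "finite I" "I \<subseteq> {0..}" "Y = (\<lambda>\<omega>. \<Sum>t\<in>I. c t * Z t \<omega>)"
    by (auto simp: finite_span_def)
  then show ?thesis unfolding finite_span_def
    by (intro CollectI exI[of _ I] exI[of _ "\<lambda>t. r * c t"]) (auto simp: sum_distrib_left mult.assoc)
qed

lemma finite_span_add:
  assumes "X \<in> finite_span Z" "Y \<in> finite_span Z"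
  shows "(\<lambda>\<omega>. X \<omega> + Y \<omega>) \<in> finite_span Z"
proof -
  obtain I c where X: "finite I" "I \<subseteq> {0..}" "X = (\<lambda>\<omega>. \<Sum>t\<in>I. c t * Z t \<omega>)"
    using assms(1) by (auto simp: finite_span_def)
  obtain J d where Y: "finite J" "J \<subseteq> {0..}" "Y = (\<lambda>\<omega>. \<Sum>t\<in>J. d t * Z t \<omega>)"
    using assms(2) by (auto simp: finite_span_def)
  define e where "e = (\<lambda>t. (if t \<in> I then c t else 0) + (if t \<in> J then d t else 0))"
  have "X \<omega> + Y \<omega> = (\<Sum>t\<in>I \<union> J. e t * Z t \<omega>)" for \<omega>
  proof -
    have "X \<omega> = (\<Sum>t\<in>I \<union> J. (if t \<in> I then c t else 0) * Z t \<omega>)"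
      unfolding X(3) using X(1) Y(1) by (intro sum.mono_neutral_cong_left) auto
    moreover have "Y \<omega> = (\<Sum>t\<in>I \<union> J. (if t \<in> J then d t else 0) * Z t \<omega>)"
      unfolding Y(3) using X(1) Y(1) by (intro sum.mono_neutral_cong_left) auto
    ultimately show ?thesis by (simp add: e_def sum.distrib distrib_right)
  qed
  then show ?thesis using X Y unfolding finite_span_def
    by (intro CollectI exI[of _ "I \<union> J"] exI[of _ e]) auto
qed

lemma finite_span_diff:
  "X \<in> finite_span Z \<Longrightarrow> Y \<in> finite_span Z \<Longrightarrow> (\<lambda>\<omega>. X \<omega> - Y \<omega>) \<in> finite_span Z"
  using finite_span_add[OF _ finite_span_cmult[of Y Z "-1"], of X] by simp

lemma finite_span_sum:
  assumes "\<And>i. i \<in> J \<Longrightarrow> Y i \<in> finite_span Z"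
  shows "(\<lambda>\<omega>. \<Sum>i\<in>J. Y i \<omega>) \<in> finite_span Z"
proof -
  have 0: "(\<lambda>\<omega>. 0) \<in> finite_span Z"
    unfolding finite_span_def by (intro CollectI exI[of _ "{}"]) auto
  show ?thesis using assms
    by (induction J rule: infinite_finite_induct) (auto simp: 0 finite_span_add)
qed

text \<open>What the Gaussian and the Ornstein-Uhlenbeck kernel have in common. The Lipschitz bound at the
origin makes \<open>Z\<close> Hoelder continuous of order one half in mean square.\<close>

locale lipschitz_gaussian = prob_space M
  for M :: "'w measure" and Z :: "real \<Rightarrow> 'w \<Rightarrow> real" and K :: "real \<Rightarrow> real" and L :: real +
  assumes gaussian: "centered_stationary_gaussian M Z K"
    and K_pos: "0 < K 0"
    and K_nonneg: "\<And>u. 0 \<le> u \<Longrightarrow> 0 \<le> K u"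
    and K_less: "\<And>u. 0 < u \<Longrightarrow> K u < K 0"
    and K_lipschitz: "\<And>u. 0 \<le> u \<Longrightarrow> K 0 - K u \<le> L * u"
begin

lemma L_nonneg: "0 \<le> L"
  using K_lipschitz[of 1] K_less[of 1] by simp

lemma K_le: "0 \<le> u \<Longrightarrow> K u \<le> K 0"
  using K_less[of u] by (cases "u = 0") auto

lemma Z_measurable [measurable]: "0 \<le> t \<Longrightarrow> Z t \<in> borel_measurable M"
  using gaussian by (simp add: centered_stationary_gaussian_def gaussian_process_def)

lemma Z_cov: "0 \<le> s \<Longrightarrow> 0 \<le> t \<Longrightarrow> expectation (\<lambda>\<omega>. Z s \<omega> * Z t \<omega>) = K \<bar>s - t\<bar>"
  using gaussian by (simp add: centered_stationary_gaussian_def)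

text \<open>Being a Gaussian process fixes the shape of the law only, with unknown parameters; square integrability
follows from the moments of normal laws, and then the parameters are read off from the mean
and the second moment.\<close>

lemma finite_span_law:
  assumes "Y \<in> finite_span Z"
  shows "L2_rv M Y" and "expectation Y = 0" and "distr M borel Y = normal_law 0 ((l2norm M Y)\<^sup>2)"
proof -
  obtain I c where I: "finite I" "I \<subseteq> {0..}" and Y: "Y = (\<lambda>\<omega>. \<Sum>t\<in>I. c t * Z t \<omega>)"
    using assms by (auto simp: finite_span_def)
  have gp: "\<And>I c. finite I \<and> I \<subseteq> {0..} \<Longrightarrow>
      \<exists>\<mu> v. v \<ge> 0 \<and> distr M borel (\<lambda>\<omega>. \<Sum>t\<in>I. c t * Z t \<omega>) = normal_law \<mu> v"
    using gaussian by (simp add: centered_stationary_gaussian_def gaussian_process_def)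
  have base: "L2_rv M (Z t)" if "0 \<le> t" for t
    using gp[of "{t}" "\<lambda>_. 1"] that normal_law_moments(1)[of "Z t"] Z_measurable[OF that] by auto
  have Ym: "Y \<in> borel_measurable M"
    unfolding Y using I by (intro borel_measurable_sum borel_measurable_times) auto
  obtain c' v where v: "0 \<le> v" "distr M borel Y = normal_law c' v"
    using gp[of I c] I Y by auto
  note mom = normal_law_moments[OF Ym v(2,1)]
  show "L2_rv M Y" by (rule mom)
  have "expectation Y = (\<Sum>t\<in>I. c t * expectation (Z t))"
    unfolding Y using I base[THEN L2_rv_integrable] by (subst Bochner_Integration.integral_sum) auto
  also have "\<dots> = 0"
    using gaussian I by (intro sum.neutral) (auto simp: centered_stationary_gaussian_def)
  finally show E: "expectation Y = 0" .
  then have "c' = 0" using mom by simp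
  moreover have "v = (l2norm M Y)\<^sup>2" using mom(3) E by (simp add: l2norm_power2)
  ultimately show "distr M borel Y = normal_law 0 ((l2norm M Y)\<^sup>2)" using v by simp
qed

lemma Z_L2: "0 \<le> t \<Longrightarrow> L2_rv M (Z t)"
  by (intro finite_span_law finite_span_base)

lemma l2norm_Z: "0 \<le> t \<Longrightarrow> l2norm M (Z t) = sqrt (K 0)"
  using Z_cov[of t t] by (simp add: l2norm_def power2_eq_square)

lemma Z_increment_moment:
  assumes "0 \<le> s" "0 \<le> t"
  shows "expectation (\<lambda>\<omega>. (Z s \<omega> - Z t \<omega>)\<^sup>2) = 2 * (K 0 - K \<bar>s - t\<bar>)"
  using integral_add_square[OF Z_L2[OF assms(1)] Z_L2[OF assms(2)], of "-1"]
    Z_cov[OF assms] Z_cov[OF assms(1,1)] Z_cov[OF assms(2,2)]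
  by (simp add: power2_eq_square)

lemma Z_increment_moment_le:
  assumes "0 \<le> s" "0 \<le> t" "\<bar>s - t\<bar> \<le> d"
  shows "expectation (\<lambda>\<omega>. (Z s \<omega> - Z t \<omega>)\<^sup>2) \<le> 2 * L * d"
  using Z_increment_moment[OF assms(1,2)] K_lipschitz[of "\<bar>s - t\<bar>"]
    mult_left_mono[OF assms(3) L_nonneg] by simp

definition dyadic :: "nat \<Rightarrow> real \<Rightarrow> real" where
  "dyadic k t = real (nat \<lfloor>2 ^ k * t\<rfloor>) / 2 ^ k"

lemma dyadic_bounds:
  assumes "0 \<le> t" shows "0 \<le> dyadic k t" "\<bar>dyadic k t - t\<bar> \<le> 1 / 2 ^ k"
proof -
  show "0 \<le> dyadic k t" by (simp add: dyadic_def)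
  have "\<bar>dyadic k t - t\<bar> = \<bar>real (nat \<lfloor>2 ^ k * t\<rfloor>) - 2 ^ k * t\<bar> / 2 ^ k"
    by (simp add: dyadic_def divide_simps abs_mult abs_div mult.commute)
  also have "\<dots> \<le> 1 / 2 ^ k"
    using assms by (intro divide_right_mono) (auto, linarith)
  finally show "\<bar>dyadic k t - t\<bar> \<le> 1 / 2 ^ k" .
qed

text \<open>A version of \<open>Z\<close> that is jointly measurable in time and chance, so that it may be integrated
along paths. \<^const>\<open>lim\<close> has an unspecified value where the limit does not
exist, which for each non-negative time concerns a null set only.\<close>

definition Zv :: "real \<Rightarrow> 'w \<Rightarrow> real" where
  "Zv t \<omega> = lim (\<lambda>k. Z (dyadic k t) \<omega>)"

text \<open>For fixed \<open>k\<close> the dyadic approximation is a countable patchwork of functions that are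
constant in time.\<close>

lemma Zv_measurable [measurable]: "case_prod Zv \<in> borel_measurable (lborel \<Otimes>\<^sub>M M)"
proof -
  have "(\<lambda>p. Z (dyadic k (fst p)) (snd p)) \<in> borel_measurable (lborel \<Otimes>\<^sub>M M)" for k
    unfolding dyadic_def
  proof (rule measurable_compose_countable[where f="\<lambda>i p. Z (real i / 2 ^ k) (snd p)"
        and g="\<lambda>p. nat \<lfloor>2 ^ k * fst p\<rfloor>"])
    fix i
    have [measurable]: "Z (real i / 2 ^ k) \<in> borel_measurable M" by simp
    show "(\<lambda>p. Z (real i / 2 ^ k) (snd p)) \<in> borel_measurable (lborel \<Otimes>\<^sub>M M)" by measurable
  qed measurable
  then have "(\<lambda>p. lim (\<lambda>k. Z (dyadic k (fst p)) (snd p))) \<in> borel_measurable (lborel \<Otimes>\<^sub>M M)"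
    by (rule borel_measurable_lim_metric)
  then show ?thesis by (simp add: Zv_def split_beta')
qed

lemma Zv_measurable_path [measurable]: "Zv t \<in> borel_measurable M"
  using measurable_compose[OF measurable_Pair1' Zv_measurable, of t] by simp

text \<open>The second moments of \<open>Z (dyadic k t) - Z t\<close> are summable in \<open>k\<close>, so almost surely
the squares are summable, and in particular tend to zero.\<close>

lemma Zv_AE_eq:
  assumes "0 \<le> t" shows "AE \<omega> in M. Zv t \<omega> = Z t \<omega>"
proof -
  let ?D = "\<lambda>k \<omega>. (Z (dyadic k t) \<omega> - Z t \<omega>)\<^sup>2"
  note d = dyadic_bounds[OF assms]
  have [measurable]: "Z (dyadic k t) \<in> borel_measurable M" "Z t \<in> borel_measurable M" for k
    using d assms by auto
  have term_le: "(\<integral>\<^sup>+ \<omega>. ennreal (?D k \<omega>) \<partial>M) \<le> ennreal (2 * L * (1 / 2) ^ k)" for k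
  proof -
    have "(\<integral>\<^sup>+ \<omega>. ennreal (?D k \<omega>) \<partial>M) = ennreal (expectation (?D k))"
      using L2_rv_diff[OF Z_L2[OF d(1)] Z_L2[OF assms]]
      by (intro nn_integral_eq_integral) (auto simp: L2_rv_def)
    also have "\<dots> \<le> ennreal (2 * L * (1 / 2) ^ k)"
      using Z_increment_moment_le[OF d(1) assms d(2)]
      by (intro ennreal_leI) (simp add: power_one_over)
    finally show ?thesis .
  qed
  have "(\<integral>\<^sup>+ \<omega>. (\<Sum>k. ennreal (?D k \<omega>)) \<partial>M) = (\<Sum>k. \<integral>\<^sup>+ \<omega>. ennreal (?D k \<omega>) \<partial>M)"
    by (rule nn_integral_suminf) measurable
  also have "\<dots> \<le> (\<Sum>k. ennreal (2 * L * (1 / 2) ^ k))"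
    by (intro suminf_le term_le) auto
  also have "\<dots> = ennreal (\<Sum>k. 2 * L * (1 / 2) ^ k)"
    using L_nonneg by (intro suminf_ennreal2 summable_mult summable_geometric) auto
  finally have "AE \<omega> in M. (\<Sum>k. ennreal (?D k \<omega>)) \<noteq> \<infinity>"
    by (intro nn_integral_noteq_infinite) (auto simp: top_unique)
  then show ?thesis
  proof (rule AE_mp, intro AE_I2 impI)
    fix \<omega> assume "(\<Sum>k. ennreal (?D k \<omega>)) \<noteq> \<infinity>"
    then have "summable (\<lambda>k. ?D k \<omega>)" by (intro summable_suminf_not_top) auto
    then have "(\<lambda>k. ?D k \<omega>) \<longlonglongrightarrow> 0" by (rule summable_LIMSEQ_zero)
    then have "(\<lambda>k. Z (dyadic k t) \<omega> - Z t \<omega>) \<longlonglongrightarrow> 0"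
      using tendsto_real_sqrt[of _ 0] by (fastforce simp: tendsto_rabs_zero_iff)
    then have "(\<lambda>k. Z (dyadic k t) \<omega>) \<longlonglongrightarrow> Z t \<omega>" by (rule LIM_zero_cancel)
    then show "Zv t \<omega> = Z t \<omega>" unfolding Zv_def by (rule limI)
  qed
qed

lemma Zv_L2: "0 \<le> t \<Longrightarrow> L2_rv M (Zv t)"
  using Zv_AE_eq[of t] by (intro L2_rv_AE_cong[OF _ Zv_measurable_path Z_L2[of t]]) auto

lemma Zv_second_moment: "0 \<le> t \<Longrightarrow> expectation (\<lambda>\<omega>. (Zv t \<omega>)\<^sup>2) = K 0"
  using l2norm_AE_cong[OF Zv_AE_eq[of t]] l2norm_Z[of t] l2norm_power2[of M "Zv t"] K_pos by simp

end

section \<open>Mean-square integrals as pathwise integrals\<close>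

lemma finite_minus_interior_interval:
  fixes k :: "real set"
  assumes "k = cbox c d" shows "finite (k - interior k)"
proof -
  have "k - interior k \<subseteq> {c, d}" using assms by auto
  then show ?thesis by (rule finite_subset) simp
qed

lemma measure_interior_interval:
  fixes k :: "real set"
  assumes "k = cbox c d" shows "measure lborel (interior k) = measure lborel k"
  using assms by (cases "c \<le> d") auto

context lipschitz_gaussian
begin

text \<open>The measurable version replaces \<open>Z\<close>, whose paths need not be measurable in time.\<close>

definition path_integral :: "real set \<Rightarrow> (real \<Rightarrow> real) \<Rightarrow> 'w \<Rightarrow> real" where
  "path_integral A f \<omega> = (LINT t|lborel. indicator A t * (f t * Zv t \<omega>))"

text \<open>The sign of \<open>f\<close> is attached to the process, which leaves \<open>\<bar>f\<bar>\<close> as the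
non-negative weight.\<close>

lemma path_integral_L2:
  assumes A [measurable]: "A \<in> sets borel" and A0: "A \<subseteq> {0..}"
    and f [measurable]: "f \<in> borel_measurable borel"
    and int: "integrable lborel (\<lambda>t. indicator A t * \<bar>f t\<bar>)"
  shows "AE \<omega> in M. integrable lborel (\<lambda>t. indicator A t * (f t * Zv t \<omega>))"
    and "L2_rv M (path_integral A f)"
    and "l2norm M (path_integral A f) \<le> (LINT t|lborel. indicator A t * \<bar>f t\<bar>) * sqrt (K 0)"
proof -
  let ?q = "\<lambda>t. indicator A t * \<bar>f t\<bar>"
  let ?G = "\<lambda>t \<omega>. sgn (f t) * Zv t \<omega>"
  have G: "case_prod ?G \<in> borel_measurable (lborel \<Otimes>\<^sub>M M)"
    by measurable
  have L2: "L2_rv M (?G t)" if "?q t \<noteq> 0" for t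
    using that A0 by (intro L2_rv_cmult Zv_L2) (auto split: split_indicator_asm)
  have le: "expectation (\<lambda>\<omega>. (?G t \<omega>)\<^sup>2) \<le> K 0" if "?q t \<noteq> 0" for t
  proof -
    have "0 \<le> t" using that A0 by (auto split: split_indicator_asm)
    moreover have "f t \<noteq> 0" using that by auto
    then have "(sgn (f t))\<^sup>2 = 1" by (simp add: sgn_if)
    ultimately show ?thesis using Zv_second_moment[of t] by (simp add: power_mult_distrib)
  qed
  have eq: "?q t * ?G t \<omega> = indicator A t * (f t * Zv t \<omega>)" for t \<omega>
    by (simp add: mult.assoc[symmetric] abs_mult_sgn)
  note W = weighted_integral_L2[of ?q ?G "K 0", OF int _ G, unfolded eq]
  show "AE \<omega> in M. integrable lborel (\<lambda>t. indicator A t * (f t * Zv t \<omega>))"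
    using L2 le K_pos by (intro W(1)) (auto simp: L2_rv_def)
  show "L2_rv M (path_integral A f)"
    unfolding path_integral_def[abs_def] using L2 le K_pos by (intro W(2)) (auto simp: L2_rv_def)
  show "l2norm M (path_integral A f) \<le> (LINT t|lborel. indicator A t * \<bar>f t\<bar>) * sqrt (K 0)"
    unfolding path_integral_def[abs_def] using L2 le K_pos by (intro W(3)) (auto simp: L2_rv_def)
qed

lemma path_integral_Un:
  assumes A [measurable]: "A \<in> sets borel" "B \<in> sets borel" and A0: "A \<subseteq> {0..}" "B \<subseteq> {0..}"
    and disj: "A \<inter> B = {}"
    and f [measurable]: "f \<in> borel_measurable borel"
    and int: "integrable lborel (\<lambda>t. indicator A t * \<bar>f t\<bar>)" "integrable lborel (\<lambda>t. indicator B t * \<bar>f t\<bar>)"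
  shows "AE \<omega> in M. path_integral (A \<union> B) f \<omega> = path_integral A f \<omega> + path_integral B f \<omega>"
  using path_integral_L2(1)[OF A(1) A0(1) f int(1)] path_integral_L2(1)[OF A(2) A0(2) f int(2)]
proof eventually_elim
  case (elim \<omega>)
  have "path_integral (A \<union> B) f \<omega> =
    (LINT t|lborel. indicator A t * (f t * Zv t \<omega>) + indicator B t * (f t * Zv t \<omega>))"
    unfolding path_integral_def using disj
    by (intro Bochner_Integration.integral_cong) (auto split: split_indicator)
  also have "\<dots> = path_integral A f \<omega> + path_integral B f \<omega>"
    unfolding path_integral_def using elim by simp
  finally show ?case .
qed

lemma Z_minus_Zv_moment_le:
  assumes "0 \<le> s" "0 \<le> t" "\<bar>s - t\<bar> \<le> d"
  shows "expectation (\<lambda>\<omega>. (Z s \<omega> - Zv t \<omega>)\<^sup>2) \<le> 2 * L * d"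
proof -
  have [measurable]: "Z s \<in> borel_measurable M" "Z t \<in> borel_measurable M" using assms by auto
  have "expectation (\<lambda>\<omega>. (Z s \<omega> - Zv t \<omega>)\<^sup>2) = expectation (\<lambda>\<omega>. (Z s \<omega> - Z t \<omega>)\<^sup>2)"
    using Zv_AE_eq[OF assms(2)] by (intro integral_cong_AE) auto
  then show ?thesis using Z_increment_moment_le[OF assms] by simp
qed

text \<open>Over a short set of times the process may be frozen at a nearby point, with a relative error of the
order of the square root of the distance.\<close>

lemma path_integral_near_point:
  assumes A [measurable]: "A \<in> sets borel" and A0: "A \<subseteq> {0..}" and s: "0 \<le> s"
    and near: "\<And>t. t \<in> A \<Longrightarrow> \<bar>s - t\<bar> \<le> d" and d: "0 \<le> d"
    and f [measurable]: "f \<in> borel_measurable borel"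
    and int: "integrable lborel (\<lambda>t. indicator A t * \<bar>f t\<bar>)"
  shows "l2norm M (\<lambda>\<omega>. (LINT t|lborel. indicator A t * f t) * Z s \<omega> - path_integral A f \<omega>)
    \<le> (LINT t|lborel. indicator A t * \<bar>f t\<bar>) * sqrt (2 * L * d)"
proof -
  have Zs [measurable]: "Z s \<in> borel_measurable M" using s by auto
  let ?q = "\<lambda>t. indicator A t * \<bar>f t\<bar>"
  let ?G = "\<lambda>t \<omega>. sgn (f t) * (Z s \<omega> - Zv t \<omega>)"
  have G: "case_prod ?G \<in> borel_measurable (lborel \<Otimes>\<^sub>M M)"
    by measurable
  have L2: "L2_rv M (?G t)" if "?q t \<noteq> 0" for t
    using that A0 s by (intro L2_rv_cmult L2_rv_diff Zv_L2 Z_L2) (auto split: split_indicator_asm)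
  have le: "expectation (\<lambda>\<omega>. (?G t \<omega>)\<^sup>2) \<le> 2 * L * d" if "?q t \<noteq> 0" for t
  proof -
    have "t \<in> A" "0 \<le> t" using that A0 by (auto split: split_indicator_asm)
    moreover have "f t \<noteq> 0" using that by auto
    then have "(sgn (f t))\<^sup>2 = 1" by (simp add: sgn_if)
    ultimately show ?thesis using Z_minus_Zv_moment_le[OF s \<open>0 \<le> t\<close> near] by (simp add: power_mult_distrib)
  qed
  have eq: "?q t * ?G t \<omega> = indicator A t * f t * Z s \<omega> - indicator A t * (f t * Zv t \<omega>)" for t \<omega>
    by (cases "f t" "0::real" rule: linorder_cases) (simp_all add: algebra_simps)
  note W = weighted_integral_L2[of ?q ?G "2 * L * d", OF int _ G]
  have Wm: "L2_rv M (\<lambda>\<omega>. LINT t|lborel. ?q t * ?G t \<omega>)"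
    using L2 le L_nonneg d by (intro W(2)) (auto simp: L2_rv_def)
  have le': "l2norm M (\<lambda>\<omega>. LINT t|lborel. ?q t * ?G t \<omega>) \<le> (LINT t|lborel. ?q t) * sqrt (2 * L * d)"
    using L2 le L_nonneg d by (intro W(3)) (auto simp: L2_rv_def)
  have int': "integrable lborel (\<lambda>t. indicator A t * f t)"
    using int by (rule Bochner_Integration.integrable_bound) (auto simp: abs_mult)
  have "AE \<omega> in M. (LINT t|lborel. indicator A t * f t) * Z s \<omega> - path_integral A f \<omega>
      = (LINT t|lborel. ?q t * ?G t \<omega>)"
    using path_integral_L2(1)[OF A A0 f int]
    by eventually_elim (simp add: eq path_integral_def int')
  then have "l2norm M (\<lambda>\<omega>. (LINT t|lborel. indicator A t * f t) * Z s \<omega> - path_integral A f \<omega>)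
      = l2norm M (\<lambda>\<omega>. LINT t|lborel. ?q t * ?G t \<omega>)"
    using Wm path_integral_L2(2)[OF A A0 f int] s
    by (intro l2norm_AE_cong) (auto dest: L2_rv_measurable)
  then show ?thesis using le' by simp
qed

text \<open>A Riemann sum is itself the path integral of a step process. Adjacent intervals of
the partition share end points, so the step process is built on the interiors of the intervals;
these are disjoint and cover all but finitely many times.\<close>

lemma riemann_sum_near_path_integral:
  assumes T: "0 \<le> T" and f [measurable]: "f \<in> borel_measurable borel"
    and int: "integrable lborel (\<lambda>t. indicator {0..T} t * \<bar>f t\<bar>)"
    and p: "p tagged_division_of {0..T}"
    and near: "\<And>x k t. (x, k) \<in> p \<Longrightarrow> t \<in> k \<Longrightarrow> l2norm M (\<lambda>\<omega>. f x * Z x \<omega> - f t * Zv t \<omega>) \<le> e"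
    and e: "0 \<le> e"
  shows "l2norm M (\<lambda>\<omega>. (\<Sum>(x,k)\<in>p. measure lborel k * (f x * Z x \<omega>)) - path_integral {0..T} f \<omega>) \<le> T * e"
proof -
  have fin: "finite p" using p by auto
  have el: "x \<in> k" "k \<subseteq> {0..T}" "0 \<le> x" "\<exists>c d. k = cbox c d" if "(x, k) \<in> p" for x k
    using tagged_division_ofD[OF p] that by (auto simp: subset_iff)
  define U where "U = (\<Union>(x,k)\<in>p. interior k)"
  have U [measurable]: "U \<in> sets borel" unfolding U_def by (intro borel_open open_UN) auto
  have U0: "U \<subseteq> {0..T}" unfolding U_def using el(2) interior_subset by fastforce
  let ?q = "indicator U :: real \<Rightarrow> real"
  define R where "R = (\<lambda>t \<omega>. \<Sum>(x,k)\<in>p. indicator (interior k) t * (f x * Z x \<omega>))"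
  let ?G = "\<lambda>t \<omega>. R t \<omega> - f t * Zv t \<omega>"
  have R: "R t \<omega> = f x * Z x \<omega>" if "(x, k) \<in> p" "t \<in> interior k" for x k t \<omega>
  proof -
    have "R t \<omega> = (\<Sum>y\<in>{(x,k)}. (case y of (x,k) \<Rightarrow> indicator (interior k) t * (f x * Z x \<omega>)))"
      unfolding R_def
    proof (intro sum.mono_neutral_right ballI)
      fix y assume y: "y \<in> p - {(x, k)}"
      obtain x' k' where "y = (x', k')" by force
      then show "(case y of (x,k) \<Rightarrow> indicator (interior k) t * (f x * Z x \<omega>)) = 0"
        using tagged_division_ofD(5)[OF p that(1), of x' k'] y that(2) by (auto split: split_indicator)
    qed (use fin that in auto)
    then show ?thesis using that by simp
  qed
  have Rm: "case_prod R \<in> borel_measurable (lborel \<Otimes>\<^sub>M M)"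
    unfolding R_def split_beta'
  proof (rule borel_measurable_sum)
    fix y assume "y \<in> p"
    then have [measurable]: "Z (fst y) \<in> borel_measurable M" using el(3)[of "fst y" "snd y"] by auto
    have [measurable]: "interior (snd y) \<in> sets borel" by (rule borel_open) auto
    show "(\<lambda>x. indicator (interior (snd y)) (fst x) * (f (fst y) * Z (fst y) (snd x))) \<in> borel_measurable (lborel \<Otimes>\<^sub>M M)"
      by measurable
  qed
  note [measurable] = Rm
  have G: "case_prod ?G \<in> borel_measurable (lborel \<Otimes>\<^sub>M M)" by measurable
  have Gle: "L2_rv M (?G t) \<and> expectation (\<lambda>\<omega>. (?G t \<omega>)\<^sup>2) \<le> e\<^sup>2" if "?q t \<noteq> 0" for t
  proof -
    have "t \<in> U" using that by (auto split: split_indicator_asm)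
    then obtain x k where xk: "(x, k) \<in> p" "t \<in> interior k" unfolding U_def by auto
    then have t: "t \<in> k" using interior_subset by blast
    then have t0: "0 \<le> t" using el(2)[OF xk(1)] by auto
    have "L2_rv M (\<lambda>\<omega>. f x * Z x \<omega> - f t * Zv t \<omega>)"
      using t0 el(3)[OF xk(1)] by (intro L2_rv_diff L2_rv_cmult Z_L2 Zv_L2)
    moreover have "(l2norm M (\<lambda>\<omega>. f x * Z x \<omega> - f t * Zv t \<omega>))\<^sup>2 \<le> e\<^sup>2"
      using near[OF xk(1) t] by (intro power_mono) auto
    ultimately show ?thesis by (simp add: R[OF xk] l2norm_power2)
  qed
  have emU: "emeasure lborel U < \<infinity>"
    using emeasure_mono[OF U0, of lborel] T by (auto simp: less_top[symmetric] top_unique)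
  have qi: "integrable lborel ?q" using emU by simp
  note W = weighted_integral_L2[of ?q ?G "e\<^sup>2", OF qi _ G]
  have Wm: "L2_rv M (\<lambda>\<omega>. LINT t|lborel. ?q t * ?G t \<omega>)"
    using Gle by (intro W(2)) (auto simp: L2_rv_def)
  have le': "l2norm M (\<lambda>\<omega>. LINT t|lborel. ?q t * ?G t \<omega>) \<le> (LINT t|lborel. ?q t) * sqrt (e\<^sup>2)"
    using Gle by (intro W(3)) (auto simp: L2_rv_def)
  have "(LINT t|lborel. ?q t) \<le> (LINT t|lborel. indicator {0..T} t)"
    using qi U0 T by (intro integral_mono) (auto split: split_indicator)
  also have "\<dots> = T" using T by simp
  finally have "(LINT t|lborel. ?q t) * sqrt (e\<^sup>2) \<le> T * e" using e by (auto intro!: mult_right_mono)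
  with le' have le: "l2norm M (\<lambda>\<omega>. LINT t|lborel. ?q t * ?G t \<omega>) \<le> T * e" by linarith
  have "finite (\<Union>(x,k)\<in>p. k - interior k)"
  proof (rule finite_UN_I[OF fin])
    fix y assume "y \<in> p"
    moreover obtain x k where y: "y = (x, k)" by force
    ultimately obtain c d where "k = cbox c d" using el(4) by blast
    then show "finite (case y of (x,k) \<Rightarrow> k - interior k)"
      unfolding y prod.case by (rule finite_minus_interior_interval)
  qed
  moreover have "{0..T} - U \<subseteq> (\<Union>(x,k)\<in>p. k - interior k)"
    using tagged_division_ofD(6)[OF p] unfolding U_def by fastforce
  ultimately have "finite ({0..T} - U)" by (rule rev_finite_subset)
  then have "{0..T} - U \<in> null_sets lborel" by (rule finite_imp_null_set_lborel)
  \<comment> \<open>The times lost at the end points of the intervals form a null set.\<close>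
  then have aeU: "AE t in lborel. indicator U t = (indicator {0..T} t :: real)"
    by (rule AE_I') (use U0 in \<open>auto split: split_indicator\<close>)
  have eq: "(\<Sum>(x,k)\<in>p. measure lborel k * (f x * Z x \<omega>)) - path_integral {0..T} f \<omega>
      = (LINT t|lborel. ?q t * ?G t \<omega>)"
    if i: "integrable lborel (\<lambda>t. indicator {0..T} t * (f t * Zv t \<omega>))" and \<omega>: "\<omega> \<in> space M" for \<omega>
  proof -
    have [measurable]: "(\<lambda>t. Zv t \<omega>) \<in> borel_measurable borel"
      using measurable_compose[OF measurable_Pair2'[OF \<omega>] Zv_measurable] by simp
    have ik: "integrable lborel (indicator (interior k) :: real \<Rightarrow> real)" "measure lborel (interior k) = measure lborel k"
      if xk: "(x, k) \<in> p" for x k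
    proof -
      obtain c d where k: "k = cbox c d" using el(4)[OF xk] by blast
      show "integrable lborel (indicator (interior k) :: real \<Rightarrow> real)"
        unfolding k by (cases "c \<le> d") auto
      show "measure lborel (interior k) = measure lborel k"
        using k by (rule measure_interior_interval)
    qed
    have qR: "?q t * R t \<omega> = R t \<omega>" for t
    proof (cases "t \<in> U")
      case False
      then have "R t \<omega> = 0" unfolding R_def U_def by (intro sum.neutral) (auto split: split_indicator)
      then show ?thesis by simp
    qed simp
    have intR: "integrable lborel (\<lambda>t. R t \<omega>)"
      unfolding R_def using ik by (intro Bochner_Integration.integrable_sum) auto
    have "(LINT t|lborel. R t \<omega>) = (\<Sum>y\<in>p. LINT t|lborel. (case y of (x,k) \<Rightarrow> indicator (interior k) t * (f x * Z x \<omega>)))"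
      unfolding R_def using ik by (intro Bochner_Integration.integral_sum) auto
    also have "\<dots> = (\<Sum>(x,k)\<in>p. measure lborel k * (f x * Z x \<omega>))"
      using ik by (intro sum.cong) auto
    finally have LR: "(LINT t|lborel. R t \<omega>) = (\<Sum>(x,k)\<in>p. measure lborel k * (f x * Z x \<omega>))" .
    have aeUZ: "AE t in lborel. ?q t * (f t * Zv t \<omega>) = indicator {0..T} t * (f t * Zv t \<omega>)"
      using aeU by eventually_elim simp
    have iU: "integrable lborel (\<lambda>t. ?q t * (f t * Zv t \<omega>))"
      using i aeUZ by (subst integrable_cong_AE[where g="\<lambda>t. indicator {0..T} t * (f t * Zv t \<omega>)"]) auto
    have "(LINT t|lborel. ?q t * (f t * Zv t \<omega>)) = path_integral {0..T} f \<omega>"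
      unfolding path_integral_def using aeUZ by (intro integral_cong_AE) auto
    then show ?thesis
      using LR intR iU by (simp add: right_diff_distrib qR)
  qed
  have sumL2: "L2_rv M (\<lambda>\<omega>. \<Sum>(x,k)\<in>p. measure lborel k * (f x * Z x \<omega>))"
    unfolding split_beta' using el(3) by (intro L2_rv_sum L2_rv_cmult Z_L2) auto
  have pI: "path_integral {0..T} f \<in> borel_measurable M"
    using path_integral_L2(2)[OF _ _ f int] by (auto dest: L2_rv_measurable)
  have "AE \<omega> in M. integrable lborel (\<lambda>t. indicator {0..T} t * (f t * Zv t \<omega>))"
    using int by (intro path_integral_L2) auto
  then have "AE \<omega> in M. (\<Sum>(x,k)\<in>p. measure lborel k * (f x * Z x \<omega>)) - path_integral {0..T} f \<omega>
      = (LINT t|lborel. ?q t * ?G t \<omega>)"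
    using AE_space by eventually_elim (rule eq)
  then have "l2norm M (\<lambda>\<omega>. (\<Sum>(x,k)\<in>p. measure lborel k * (f x * Z x \<omega>)) - path_integral {0..T} f \<omega>)
      = l2norm M (\<lambda>\<omega>. LINT t|lborel. ?q t * ?G t \<omega>)"
    using L2_rv_measurable[OF sumL2] L2_rv_measurable[OF Wm] pI
    by (intro l2norm_AE_cong) auto
  then show ?thesis using le by simp
qed

lemma integrable_abs_on_Icc:
  assumes "continuous_on {0..T} f"
  shows "integrable lborel (\<lambda>t. indicator {0..T::real} t * \<bar>f t :: real\<bar>)"
  using borel_integrable_compact[of "{0..T}" "\<lambda>t. \<bar>f t\<bar>"] assms
  by (auto intro!: continuous_intros)

text \<open>The mean-square Riemann integral exists because \<open>t \<mapsto> f t Z\<^sub>t\<close> is uniformly continuous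
in mean square on a compact interval.\<close>

lemma has_ms_integral_path_integral:
  assumes T: "0 \<le> T" and f [measurable]: "f \<in> borel_measurable borel"
    and cont: "continuous_on {0..T} f"
  shows "has_ms_integral M (\<lambda>t \<omega>. f t * Z t \<omega>) 0 T (path_integral {0..T} f)"
proof -
  note int = integrable_abs_on_Icc[OF cont]
  let ?R = "\<lambda>p \<omega>. \<Sum>(x,k)\<in>p. measure lborel k * (f x * Z x \<omega>)"
  have pI: "L2_rv M (path_integral {0..T} f)"
    using int by (intro path_integral_L2) auto
  have RL2: "L2_rv M (?R p)" if p: "p tagged_division_of {0..T}" for p
    unfolding split_beta' using tagged_division_ofD[OF p]
    by (intro L2_rv_sum L2_rv_cmult Z_L2) (force simp: subset_iff)
  obtain B where B: "\<And>t. t \<in> {0..T} \<Longrightarrow> \<bar>f t\<bar> \<le> B" "0 \<le> B"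
    using compact_imp_bounded[OF compact_continuous_image[OF cont compact_Icc]] T
    unfolding bounded_iff by (force intro: order_trans[OF abs_ge_zero])
  have unif: "uniformly_continuous_on {0..T} f"
    using cont by (rule compact_uniformly_continuous) simp
  have "\<forall>\<^sub>F p in riemann_filter 0 T. L2_rv M (?R p)"
    unfolding eventually_riemann_filter using RL2 by (intro exI[of _ 1]) auto
  moreover have "((\<lambda>p. l2norm M (\<lambda>\<omega>. ?R p \<omega> - path_integral {0..T} f \<omega>)) \<longlongrightarrow> 0) (riemann_filter 0 T)"
  proof (rule tendstoI)
    fix e :: real assume e: "0 < e"
    define c where "c = e / (T + 1)"
    have c: "0 < c" "T * c < e" using e T by (auto simp: c_def field_simps)
    obtain d1 where d1: "0 < d1"
      "\<And>s t. s \<in> {0..T} \<Longrightarrow> t \<in> {0..T} \<Longrightarrow> dist s t < d1 \<Longrightarrow> dist (f s) (f t) < c / (2 * sqrt (K 0))"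
      using unif c K_pos unfolding uniformly_continuous_on_def
      by (metis divide_pos_pos mult_pos_pos real_sqrt_gt_zero zero_less_numeral)
    define r where "r = c / (2 * (B + 1))"
    have r: "0 < r" "B * r \<le> c / 2" using c B(2) by (auto simp: r_def field_simps)
    define d2 where "d2 = r\<^sup>2 / (2 * (L + 1))"
    have d2: "0 < d2" using r L_nonneg by (simp add: d2_def)
    \<comment> \<open>With these choices freezing the weight and freezing the process cost \<open>c / 2\<close> each.\<close>
    have "2 * L * d2 \<le> r\<^sup>2" using L_nonneg by (simp add: d2_def field_simps)
    then have sq: "sqrt (2 * L * d2) \<le> r" using r by (intro real_le_lsqrt) auto
    have near: "l2norm M (\<lambda>\<omega>. f s * Z s \<omega> - f t * Zv t \<omega>) \<le> c"
      if st: "s \<in> {0..T}" "t \<in> {0..T}" "dist s t < min d1 d2" for s t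
    proof -
      have "l2norm M (\<lambda>\<omega>. (f s - f t) * Z s \<omega>) = \<bar>f s - f t\<bar> * sqrt (K 0)"
        using st l2norm_Z[of s] by (simp add: l2norm_cmult)
      also have "\<dots> \<le> c / (2 * sqrt (K 0)) * sqrt (K 0)"
        using d1(2)[of s t] st K_pos by (intro mult_right_mono) (auto simp: dist_real_def)
      also have "\<dots> = c / 2" using K_pos by simp
      finally have 1: "l2norm M (\<lambda>\<omega>. (f s - f t) * Z s \<omega>) \<le> c / 2" .
      have "l2norm M (\<lambda>\<omega>. f t * (Z s \<omega> - Zv t \<omega>)) = \<bar>f t\<bar> * l2norm M (\<lambda>\<omega>. Z s \<omega> - Zv t \<omega>)"
        by (rule l2norm_cmult)
      also have "\<dots> \<le> B * sqrt (2 * L * d2)"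
        using B st Z_minus_Zv_moment_le[of s t d2] unfolding l2norm_def
        by (intro mult_mono real_sqrt_le_mono) (auto simp: dist_real_def)
      also have "\<dots> \<le> B * r" using sq B(2) by (rule mult_left_mono)
      also have "\<dots> \<le> c / 2" by (rule r)
      finally have 2: "l2norm M (\<lambda>\<omega>. f t * (Z s \<omega> - Zv t \<omega>)) \<le> c / 2" .
      have "l2norm M (\<lambda>\<omega>. (f s - f t) * Z s \<omega> + f t * (Z s \<omega> - Zv t \<omega>)) \<le> c / 2 + c / 2"
        using st by (intro order_trans[OF l2norm_triangle] add_mono 1 2 L2_rv_cmult L2_rv_diff Z_L2 Zv_L2) auto
      then show ?thesis by (simp add: algebra_simps)
    qed
    show "\<forall>\<^sub>F p in riemann_filter 0 T. dist (l2norm M (\<lambda>\<omega>. ?R p \<omega> - path_integral {0..T} f \<omega>)) 0 < e"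
      unfolding eventually_riemann_filter
    proof (intro exI[of _ "min d1 d2"] conjI allI impI)
      show "0 < min d1 d2" using d1 d2 by simp
      fix p assume p: "p tagged_division_of {0..T} \<and> (\<lambda>x. ball x (min d1 d2)) fine p"
      have "l2norm M (\<lambda>\<omega>. ?R p \<omega> - path_integral {0..T} f \<omega>) \<le> T * c"
      proof (rule riemann_sum_near_path_integral[OF T f int])
        show "p tagged_division_of {0..T}" using p by simp
        fix x k t assume xk: "(x, k) \<in> p" "t \<in> k"
        then have "x \<in> k" "k \<subseteq> {0..T}" using tagged_division_ofD[of p "{0..T}"] p by blast+
        moreover have "k \<subseteq> ball x (min d1 d2)" using p xk unfolding fine_def by blast
        ultimately show "l2norm M (\<lambda>\<omega>. f x * Z x \<omega> - f t * Zv t \<omega>) \<le> c"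
          using xk by (intro near) (auto simp: subset_iff)
      qed (use c in auto)
      then show "dist (l2norm M (\<lambda>\<omega>. ?R p \<omega> - path_integral {0..T} f \<omega>)) 0 < e" using c by simp
    qed
  qed
  ultimately show ?thesis
    unfolding has_ms_integral_def tendsto_L2_iff_l2norm
    using pI by (auto intro!: L2_rv_cmult Z_L2)
qed

end

section \<open>The limit variable and its variance\<close>

lemma has_ms_integral_AE_unique:
  assumes "has_ms_integral M X a b Y" "has_ms_integral M X a b Y'"
  shows "AE \<omega> in M. Y \<omega> = Y' \<omega>"
  using assms tendsto_L2_AE_unique[OF riemann_filter_neq_bot] unfolding has_ms_integral_def by blast

text \<open>The choice operator in the definition of the improper integral picks an unknown version; uniqueness
identifies it with the path integral up to a null set.\<close>

lemma has_ms_integral_Ici_AE_unique: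
  assumes "has_ms_integral_Ici M X a Y" "has_ms_integral_Ici M X a Y'"
  shows "AE \<omega> in M. Y \<omega> = Y' \<omega>"
proof -
  obtain I where I: "\<And>T. a \<le> T \<Longrightarrow> has_ms_integral M X a T (I T)" "tendsto_L2 M I Y at_top"
    using assms(1) by (auto simp: has_ms_integral_Ici_def)
  obtain I' where I': "\<And>T. a \<le> T \<Longrightarrow> has_ms_integral M X a T (I' T)" "tendsto_L2 M I' Y' at_top"
    using assms(2) by (auto simp: has_ms_integral_Ici_def)
  have "\<forall>\<^sub>F T in at_top. L2_rv M (I' T) \<and> (AE \<omega> in M. I T \<omega> = I' T \<omega>)"
    using eventually_ge_at_top[of a]
  proof eventually_elim
    case (elim T)
    then show ?case using has_ms_integral_AE_unique[OF I(1) I'(1)] I'(1)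
      by (auto simp: has_ms_integral_def tendsto_L2_def)
  qed
  then have "tendsto_L2 M I' Y at_top" by (rule tendsto_L2_AE_cong[OF I(2)])
  then show ?thesis using I'(2) by (rule tendsto_L2_AE_unique[rotated]) simp
qed

text \<open>Up to the sign, the weight of \<open>Z\<^sub>t\<close> in the limit variable.\<close>

abbreviation powr_deriv :: "real \<Rightarrow> real \<Rightarrow> real" where
  "powr_deriv p t \<equiv> p * (1 + t) powr (p - 1)"

lemma abs_powr_deriv: "p < 0 \<Longrightarrow> \<bar>powr_deriv p t\<bar> = - powr_deriv p t"
  by (simp add: abs_mult)

lemma powr_neg_tendsto_0_at_top:
  assumes "p < 0" shows "((\<lambda>t::real. (1 + t) powr p) \<longlongrightarrow> 0) at_top"
  using assms by (intro tendsto_neg_powr filterlim_tendsto_add_at_top[OF tendsto_const] filterlim_ident)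

lemma has_bochner_integral_powr_deriv_Ioi:
  assumes p: "p < 0" and s: "0 \<le> s"
  shows "has_bochner_integral lborel (\<lambda>t. indicator {s<..} t * \<bar>powr_deriv p t\<bar>) ((1 + s) powr p)"
proof (rule has_bochner_integral_nn_integral)
  have "(\<integral>\<^sup>+ t. ennreal (indicator {s<..} t * \<bar>powr_deriv p t\<bar>) \<partial>lborel)
      = (\<integral>\<^sup>+ t. ennreal (- powr_deriv p t) * indicator {s..} t \<partial>lborel)"
    using AE_lborel_singleton[of s] p
    by (intro nn_integral_cong_AE) (auto simp: abs_mult split: split_indicator)
  also have "\<dots> = ennreal (0 - (- ((1 + s) powr p)))"
  proof (rule nn_integral_FTC_atLeast)
    fix t assume t: "s \<le> t"
    show "((\<lambda>t. - ((1 + t) powr p)) has_real_derivative - powr_deriv p t) (at t)"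
      using t s by (auto intro!: derivative_eq_intros)
    show "0 \<le> - powr_deriv p t" using p by (simp add: mult_le_0_iff)
  next
    show "((\<lambda>t. - ((1 + t) powr p)) \<longlongrightarrow> 0) at_top"
      using tendsto_minus[OF powr_neg_tendsto_0_at_top[OF p]] by simp
  qed measurable
  finally show "(\<integral>\<^sup>+ t. ennreal (indicator {s<..} t * \<bar>powr_deriv p t\<bar>) \<partial>lborel) = ennreal ((1 + s) powr p)"
    by simp
qed auto

lemma has_bochner_integral_powr_deriv_Ioc:
  assumes p: "p < 0" and s: "0 \<le> s" "s \<le> t"
  shows "has_bochner_integral lborel (\<lambda>x. indicator {s<..t} x * \<bar>powr_deriv p x\<bar>) ((1 + s) powr p - (1 + t) powr p)"
proof -
  have "has_bochner_integral lborel
     (\<lambda>x. indicator {s<..} x * \<bar>powr_deriv p x\<bar> - indicator {t<..} x * \<bar>powr_deriv p x\<bar>)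
     ((1 + s) powr p - (1 + t) powr p)"
    using s by (intro has_bochner_integral_diff has_bochner_integral_powr_deriv_Ioi p) auto
  also have "(\<lambda>x. indicator {s<..} x * \<bar>powr_deriv p x\<bar> - indicator {t<..} x * \<bar>powr_deriv p x\<bar>)
      = (\<lambda>x. indicator {s<..t} x * \<bar>powr_deriv p x\<bar>)"
    using s by (auto split: split_indicator)
  finally show ?thesis .
qed

lemma has_bochner_integral_powr_deriv_Ici:
  assumes p: "p < 0"
  shows "has_bochner_integral lborel (\<lambda>t. indicator {0..} t * \<bar>powr_deriv p t\<bar>) 1"
proof -
  have "has_bochner_integral lborel (\<lambda>t. indicator {0<..} t * \<bar>powr_deriv p t\<bar>) 1"
    using has_bochner_integral_powr_deriv_Ioi[OF p, of 0] by simp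
  moreover have "AE t in lborel. indicator {0<..} t * \<bar>powr_deriv p t\<bar> = indicator {0..} t * \<bar>powr_deriv p t\<bar>"
    using AE_lborel_singleton[of 0] by eventually_elim (auto split: split_indicator)
  ultimately show ?thesis
    by (subst (asm) has_bochner_integral_cong_AE) auto
qed

lemma has_bochner_integral_powr_deriv_Icc:
  assumes p: "p < 0" and T: "0 \<le> T"
  shows "has_bochner_integral lborel (\<lambda>x. indicator {0..T} x * \<bar>powr_deriv p x\<bar>) (1 - (1 + T) powr p)"
proof -
  have "has_bochner_integral lborel
     (\<lambda>x. indicator {0..} x * \<bar>powr_deriv p x\<bar> - indicator {T<..} x * \<bar>powr_deriv p x\<bar>)
     (1 - (1 + T) powr p)"
    using T by (intro has_bochner_integral_diff has_bochner_integral_powr_deriv_Ioi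
        has_bochner_integral_powr_deriv_Ici p) auto
  also have "(\<lambda>x. indicator {0..} x * \<bar>powr_deriv p x\<bar> - indicator {T<..} x * \<bar>powr_deriv p x\<bar>)
      = (\<lambda>x. indicator {0..T} x * \<bar>powr_deriv p x\<bar>)"
    using T by (auto split: split_indicator)
  finally show ?thesis .
qed

context lipschitz_gaussian
begin

lemma path_integral_tail:
  assumes p: "p < 0" and T: "0 \<le> T"
  shows "AE \<omega> in M. path_integral {0..} (powr_deriv p) \<omega>
      = path_integral {0..T} (powr_deriv p) \<omega> + path_integral {T<..} (powr_deriv p) \<omega>"
    and "L2_rv M (path_integral {T<..} (powr_deriv p))"
    and "l2norm M (path_integral {T<..} (powr_deriv p)) \<le> (1 + T) powr p * sqrt (K 0)"
proof -
  note i1 = has_bochner_integral_powr_deriv_Ioi[OF p T, unfolded has_bochner_integral_iff]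
  note i2 = has_bochner_integral_powr_deriv_Icc[OF p T, unfolded has_bochner_integral_iff]
  have sub: "{0..T} \<union> {T<..} = {0..}" "{T<..} \<subseteq> {0..}" "{0..T} \<inter> {T<..} = {}" "{0..T} \<subseteq> {0..}"
    using T by auto
  from sub show "AE \<omega> in M. path_integral {0..} (powr_deriv p) \<omega>
      = path_integral {0..T} (powr_deriv p) \<omega> + path_integral {T<..} (powr_deriv p) \<omega>"
    using path_integral_Un[of "{0..T}" "{T<..}" "powr_deriv p"] i1 i2 by simp
  show "L2_rv M (path_integral {T<..} (powr_deriv p))"
    using i1 sub(2) by (intro path_integral_L2) simp_all
  show "l2norm M (path_integral {T<..} (powr_deriv p)) \<le> (1 + T) powr p * sqrt (K 0)"
    using path_integral_L2(3)[of "{T<..}" "powr_deriv p"] i1 sub(2) by simp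
qed

lemma path_integral_Ici_L2:
  "p < 0 \<Longrightarrow> L2_rv M (path_integral {0..} (powr_deriv p))"
  using has_bochner_integral_powr_deriv_Ici[of p, unfolded has_bochner_integral_iff]
  by (intro path_integral_L2) auto

lemma has_ms_integral_Ici_path_integral:
  assumes p: "p < 0"
  shows "has_ms_integral_Ici M (\<lambda>t \<omega>. powr_deriv p t * Z t \<omega>) 0 (path_integral {0..} (powr_deriv p))"
  unfolding has_ms_integral_Ici_def
proof (intro exI conjI allI impI)
  fix T :: real assume T: "0 \<le> T"
  have "continuous_on {0..T} (powr_deriv p)"
    by (intro continuous_intros) auto
  then show "has_ms_integral M (\<lambda>t \<omega>. powr_deriv p t * Z t \<omega>) 0 T (path_integral {0..T} (powr_deriv p))"
    by (intro has_ms_integral_path_integral T) auto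
next
  let ?I = "\<lambda>T. path_integral {0..T} (powr_deriv p)" and ?Y = "path_integral {0..} (powr_deriv p)"
  have IL2: "L2_rv M (?I T)" if "0 \<le> T" for T
    using has_bochner_integral_powr_deriv_Icc[OF p that, unfolded has_bochner_integral_iff]
    by (intro path_integral_L2) auto
  have "\<forall>\<^sub>F T in at_top. norm (l2norm M (\<lambda>\<omega>. ?I T \<omega> - ?Y \<omega>)) \<le> (1 + T) powr p * sqrt (K 0)"
    using eventually_ge_at_top[of 0]
  proof eventually_elim
    case (elim T)
    note tail = path_integral_tail[OF p elim]
    have "l2norm M (\<lambda>\<omega>. ?I T \<omega> - ?Y \<omega>) = l2norm M (\<lambda>\<omega>. - 1 * path_integral {T<..} (powr_deriv p) \<omega>)"
      using tail(1) L2_rv_measurable[OF IL2[OF elim]] L2_rv_measurable[OF tail(2)]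
        L2_rv_measurable[OF path_integral_Ici_L2[OF p]]
      by (intro l2norm_AE_cong) auto
    also have "\<dots> = l2norm M (path_integral {T<..} (powr_deriv p))"
      by (simp add: l2norm_def)
    finally show ?case using tail(3) by simp
  qed
  moreover have "((\<lambda>T. (1 + T) powr p * sqrt (K 0)) \<longlongrightarrow> 0) at_top"
    using tendsto_mult_left_zero[OF powr_neg_tendsto_0_at_top[OF p]] by simp
  ultimately have "((\<lambda>T. l2norm M (\<lambda>\<omega>. ?I T \<omega> - ?Y \<omega>)) \<longlongrightarrow> 0) at_top"
    by (rule Lim_null_comparison)
  then show "tendsto_L2 M ?I ?Y at_top"
    unfolding tendsto_L2_iff_l2norm using IL2 path_integral_Ici_L2[OF p]
    by (auto intro: eventually_mono[OF eventually_ge_at_top[of 0]])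
qed

lemma S_inf_eq_path_integral:
  assumes p: "p < 0"
  shows "AE \<omega> in M. S_inf M Z p \<omega> = - Z 0 \<omega> - path_integral {0..} (powr_deriv p) \<omega>"
    and "L2_rv M (S_inf M Z p)"
proof -
  let ?J = "ms_integral_Ici M (\<lambda>t \<omega>. powr_deriv p t * Z t \<omega>) 0"
  have J: "has_ms_integral_Ici M (\<lambda>t \<omega>. powr_deriv p t * Z t \<omega>) 0 ?J"
    unfolding ms_integral_Ici_def
    by (rule someI[of "has_ms_integral_Ici M (\<lambda>t \<omega>. powr_deriv p t * Z t \<omega>) 0",
          OF has_ms_integral_Ici_path_integral[OF p]])
  have JL2: "L2_rv M ?J" using J by (auto simp: has_ms_integral_Ici_def tendsto_L2_def)
  have "AE \<omega> in M. ?J \<omega> = path_integral {0..} (powr_deriv p) \<omega>"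
    using J has_ms_integral_Ici_path_integral[OF p] by (rule has_ms_integral_Ici_AE_unique)
  then show "AE \<omega> in M. S_inf M Z p \<omega> = - Z 0 \<omega> - path_integral {0..} (powr_deriv p) \<omega>"
    by eventually_elim (simp add: S_inf_def)
  have "L2_rv M (\<lambda>\<omega>. - 1 * Z 0 \<omega> - ?J \<omega>)"
    by (intro L2_rv_diff L2_rv_cmult Z_L2 JL2) simp
  then show "L2_rv M (S_inf M Z p)" by (simp add: S_inf_def[abs_def])
qed

text \<open>Fubini's theorem; Cauchy-Schwarz gives the bound \<open>\<bar>f t\<bar> K 0\<close> for the inner integral of the absolute
value, which is integrable over time.\<close>

lemma expectation_path_integral_times_Z0:
  assumes p: "p < 0"
  shows "integrable lborel (\<lambda>t. indicator {0..} t * (powr_deriv p t * K \<bar>t\<bar>))"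
    and "expectation (\<lambda>\<omega>. path_integral {0..} (powr_deriv p) \<omega> * Z 0 \<omega>)
      = (LINT t|lborel. indicator {0..} t * (powr_deriv p t * K \<bar>t\<bar>))"
proof -
  interpret P: pair_sigma_finite lborel M ..
  have [measurable]: "Z 0 \<in> borel_measurable M" by simp
  let ?F = "\<lambda>t \<omega>. indicator {0..} t * (powr_deriv p t * Zv t \<omega>) * Z 0 \<omega>"
  note q = has_bochner_integral_powr_deriv_Ici[OF p, unfolded has_bochner_integral_iff]
  have prod: "integrable M (\<lambda>\<omega>. Zv t \<omega> * Z 0 \<omega>)" if "0 \<le> t" for t
    using that by (intro L2_rv_mult_integrable Zv_L2 Z_L2) auto
  have intM: "integrable M (?F t)" for t
    using prod[of t] by (auto simp: mult.assoc split: split_indicator)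
  have cov: "expectation (\<lambda>\<omega>. Zv t \<omega> * Z 0 \<omega>) = K \<bar>t\<bar>" if "0 \<le> t" for t
  proof -
    have [measurable]: "Z t \<in> borel_measurable M" using that by simp
    have "expectation (\<lambda>\<omega>. Zv t \<omega> * Z 0 \<omega>) = expectation (\<lambda>\<omega>. Z t \<omega> * Z 0 \<omega>)"
      using Zv_AE_eq[OF that] by (intro integral_cong_AE) auto
    then show ?thesis using Z_cov[OF that, of 0] by simp
  qed
  have EF: "expectation (?F t) = indicator {0..} t * (powr_deriv p t * K \<bar>t\<bar>)" for t
    using cov[of t] by (cases "0 \<le> t") (auto simp: mult.assoc)
  have absF: "expectation (\<lambda>\<omega>. norm (?F t \<omega>)) \<le> indicator {0..} t * \<bar>powr_deriv p t\<bar> * K 0" for t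
  proof (cases "0 \<le> t")
    case True
    have "l2norm M (\<lambda>\<omega>. \<bar>Zv t \<omega>\<bar>) = sqrt (K 0)" "l2norm M (\<lambda>\<omega>. \<bar>Z 0 \<omega>\<bar>) = sqrt (K 0)"
      using Zv_second_moment[OF True] l2norm_Z[of 0] by (simp_all add: l2norm_def)
    moreover have "L2_rv M (\<lambda>\<omega>. \<bar>Zv t \<omega>\<bar>)" "L2_rv M (\<lambda>\<omega>. \<bar>Z 0 \<omega>\<bar>)"
      using Zv_L2[OF True] Z_L2[of 0] by (auto simp: L2_rv_def)
    ultimately have "(expectation (\<lambda>\<omega>. \<bar>Zv t \<omega>\<bar> * \<bar>Z 0 \<omega>\<bar>))\<^sup>2 \<le> (K 0)\<^sup>2"
      using L2_Cauchy_Schwarz[of M "\<lambda>\<omega>. \<bar>Zv t \<omega>\<bar>" "\<lambda>\<omega>. \<bar>Z 0 \<omega>\<bar>"] K_pos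
        l2norm_power2[of M "\<lambda>\<omega>. \<bar>Zv t \<omega>\<bar>"] l2norm_power2[of M "\<lambda>\<omega>. \<bar>Z 0 \<omega>\<bar>"]
      by (simp add: power2_eq_square)
    then have "expectation (\<lambda>\<omega>. \<bar>Zv t \<omega>\<bar> * \<bar>Z 0 \<omega>\<bar>) \<le> K 0"
      by (rule power2_le_imp_le) (use K_pos in simp)
    moreover have "expectation (\<lambda>\<omega>. norm (?F t \<omega>)) = \<bar>powr_deriv p t\<bar> * expectation (\<lambda>\<omega>. \<bar>Zv t \<omega>\<bar> * \<bar>Z 0 \<omega>\<bar>)"
      using True by (simp add: abs_mult mult.assoc)
    ultimately show ?thesis using True by (simp add: mult_left_mono)
  qed simp
  have "integrable lborel (\<lambda>t. expectation (\<lambda>\<omega>. norm (?F t \<omega>)))"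
  proof (rule Bochner_Integration.integrable_bound)
    show "integrable lborel (\<lambda>t. indicator {0..} t * \<bar>powr_deriv p t\<bar> * K 0)" using q by simp
    show "(\<lambda>t. expectation (\<lambda>\<omega>. norm (?F t \<omega>))) \<in> borel_measurable lborel" by measurable
    show "AE t in lborel. norm (expectation (\<lambda>\<omega>. norm (?F t \<omega>)))
        \<le> norm (indicator {0..} t * \<bar>powr_deriv p t\<bar> * K 0)"
      using absF[THEN order_trans, OF abs_ge_self] by simp
  qed
  then have int: "integrable (lborel \<Otimes>\<^sub>M M) (case_prod ?F)"
    using intM by (intro P.Fubini_integrable) auto
  show "integrable lborel (\<lambda>t. indicator {0..} t * (powr_deriv p t * K \<bar>t\<bar>))"
    using P.integrable_fst[OF int] by (simp only: EF)
  have "expectation (\<lambda>\<omega>. path_integral {0..} (powr_deriv p) \<omega> * Z 0 \<omega>)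
      = expectation (\<lambda>\<omega>. LINT t|lborel. ?F t \<omega>)"
    unfolding path_integral_def by simp
  also have "\<dots> = (LINT t|lborel. expectation (?F t))"
    by (rule P.Fubini_integral[OF int])
  finally show "expectation (\<lambda>\<omega>. path_integral {0..} (powr_deriv p) \<omega> * Z 0 \<omega>)
      = (LINT t|lborel. indicator {0..} t * (powr_deriv p t * K \<bar>t\<bar>))"
    by (simp only: EF)
qed

text \<open>The weights \<open>\<bar>powr_deriv p t\<bar>\<close> have total mass one, so the covariance of the limit variable with \<open>Z\<^sub>0\<close>
is minus the integral of \<open>\<bar>powr_deriv p t\<bar> (K 0 - K t)\<close>. This is non-zero,
and a variable that is correlated with another one has positive variance.\<close>

lemma V_inf_pos:
  assumes p: "p < 0" shows "0 < V_inf M Z p"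
proof -
  let ?S = "S_inf M Z p" and ?I = "path_integral {0..} (powr_deriv p)"
  \<comment> \<open>Minus the integral of \<open>?g\<close> is the covariance of \<open>S_inf\<close> and \<open>Z\<^sub>0\<close>.\<close>
  let ?g = "\<lambda>t. indicator {0..} t * \<bar>powr_deriv p t\<bar> * (K 0 - K \<bar>t\<bar>)"
  note q = has_bochner_integral_powr_deriv_Ici[OF p, unfolded has_bochner_integral_iff]
  note IZ = expectation_path_integral_times_Z0[OF p]
  have SL2: "L2_rv M ?S" by (rule S_inf_eq_path_integral(2)[OF p])
  have Z0: "L2_rv M (Z 0)" by (rule Z_L2) simp
  have IL2: "L2_rv M ?I" by (rule path_integral_Ici_L2[OF p])
  note meas = L2_rv_measurable[OF SL2] L2_rv_measurable[OF Z0] L2_rv_measurable[OF IL2]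
  have g_eq: "?g t = indicator {0..} t * \<bar>powr_deriv p t\<bar> * K 0
      + indicator {0..} t * (powr_deriv p t * K \<bar>t\<bar>)" for t
    by (simp add: abs_powr_deriv[OF p] algebra_simps)
  have gint: "integrable lborel ?g" and gval: "(LINT t|lborel. ?g t)
      = K 0 + (LINT t|lborel. indicator {0..} t * (powr_deriv p t * K \<bar>t\<bar>))"
    unfolding g_eq using q IZ(1) by simp_all
  have g0: "0 \<le> ?g t" for t using K_le[of "\<bar>t\<bar>"] by simp
  have "(LINT t|lborel. ?g t) \<noteq> 0"
  proof
    assume "(LINT t|lborel. ?g t) = 0"
    then have "AE t in lborel. ?g t = 0"
      using gint g0 by (subst (asm) integral_nonneg_eq_0_iff_AE) auto
    then have "AE t in lborel. t \<notin> {0<..<1::real}"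
    proof eventually_elim
      case (elim t)
      then show ?case using K_less[of t] p by (auto split: split_indicator_asm)
    qed
    then have "emeasure lborel {t \<in> space lborel. t \<in> {0<..<1::real}} = 0"
      by (rule emeasure_eq_0_AE)
    moreover have "{t \<in> space lborel. t \<in> {0<..<1::real}} = {0<..<1}" by auto
    ultimately have "emeasure lborel {0<..<1::real} = 0" by (simp only:)
    then show False by simp
  qed
  moreover have "0 \<le> (LINT t|lborel. ?g t)"
    using g0 by (intro integral_nonneg_AE AE_I2)
  ultimately have gpos: "0 < (LINT t|lborel. ?g t)" by linarith
  have "AE \<omega> in M. ?S \<omega> * Z 0 \<omega> = (- 1) * (Z 0 \<omega> * Z 0 \<omega>) - ?I \<omega> * Z 0 \<omega>"
    using S_inf_eq_path_integral(1)[OF p] by eventually_elim (simp add: left_diff_distrib)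
  then have "expectation (\<lambda>\<omega>. ?S \<omega> * Z 0 \<omega>) = expectation (\<lambda>\<omega>. (- 1) * (Z 0 \<omega> * Z 0 \<omega>) - ?I \<omega> * Z 0 \<omega>)"
    using meas by (intro integral_cong_AE) auto
  also have "\<dots> = - K 0 - expectation (\<lambda>\<omega>. ?I \<omega> * Z 0 \<omega>)"
    using L2_rv_mult_integrable[OF Z0 Z0] L2_rv_mult_integrable[OF IL2 Z0] Z_cov[of 0 0] by simp
  finally have ESZ: "expectation (\<lambda>\<omega>. ?S \<omega> * Z 0 \<omega>) \<noteq> 0"
    using gval gpos IZ(2) by simp
  let ?c = "expectation ?S"
  have cL2: "L2_rv M (\<lambda>\<omega>. ?c)" by (simp add: L2_rv_def)
  have EZ0: "expectation (Z 0) = 0"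
    by (intro finite_span_law finite_span_base) simp
  have "expectation (\<lambda>\<omega>. (?S \<omega> - ?c) * Z 0 \<omega>) = expectation (\<lambda>\<omega>. ?S \<omega> * Z 0 \<omega>)"
    using L2_rv_mult_integrable[OF SL2 Z0] L2_rv_integrable[OF Z0] EZ0 by (simp add: left_diff_distrib)
  then have "0 < (expectation (\<lambda>\<omega>. (?S \<omega> - ?c) * Z 0 \<omega>))\<^sup>2" using ESZ by simp
  also have "\<dots> \<le> V_inf M Z p * (LINT \<omega>|M. (Z 0 \<omega>)\<^sup>2)"
    unfolding V_inf_def by (rule L2_Cauchy_Schwarz[OF L2_rv_diff[OF SL2 cL2] Z0])
  finally have "0 < V_inf M Z p * (LINT \<omega>|M. (Z 0 \<omega>)\<^sup>2)" .
  moreover have "(LINT \<omega>|M. (Z 0 \<omega>)\<^sup>2) = K 0"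
    using Z_cov[of 0 0] by (simp add: power2_eq_square)
  ultimately show ?thesis using K_pos by (simp add: zero_less_mult_iff)
qed

end

section \<open>Weighted sums over the observation grid\<close>

definition noise_score :: "(real \<Rightarrow> 'w \<Rightarrow> real) \<Rightarrow> real \<Rightarrow> real \<Rightarrow> nat \<Rightarrow> 'w \<Rightarrow> real" where
  "noise_score Z m h n \<omega> =
     (\<Sum>i=1..n. (1 + (real i - 1) * h) powr m * (Z (real i * h) \<omega> - Z ((real i - 1) * h) \<omega>))"

definition weight_sum :: "real \<Rightarrow> real \<Rightarrow> nat \<Rightarrow> real" where
  "weight_sum r h n = h * (\<Sum>i=1..n. (1 + (real i - 1) * h) powr r)"

definition trend :: "real \<Rightarrow> real \<Rightarrow> real" where
  "trend r t = integral {0..t} (\<lambda>s. (1 + s) powr r)"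

definition bias_score :: "real \<Rightarrow> real \<Rightarrow> nat \<Rightarrow> real" where
  "bias_score m h n = (\<Sum>i=1..n. (1 + (real i - 1) * h) powr m *
     (trend m (real i * h) - trend m ((real i - 1) * h) - h * (1 + (real i - 1) * h) powr m))"

lemma powr_between:
  fixes r :: real
  assumes "0 < x" "x \<le> y" "y \<le> z"
  shows "\<bar>y powr r - x powr r\<bar> \<le> \<bar>z powr r - x powr r\<bar>"
proof (cases "0 \<le> r")
  case True
  then have "x powr r \<le> y powr r" "y powr r \<le> z powr r" using assms by (auto intro!: powr_mono2)
  then show ?thesis by simp
next
  case False
  then have "x powr r \<ge> y powr r" "y powr r \<ge> z powr r" using assms by (auto intro!: powr_mono2')
  then show ?thesis by simp
qed

text \<open>The mean value theorem: the integral over an interval is its length times the value at an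
intermediate point, and by monotonicity that value lies between the values at the end points.\<close>

lemma trend_step:
  assumes "0 \<le> s" "s < t"
  shows "\<bar>trend r t - trend r s - (t - s) * (1 + s) powr r\<bar> \<le> (t - s) * \<bar>(1 + t) powr r - (1 + s) powr r\<bar>"
proof -
  have "\<exists>c\<in>{s<..<t}. trend r t - trend r s = (\<lambda>x. x * (1 + c) powr r) (t - s)"
  proof (rule mvt_simple[OF assms(2)])
    fix x assume x: "s \<le> x" "x \<le> t"
    have "continuous_on {0..t} (\<lambda>s. (1 + s) powr r)" by (intro continuous_intros) auto
    then have "(trend r has_real_derivative (1 + x) powr r) (at x within {0..t})"
      unfolding trend_def using x assms by (intro integral_has_real_derivative) auto
    then have "(trend r has_real_derivative (1 + x) powr r) (at x within {s..t})"
      by (rule DERIV_subset) (use assms in auto)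
    then show "(trend r has_derivative (\<lambda>y. y * (1 + x) powr r)) (at x within {s..t})"
      unfolding has_field_derivative_def by (rule has_derivative_eq_rhs) (simp add: fun_eq_iff)
  qed
  then obtain c where c: "s < c" "c < t" "trend r t - trend r s = (t - s) * (1 + c) powr r" by auto
  have "\<bar>trend r t - trend r s - (t - s) * (1 + s) powr r\<bar> = (t - s) * \<bar>(1 + c) powr r - (1 + s) powr r\<bar>"
    using assms c by (simp add: right_diff_distrib[symmetric] abs_mult)
  also have "\<dots> \<le> (t - s) * \<bar>(1 + t) powr r - (1 + s) powr r\<bar>"
    using assms c powr_between[of "1 + s" "1 + c" "1 + t" r] by (intro mult_left_mono) auto
  finally show ?thesis .
qed

lemma trend_0 [simp]: "trend r 0 = 0"
  by (simp add: trend_def)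

lemma sum_abs_powr_increments:
  fixes h r :: real
  assumes "0 < h"
  shows "(\<Sum>i=1..n. \<bar>(1 + real i * h) powr r - (1 + (real i - 1) * h) powr r\<bar>) = \<bar>(1 + real n * h) powr r - 1\<bar>"
proof (cases "0 \<le> r")
  case True
  have "(\<Sum>i=1..n. \<bar>(1 + real i * h) powr r - (1 + (real i - 1) * h) powr r\<bar>) = (1 + real n * h) powr r - 1"
  proof (induction n)
    case (Suc n)
    have "(1 + real n * h) powr r \<le> (1 + real (Suc n) * h) powr r"
      using assms True by (intro powr_mono2) (auto simp: algebra_simps)
    then show ?case using Suc by (simp add: algebra_simps)
  qed simp
  moreover have "1 powr r \<le> (1 + real n * h) powr r"
    using assms True by (intro powr_mono2) auto
  ultimately show ?thesis by simp
next
  case False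
  have "(\<Sum>i=1..n. \<bar>(1 + real i * h) powr r - (1 + (real i - 1) * h) powr r\<bar>) = 1 - (1 + real n * h) powr r"
  proof (induction n)
    case (Suc n)
    have "(1 + real n * h) powr r \<ge> (1 + real (Suc n) * h) powr r"
      using assms False by (intro powr_mono2') (auto simp: algebra_simps add_pos_nonneg)
    then show ?case using Suc by (simp add: algebra_simps)
  qed simp
  moreover have "(1 + real n * h) powr r \<le> 1 powr r"
    using assms False by (intro powr_mono2') auto
  ultimately show ?thesis by simp
qed

lemma trend_grid_step:
  assumes "0 < h" "1 \<le> i"
  shows "\<bar>trend r (real i * h) - trend r ((real i - 1) * h) - h * (1 + (real i - 1) * h) powr r\<bar>
    \<le> h * \<bar>(1 + real i * h) powr r - (1 + (real i - 1) * h) powr r\<bar>"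
proof -
  have e: "real i * h - (real i - 1) * h = h" by (simp add: algebra_simps)
  have "0 \<le> (real i - 1) * h" "(real i - 1) * h < real i * h" using assms by auto
  from trend_step[OF this, of r] show ?thesis unfolding e .
qed

text \<open>The left-point errors add up to \<open>h\<close> times the total variation of a monotone function, which telescopes.\<close>

lemma weight_sum_trend:
  assumes "0 < h"
  shows "\<bar>trend r (real n * h) - weight_sum r h n\<bar> \<le> h * \<bar>(1 + real n * h) powr r - 1\<bar>"
proof -
  have "trend r (real n * h) = (\<Sum>i=1..n. trend r (real i * h) - trend r ((real i - 1) * h))"
    by (induction n) (auto simp: algebra_simps)
  then have eq: "trend r (real n * h) - weight_sum r h n =
      (\<Sum>i=1..n. trend r (real i * h) - trend r ((real i - 1) * h) - h * (1 + (real i - 1) * h) powr r)"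
    by (simp add: weight_sum_def sum_subtractf sum_distrib_left)
  have "\<bar>trend r (real n * h) - weight_sum r h n\<bar>
      \<le> (\<Sum>i=1..n. h * \<bar>(1 + real i * h) powr r - (1 + (real i - 1) * h) powr r\<bar>)"
    unfolding eq using trend_grid_step[OF assms]
    by (intro order_trans[OF sum_abs] sum_mono) auto
  then show ?thesis
    by (simp only: sum_distrib_left[symmetric] sum_abs_powr_increments[OF assms])
qed

lemma bias_score_bound:
  assumes h: "0 < h"
  shows "\<bar>bias_score m h n\<bar> \<le> h * (max 1 ((1 + real n * h) powr m))\<^sup>2"
proof -
  let ?W = "max 1 ((1 + real n * h) powr m)"
  have w: "(1 + (real i - 1) * h) powr m \<le> ?W" if "i \<in> {1..n}" for i
  proof (cases "0 \<le> m")
    case True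
    have "1 + (real i - 1) * h \<le> 1 + real n * h" using that h by (intro add_left_mono mult_right_mono) auto
    then have "(1 + (real i - 1) * h) powr m \<le> (1 + real n * h) powr m"
      using True that h by (intro powr_mono2) auto
    then show ?thesis by simp
  next
    case False
    have "0 \<le> (real i - 1) * h" using that h by simp
    then have "(1 + (real i - 1) * h) powr m \<le> 1 powr m"
      using False by (intro powr_mono2') auto
    then show ?thesis by simp
  qed
  have "\<bar>bias_score m h n\<bar> \<le> (\<Sum>i=1..n. ?W * (h * \<bar>(1 + real i * h) powr m - (1 + (real i - 1) * h) powr m\<bar>))"
    unfolding bias_score_def
  proof (rule order_trans[OF sum_abs], rule sum_mono)
    fix i assume i: "i \<in> {1..n}"
    then show "\<bar>(1 + (real i - 1) * h) powr m * (trend m (real i * h) - trend m ((real i - 1) * h) - h * (1 + (real i - 1) * h) powr m)\<bar>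
      \<le> ?W * (h * \<bar>(1 + real i * h) powr m - (1 + (real i - 1) * h) powr m\<bar>)"
      unfolding abs_mult using trend_grid_step[OF h, of i m] w[OF i]
      by (intro mult_mono) auto
  qed
  also have "\<dots> = ?W * (h * \<bar>(1 + real n * h) powr m - 1\<bar>)"
    by (subst sum_distrib_left[symmetric], subst sum_distrib_left[symmetric])
      (simp only: sum_abs_powr_increments[OF h])
  also have "\<dots> \<le> ?W * (h * ?W)"
  proof -
    have "0 \<le> (1 + real n * h) powr m" by simp
    then have "\<bar>(1 + real n * h) powr m - 1\<bar> \<le> ?W" by linarith
    then show ?thesis using h by (intro mult_left_mono) auto
  qed
  finally show ?thesis by (simp add: power2_eq_square algebra_simps)
qed

lemma trend_closed_form:
  assumes "0 \<le> t"
  shows "r \<noteq> -1 \<Longrightarrow> trend r t = ((1 + t) powr (r + 1) - 1) / (r + 1)"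
    and "trend (-1) t = ln (1 + t)"
proof -
  assume r: "r \<noteq> -1"
  have "((\<lambda>s. (1 + s) powr r) has_integral ((1 + t) powr (r + 1) / (r + 1) - (1 + 0) powr (r + 1) / (r + 1))) {0..t}"
    using r assms
    by (intro fundamental_theorem_of_calculus)
       (auto simp: has_real_derivative_iff_has_vector_derivative[symmetric] intro!: derivative_eq_intros)
  then show "trend r t = ((1 + t) powr (r + 1) - 1) / (r + 1)"
    unfolding trend_def by (simp add: integral_unique diff_divide_distrib)
next
  have "((\<lambda>s. (1 + s) powr (-1)) has_integral (ln (1 + t) - ln (1 + 0))) {0..t}"
    using assms
    by (intro fundamental_theorem_of_calculus)
       (auto simp: has_real_derivative_iff_has_vector_derivative[symmetric] powr_minus field_simps intro!: derivative_eq_intros)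
  then show "trend (-1) t = ln (1 + t)"
    unfolding trend_def by (simp add: integral_unique)
qed

lemma A_inf_eq:
  assumes "m < - 1 / 2" shows "A_inf m = - 1 / (2 * m + 1)"
proof -
  define p where "p = 2 * m + 1"
  have p: "p < 0" and e: "p - 1 = 2 * m" using assms by (simp_all add: p_def)
  have "has_bochner_integral lborel (\<lambda>t. (- 1 / p) * (indicator {0..} t * \<bar>powr_deriv p t\<bar>)) ((- 1 / p) * 1)"
    by (intro has_bochner_integral_mult_right has_bochner_integral_powr_deriv_Ici p)
  also have "(\<lambda>t. (- 1 / p) * (indicator {0..} t * \<bar>powr_deriv p t\<bar>)) = (\<lambda>t. indicator {0..} t * (1 + t) powr (2 * m))"
    using p e by (auto simp: abs_mult)
  finally have b: "has_bochner_integral lborel (\<lambda>t. indicator {0..} t * (1 + t) powr (2 * m)) (- 1 / p)" by simp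
  then have "set_integrable lborel {0..} (\<lambda>t. (1 + t) powr (2 * m))"
    "(LINT t:{0..}|lborel. (1 + t) powr (2 * m)) = - 1 / p"
    by (simp_all add: set_integrable_def set_lebesgue_integral_def has_bochner_integral_iff)
  then show ?thesis
    unfolding A_inf_def using set_borel_integral_eq_integral(2)[of "{0..}" "\<lambda>t. (1 + t) powr (2 * m)"]
    by (simp add: p_def)
qed

text \<open>A residual is the noise increment, plus \<open>\<xi>\<^sub>0\<close> times the error of the left-point rule for the drift
integral, plus \<open>(\<xi>\<^sub>0 - \<xi>) h\<close> times a weight.\<close>

lemma contrast_quadratic:
  fixes Z :: "real \<Rightarrow> 'w \<Rightarrow> real"
  assumes h': "h n = h'"
  shows "contrast (drift m) (observed (drift m) \<xi>\<^sub>0 Z) h n \<omega> \<xi> =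
    (\<Sum>i=1..n. (Z (real i * h') \<omega> - Z ((real i - 1) * h') \<omega> + \<xi>\<^sub>0 * (trend m (real i * h') - trend m ((real i - 1) * h')
        - h' * (1 + (real i - 1) * h') powr m))\<^sup>2)
    + h' * (weight_sum (2 * m) h' n * (\<xi> - \<xi>\<^sub>0)\<^sup>2
        - 2 * (\<xi> - \<xi>\<^sub>0) * (noise_score Z m h' n \<omega> + \<xi>\<^sub>0 * bias_score m h' n))"
proof -
  let ?w = "\<lambda>i. (1 + (real i - 1) * h') powr m"
  let ?r = "\<lambda>i. Z (real i * h') \<omega> - Z ((real i - 1) * h') \<omega> + \<xi>\<^sub>0 * (trend m (real i * h') - trend m ((real i - 1) * h') - h' * ?w i)"
  have dr: "integral {0..t} (drift m \<xi>\<^sub>0) = \<xi>\<^sub>0 * trend m t" for t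
    by (simp add: drift_def[abs_def] trend_def)
  have sq: "(?w i)\<^sup>2 = (1 + (real i - 1) * h') powr (2 * m)" if "i \<in> {1..n}" for i
    by (simp add: power2_eq_square powr_add[symmetric])
  have "contrast (drift m) (observed (drift m) \<xi>\<^sub>0 Z) h n \<omega> \<xi> =
      (\<Sum>i=1..n. (?r i)\<^sup>2 + h' * ((\<xi> - \<xi>\<^sub>0)\<^sup>2 * h' * (?w i)\<^sup>2
        - 2 * (\<xi> - \<xi>\<^sub>0) * (?w i * (Z (real i * h') \<omega> - Z ((real i - 1) * h') \<omega>)
          + \<xi>\<^sub>0 * (?w i * (trend m (real i * h') - trend m ((real i - 1) * h') - h' * ?w i)))))"
    unfolding contrast_def observed_def dr
    by (intro sum.cong refl) (simp add: drift_def h' power2_eq_square algebra_simps)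
  also have "\<dots> = (\<Sum>i=1..n. (?r i)\<^sup>2) + h' * ((\<xi> - \<xi>\<^sub>0)\<^sup>2 * h' * (\<Sum>i=1..n. (?w i)\<^sup>2)
        - 2 * (\<xi> - \<xi>\<^sub>0) * (noise_score Z m h' n \<omega> + \<xi>\<^sub>0 * bias_score m h' n))"
    by (simp only: sum.distrib sum_subtractf sum_distrib_left[symmetric] noise_score_def bias_score_def)
  also have "(\<Sum>i=1..n. (?w i)\<^sup>2) = (\<Sum>i=1..n. (1 + (real i - 1) * h') powr (2 * m))"
    using sq by (rule sum.cong[OF refl])
  finally show ?thesis by (simp add: weight_sum_def mult.assoc mult.commute mult.left_commute)
qed

lemma weight_sum_pos:
  assumes "0 < h" "1 \<le> n" shows "0 < weight_sum r h n"
proof -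
  have "0 < (1 + (real i - 1) * h) powr r" if "i \<in> {1..n}" for i
  proof -
    have "0 \<le> (real i - 1) * h" using that assms by simp
    then show ?thesis by simp
  qed
  then show ?thesis unfolding weight_sum_def using assms by (intro mult_pos_pos sum_pos) auto
qed

lemma sum_powr_increments:
  fixes h r :: real
  shows "(\<Sum>i=1..n. (1 + real i * h) powr r - (1 + (real i - 1) * h) powr r) = (1 + real n * h) powr r - 1"
  by (induction n) (auto simp: algebra_simps)

text \<open>The indices to the left and to the right of \<open>i\<close> contribute one geometric series each.\<close>

lemma sum_geometric_distance:
  fixes x :: real
  assumes x: "0 < x" "x < 1" and i: "i \<le> n"
  shows "(\<Sum>j=1..n. x ^ nat \<bar>int i - int j\<bar>) \<le> 2 / (1 - x)"
proof -
  have geo: "(\<Sum>k\<le>l. x ^ k) \<le> 1 / (1 - x)" for l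
  proof -
    have "(\<Sum>k\<le>l. x ^ k) \<le> suminf (\<lambda>k. x ^ k)"
      using x by (intro sum_le_suminf summable_geometric) auto
    then show ?thesis using x by (simp add: suminf_geometric)
  qed
  have "(\<Sum>j=1..n. x ^ nat \<bar>int i - int j\<bar>) \<le> (\<Sum>j\<in>{..i} \<union> {i..n}. x ^ nat \<bar>int i - int j\<bar>)"
    using x by (intro sum_mono2) auto
  also have "\<dots> \<le> (\<Sum>j\<in>{..i}. x ^ nat \<bar>int i - int j\<bar>) + (\<Sum>j\<in>{i..n}. x ^ nat \<bar>int i - int j\<bar>)"
    using x by (simp add: sum_Un sum_nonneg)
  also have "(\<Sum>j\<in>{..i}. x ^ nat \<bar>int i - int j\<bar>) = (\<Sum>k\<le>i. x ^ k)"
    by (rule sum.reindex_bij_witness[of _ "\<lambda>k. i - k" "\<lambda>j. i - j"]) (auto simp: nat_diff_distrib' of_nat_diff)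
  also have "(\<Sum>j\<in>{i..n}. x ^ nat \<bar>int i - int j\<bar>) = (\<Sum>k\<le>n - i. x ^ k)"
    using i by (intro sum.reindex_bij_witness[of _ "\<lambda>k. k + i" "\<lambda>j. j - i"]) (auto simp: nat_diff_distrib')
  finally show ?thesis using geo[of i] geo[of "n - i"] by simp
qed

section \<open>The noise score\<close>

text \<open>Summation by parts moves the differences from the process to the smooth weights.\<close>

lemma noise_score_Abel:
  "noise_score Z m h n \<omega> = (1 + real n * h) powr m * Z (real n * h) \<omega> - Z 0 \<omega>
    - (\<Sum>i=1..n. ((1 + real i * h) powr m - (1 + (real i - 1) * h) powr m) * Z (real i * h) \<omega>)"
proof -
  have Abel: "(\<Sum>i=1..n. w (real i - 1) * (z (real i) - z (real i - 1)))
      = w n * z n - w 0 * z 0 - (\<Sum>i=1..n. (w i - w (real i - 1)) * z i)"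
    for w z :: "real \<Rightarrow> real"
    by (induction n) (simp_all add: algebra_simps)
  show ?thesis
    using Abel[of "\<lambda>x. (1 + x * h) powr m" "\<lambda>x. Z (x * h) \<omega>"]
    by (simp add: noise_score_def)
qed

context lipschitz_gaussian
begin

lemma noise_score_in_span:
  assumes "0 < h" shows "noise_score Z m h n \<in> finite_span Z"
  unfolding noise_score_def[abs_def] using assms
  by (intro finite_span_sum finite_span_cmult finite_span_diff finite_span_base) auto

text \<open>After summation by parts the remaining sum is an integral of the derivative of the
weights in which \<open>Z\<close> is frozen at the right end of each cell. Since the total variation of
the weights is at most one, freezing costs at most \<open>sqrt (2 L h)\<close> in total; the
boundary term and the tail of the limit integral account for the rest.\<close>

lemma noise_score_near_S_inf:
  assumes p: "p < 0" and h: "0 < h"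
  shows "l2norm M (\<lambda>\<omega>. noise_score Z p h n \<omega> - S_inf M Z p \<omega>)
    \<le> 2 * (1 + real n * h) powr p * sqrt (K 0) + sqrt (2 * L * h)"
proof -
  let ?f = "powr_deriv p"
  let ?w = "\<lambda>k. (1 + real k * h) powr p"
  let ?D = "\<lambda>k \<omega>. (\<Sum>i=1..k. ((1 + real i * h) powr p - (1 + (real i - 1) * h) powr p) * Z (real i * h) \<omega>)"
  have sumL2: "L2_rv M (?D k)" for k
    using h by (intro L2_rv_sum L2_rv_cmult Z_L2) auto
  have PL2: "L2_rv M (path_integral {0..real k * h} ?f)" for k
    using has_bochner_integral_powr_deriv_Icc[OF p, of "real k * h", unfolded has_bochner_integral_iff] h
    by (intro path_integral_L2) auto
  \<comment> \<open>Cell by cell, the freezing error is bounded by the loss of weight over the cell.\<close>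
  have D: "l2norm M (\<lambda>\<omega>. ?D k \<omega> - path_integral {0..real k * h} ?f \<omega>) \<le> (1 - ?w k) * sqrt (2 * L * h)" for k
  proof (induction k)
    case 0
    have "l2norm M (path_integral {0..0} ?f) \<le> 0"
      using path_integral_L2(3)[of "{0..0}" ?f]
        has_bochner_integral_powr_deriv_Icc[OF p, of 0, unfolded has_bochner_integral_iff] by simp
    moreover have "l2norm M (\<lambda>\<omega>. - path_integral {0..0} ?f \<omega>) = l2norm M (path_integral {0..0} ?f)"
      by (simp add: l2norm_def)
    ultimately show ?case by simp
  next
    case (Suc k)
    let ?s = "real k * h" and ?t = "real (Suc k) * h"
    let ?A = "{?s<..?t}"
    have st: "0 \<le> ?s" "?s \<le> ?t" "0 \<le> ?t" "?t - ?s = h" using h by (auto simp: algebra_simps)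
    note i1 = has_bochner_integral_powr_deriv_Ioc[OF p st(1,2), unfolded has_bochner_integral_iff]
    note i2 = has_bochner_integral_powr_deriv_Icc[OF p st(1), unfolded has_bochner_integral_iff]
    have sub': "{0..s} \<union> {s<..t} = {0..t}" "{s<..t} \<subseteq> {0..}" "{0..s} \<subseteq> {0..}" "{0..s} \<inter> {s<..t} = {}"
      if "0 \<le> s" "s \<le> t" for s t :: real
      using that by auto
    have sub: "{0..?s} \<union> ?A = {0..?t}" "?A \<subseteq> {0..}" "{0..?s} \<subseteq> {0..}" "{0..?s} \<inter> ?A = {}"
      by (rule sub'[OF st(1,2)])+
    have AL2: "L2_rv M (path_integral ?A ?f)"
      using i1 sub(2) by (intro path_integral_L2) simp_all
    have fval: "(LINT x|lborel. indicator ?A x * ?f x) = ?w (Suc k) - ?w k"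
    proof -
      have "(LINT x|lborel. indicator ?A x * ?f x) = (LINT x|lborel. - (indicator ?A x * \<bar>?f x\<bar>))"
        by (simp only: abs_powr_deriv[OF p] mult_minus_right minus_minus)
      also have "\<dots> = - (?w k - ?w (Suc k))" using i1 by (simp only: integral_minus)
      finally show ?thesis by simp
    qed
    have near: "l2norm M (\<lambda>\<omega>. (?w (Suc k) - ?w k) * Z ?t \<omega> - path_integral ?A ?f \<omega>)
        \<le> (?w k - ?w (Suc k)) * sqrt (2 * L * h)"
    proof -
      have d: "\<bar>?t - x\<bar> \<le> h" if "x \<in> ?A" for x
        using that st(4) by (simp only: greaterThanAtMost_iff) linarith
      have "l2norm M (\<lambda>\<omega>. (LINT x|lborel. indicator ?A x * ?f x) * Z ?t \<omega> - path_integral ?A ?f \<omega>)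
        \<le> (LINT x|lborel. indicator ?A x * \<bar>?f x\<bar>) * sqrt (2 * L * h)"
        by (rule path_integral_near_point[OF _ sub(2) st(3) d less_imp_le[OF h] _ i1[THEN conjunct1]]) measurable
      then show ?thesis by (simp only: fval i1[THEN conjunct2])
    qed
    have NL2: "L2_rv M (\<lambda>\<omega>. (?w (Suc k) - ?w k) * Z ?t \<omega> - path_integral ?A ?f \<omega>)"
      using st by (intro L2_rv_diff L2_rv_cmult Z_L2 AL2) auto
    have "AE \<omega> in M. path_integral {0..?t} ?f \<omega> = path_integral {0..?s} ?f \<omega> + path_integral ?A ?f \<omega>"
      using path_integral_Un[of "{0..?s}" ?A ?f, OF _ _ sub(3,2,4) _ i2[THEN conjunct1] i1[THEN conjunct1]]
      unfolding sub(1) by simp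
    then have "AE \<omega> in M. ?D (Suc k) \<omega> - path_integral {0..?t} ?f \<omega>
      = (?D k \<omega> - path_integral {0..?s} ?f \<omega>) + ((?w (Suc k) - ?w k) * Z ?t \<omega> - path_integral ?A ?f \<omega>)"
      by eventually_elim simp
    then have "l2norm M (\<lambda>\<omega>. ?D (Suc k) \<omega> - path_integral {0..?t} ?f \<omega>)
      = l2norm M (\<lambda>\<omega>. (?D k \<omega> - path_integral {0..?s} ?f \<omega>) + ((?w (Suc k) - ?w k) * Z ?t \<omega> - path_integral ?A ?f \<omega>))"
      by (intro l2norm_AE_cong L2_rv_measurable L2_rv_add L2_rv_diff[OF sumL2 PL2] NL2)
    also have "\<dots> \<le> (1 - ?w k) * sqrt (2 * L * h) + (?w k - ?w (Suc k)) * sqrt (2 * L * h)"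
      by (intro order_trans[OF l2norm_triangle] add_mono Suc near L2_rv_diff[OF sumL2 PL2] NL2)
    also have "\<dots> = (1 - ?w (Suc k)) * sqrt (2 * L * h)" by (simp add: algebra_simps)
    finally show ?case .
  qed
  let ?T = "real n * h"
  have T: "0 \<le> ?T" using h by simp
  note tail = path_integral_tail[OF p T] and S = S_inf_eq_path_integral[OF p]
  let ?a = "\<lambda>\<omega>. ?w n * Z ?T \<omega>" and ?b = "\<lambda>\<omega>. path_integral {0..?T} ?f \<omega> - ?D n \<omega>"
    and ?c = "path_integral {?T<..} ?f"
  have aL2: "L2_rv M ?a" and bL2: "L2_rv M ?b"
    using T by (intro L2_rv_cmult L2_rv_diff Z_L2 PL2 sumL2; simp)+
  have NL2: "L2_rv M (noise_score Z p h n)"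
    by (rule finite_span_law(1)[OF noise_score_in_span[OF h]])
  have "AE \<omega> in M. noise_score Z p h n \<omega> - S_inf M Z p \<omega> = ?a \<omega> + (?b \<omega> + ?c \<omega>)"
    using S(1) tail(1) by eventually_elim (simp add: noise_score_Abel)
  then have "l2norm M (\<lambda>\<omega>. noise_score Z p h n \<omega> - S_inf M Z p \<omega>) = l2norm M (\<lambda>\<omega>. ?a \<omega> + (?b \<omega> + ?c \<omega>))"
    by (intro l2norm_AE_cong L2_rv_measurable L2_rv_add L2_rv_diff[OF NL2 S(2)] aL2 bL2 tail(2))
  also have "\<dots> \<le> l2norm M ?a + (l2norm M ?b + l2norm M ?c)"
    by (intro order_trans[OF l2norm_triangle] add_mono order_refl l2norm_triangle L2_rv_add aL2 bL2 tail(2))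
  also have "l2norm M ?a = ?w n * sqrt (K 0)"
    using l2norm_Z[OF T] by (simp add: l2norm_cmult)
  also have "l2norm M ?b \<le> sqrt (2 * L * h)"
  proof -
    have "(1 - ?w n) * sqrt (2 * L * h) \<le> 1 * sqrt (2 * L * h)"
      using L_nonneg h by (intro mult_right_mono) auto
    then show ?thesis using D[of n] by (simp add: l2norm_minus_commute)
  qed
  finally show ?thesis using tail(3) by (simp add: algebra_simps)
qed

lemma l2norm_sum_Z:
  assumes "\<And>i. i \<in> I \<Longrightarrow> 0 \<le> t i"
  shows "(l2norm M (\<lambda>\<omega>. \<Sum>i\<in>I. d i * Z (t i) \<omega>))\<^sup>2 = (\<Sum>i\<in>I. \<Sum>j\<in>I. d i * d j * K \<bar>t i - t j\<bar>)"
proof -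
  have int: "integrable M (\<lambda>\<omega>. d i * d j * (Z (t i) \<omega> * Z (t j) \<omega>))" if "i \<in> I" "j \<in> I" for i j
    by (intro integrable_mult_right L2_rv_mult_integrable Z_L2 assms that)
  have "(l2norm M (\<lambda>\<omega>. \<Sum>i\<in>I. d i * Z (t i) \<omega>))\<^sup>2 =
      expectation (\<lambda>\<omega>. \<Sum>i\<in>I. \<Sum>j\<in>I. d i * d j * (Z (t i) \<omega> * Z (t j) \<omega>))"
    unfolding l2norm_power2
    by (intro Bochner_Integration.integral_cong refl) (simp add: power2_eq_square sum_product mult_ac)
  also have "\<dots> = (\<Sum>i\<in>I. \<Sum>j\<in>I. expectation (\<lambda>\<omega>. d i * d j * (Z (t i) \<omega> * Z (t j) \<omega>)))"
    using int by (simp add: Bochner_Integration.integral_sum)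
  also have "\<dots> = (\<Sum>i\<in>I. \<Sum>j\<in>I. d i * d j * K \<bar>t i - t j\<bar>)"
    using assms Z_cov by (intro sum.cong refl) simp
  finally show ?thesis .
qed

text \<open>The squared norm is a double sum of covariances. For \<open>m \<le> 1\<close> one of the two
weight increments is at most \<open>h\<close>, and \<open>h\<close> times a row sum of covariances is bounded by
exponential decay; the other increments telescope. The result is of smaller order than
\<open>(1 + n h)\<^sup>2\<^sup>m\<close>, which is the order of the boundary term.\<close>

lemma increment_sum_second_moment:
  assumes m: "0 < m" "m \<le> 1" and h: "0 < h"
    and decay: "\<And>u. 0 \<le> u \<Longrightarrow> K u \<le> C * exp (- (b * u))" and b: "0 < b"
  shows "(l2norm M (\<lambda>\<omega>. \<Sum>i=1..n. ((1 + real i * h) powr m - (1 + (real i - 1) * h) powr m) * Z (real i * h) \<omega>))\<^sup>2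
    \<le> 2 * C * (h + 1 / b) * (1 + real n * h) powr m"
proof -
  let ?d = "\<lambda>i. (1 + real i * h) powr m - (1 + (real i - 1) * h) powr m"
  have C: "0 \<le> C" using decay[of 0] K_pos by simp
  have d: "0 \<le> ?d i" "?d i \<le> h" if "i \<in> {1..n}" for i
  proof -
    let ?s = "(real i - 1) * h" and ?t = "real i * h"
    have st: "0 \<le> ?s" "?s < ?t" "?t - ?s = h" using that h by (auto simp: algebra_simps)
    then show "0 \<le> ?d i" using m by (simp add: powr_mono2)
    have "\<exists>z. ?s < z \<and> z < ?t \<and> (1 + ?t) powr m - (1 + ?s) powr m = (?t - ?s) * (m * (1 + z) powr (m - 1))"
      using st by (intro MVT2) (auto intro!: derivative_eq_intros)
    then obtain z where z: "?s < z" "?d i = h * (m * (1 + z) powr (m - 1))" using st by auto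
    have "(1 + z) powr (m - 1) \<le> 1 powr (m - 1)"
      using m z st by (intro powr_mono2') auto
    then have "m * (1 + z) powr (m - 1) \<le> 1 * 1" using m by (intro mult_mono) auto
    then have "h * (m * (1 + z) powr (m - 1)) \<le> h * 1" using h by (intro mult_left_mono) auto
    then show "?d i \<le> h" using z by simp
  qed
  have L2: "L2_rv M (Z (real i * h))" for i using h by (intro Z_L2) auto
  define x where "x = exp (- (b * h))"
  have x: "0 < x" "x < 1" using b h by (auto simp: x_def)
  have geo: "h * (2 / (1 - x)) \<le> 2 * (h + 1 / b)"
  proof -
    \<comment> \<open>This gives \<open>1 - x \<ge> b h / (1 + b h)\<close>, so the geometric series times \<open>h\<close> stays bounded as \<open>h\<close> tends to zero.\<close>
    have "1 + b * h \<le> exp (b * h)" by (rule exp_ge_add_one_self)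
    then have "x * (1 + b * h) \<le> x * exp (b * h)" using x by (intro mult_left_mono) auto
    also have "x * exp (b * h) = 1" by (simp add: x_def mult_exp_exp)
    finally have "b * h \<le> (1 - x) * (1 + b * h)" by (simp add: algebra_simps)
    then have "h / (1 - x) \<le> h + 1 / b" using x b by (simp add: field_simps)
    then have "2 * (h / (1 - x)) \<le> 2 * (h + 1 / b)" by (rule mult_left_mono) simp
    then show ?thesis by (simp only: times_divide_eq_right mult.commute)
  qed
  have Kx: "K \<bar>real i * h - real j * h\<bar> \<le> C * x ^ nat \<bar>int i - int j\<bar>" for i j
  proof -
    have "\<bar>real i * h - real j * h\<bar> = real (nat \<bar>int i - int j\<bar>) * h"
      using h by (simp add: left_diff_distrib[symmetric] abs_mult)
    then have "K \<bar>real i * h - real j * h\<bar> \<le> C * exp (- (b * (real (nat \<bar>int i - int j\<bar>) * h)))"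
      using decay[of "\<bar>real i * h - real j * h\<bar>"] by simp
    also have "exp (- (b * (real (nat \<bar>int i - int j\<bar>) * h))) = x ^ nat \<bar>int i - int j\<bar>"
      unfolding x_def exp_of_nat_mult[symmetric] by (simp add: algebra_simps)
    finally show ?thesis .
  qed
  have "(l2norm M (\<lambda>\<omega>. \<Sum>i=1..n. ?d i * Z (real i * h) \<omega>))\<^sup>2
      = (\<Sum>i=1..n. \<Sum>j=1..n. ?d i * ?d j * K \<bar>real i * h - real j * h\<bar>)"
    using h by (intro l2norm_sum_Z) auto
  also have "\<dots> \<le> (\<Sum>i=1..n. \<Sum>j=1..n. ?d i * h * (C * x ^ nat \<bar>int i - int j\<bar>))"
    using d h Kx K_nonneg by (intro sum_mono mult_mono) auto
  also have "\<dots> = (\<Sum>i=1..n. ?d i * (C * (h * (\<Sum>j=1..n. x ^ nat \<bar>int i - int j\<bar>))))"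
    unfolding sum_distrib_left by (intro sum.cong refl) (simp only: mult_ac)
  also have "\<dots> \<le> (\<Sum>i=1..n. ?d i * (C * (2 * (h + 1 / b))))"
  proof (intro sum_mono mult_left_mono)
    fix i assume i: "i \<in> {1..n}"
    have "h * (\<Sum>j=1..n. x ^ nat \<bar>int i - int j\<bar>) \<le> h * (2 / (1 - x))"
      using sum_geometric_distance[OF x] i h by (intro mult_left_mono) auto
    then show "h * (\<Sum>j=1..n. x ^ nat \<bar>int i - int j\<bar>) \<le> 2 * (h + 1 / b)" using geo by simp
    show "0 \<le> ?d i" by (rule d[OF i])
  qed (rule C)
  also have "\<dots> = C * (2 * (h + 1 / b)) * ((1 + real n * h) powr m - 1)"
    by (simp only: sum_distrib_right[symmetric] sum_powr_increments) simp
  also have "\<dots> \<le> C * (2 * (h + 1 / b)) * (1 + real n * h) powr m"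
    using C h b by (intro mult_left_mono) auto
  finally show ?thesis by (simp only: mult_ac)
qed

end

section \<open>Limits of elementary functions\<close>

lemma powr_at_top:
  fixes r :: real
  assumes "0 < r" shows "LIM t at_top. t powr r :> at_top"
proof -
  have "((\<lambda>t::real. t powr (- r)) \<longlongrightarrow> 0) at_top"
    using assms by (intro tendsto_neg_powr filterlim_ident) auto
  moreover have "\<forall>\<^sub>F t::real in at_top. 0 < t powr (- r)"
    using eventually_gt_at_top[of 0] by eventually_elim simp
  ultimately have "LIM t at_top. inverse (t powr (- r)) :> at_top"
    by (rule filterlim_inverse_at_top)
  then show ?thesis by (simp add: powr_minus)
qed

lemma powr_shift_ratio_tendsto_1:
  fixes r :: real
  shows "((\<lambda>t. (1 + t) powr r / t powr r) \<longlongrightarrow> 1) at_top"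
proof -
  have "((\<lambda>t::real. (1 + inverse t) powr r) \<longlongrightarrow> (1 + 0) powr r) at_top"
    by (intro tendsto_powr tendsto_add tendsto_const tendsto_inverse_0_at_top filterlim_ident) auto
  moreover have "\<forall>\<^sub>F t::real in at_top. (1 + inverse t) powr r = (1 + t) powr r / t powr r"
    using eventually_gt_at_top[of 0]
  proof eventually_elim
    case (elim t)
    then have "1 + inverse t = (1 + t) / t" by (simp add: field_simps)
    then show ?case using elim by (simp add: powr_divide)
  qed
  ultimately show ?thesis by (auto intro: Lim_transform_eventually)
qed

lemma ln_shift_ratio_tendsto_1: "((\<lambda>t::real. ln (1 + t) / ln t) \<longlongrightarrow> 1) at_top"
proof -
  have "((\<lambda>t::real. ln (1 + inverse t)) \<longlongrightarrow> ln (1 + 0)) at_top"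
    by (intro tendsto_ln tendsto_add tendsto_const tendsto_inverse_0_at_top filterlim_ident) auto
  then have "((\<lambda>t::real. ln (1 + inverse t) / ln t) \<longlongrightarrow> 0) at_top"
    by (rule tendsto_divide_0) (rule filterlim_at_top_imp_at_infinity[OF ln_at_top])
  from tendsto_add[OF tendsto_const this]
  have "((\<lambda>t::real. 1 + ln (1 + inverse t) / ln t) \<longlongrightarrow> 1) at_top" by simp
  moreover have "\<forall>\<^sub>F t::real in at_top. 1 + ln (1 + inverse t) / ln t = ln (1 + t) / ln t"
    using eventually_gt_at_top[of 1]
  proof eventually_elim
    case (elim t)
    then have "1 + inverse t = (1 + t) / t" by (simp add: field_simps)
    then have "ln (1 + inverse t) = ln (1 + t) - ln t" using elim by (simp add: ln_div)
    then show ?case using elim by (simp add: field_simps)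
  qed
  ultimately show ?thesis by (rule Lim_transform_eventually)
qed

section \<open>The estimators as functions of design, noise and bias\<close>

text \<open>From an interior point one can move towards \<open>x\<close> inside the set, so it is not closest to
\<open>x\<close> unless it equals \<open>x\<close>.\<close>

lemma closest_point_eq_interior:
  fixes S :: "real set"
  assumes S: "closed S" and r: "0 < r" "ball y r \<subseteq> S" and eq: "closest_point S x = y"
  shows "x = y"
proof (rule ccontr)
  assume ne: "x \<noteq> y"
  \<comment> \<open>The step length \<open>s\<close> keeps \<open>y + s (x - y)\<close> inside the ball and on the segment from \<open>y\<close> to \<open>x\<close>.\<close>
  define s where "s = min 1 (r / (2 * \<bar>x - y\<bar>))"
  have s: "0 < s" "s \<le> 1" using ne r by (auto simp: s_def)
  have "s * \<bar>x - y\<bar> \<le> r / (2 * \<bar>x - y\<bar>) * \<bar>x - y\<bar>"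
    by (intro mult_right_mono) (auto simp: s_def)
  also have "\<dots> < r" using ne r by simp
  finally have "y + s * (x - y) \<in> S"
    using s r(2) by (auto simp: dist_real_def abs_mult subset_iff)
  then have "dist x y \<le> dist x (y + s * (x - y))"
    using closest_point_le[OF S, of _ x] eq by metis
  also have "x - (y + s * (x - y)) = (1 - s) * (x - y)" by (simp add: algebra_simps)
  then have "dist x (y + s * (x - y)) = (1 - s) * \<bar>x - y\<bar>"
    using s by (simp add: dist_real_def abs_mult)
  also have "\<dots> < \<bar>x - y\<bar>" using s ne by simp
  finally show False by (simp add: dist_real_def)
qed

locale drift_estimation = lipschitz_gaussian M Z K L
  for M :: "'w measure" and Z :: "real \<Rightarrow> 'w \<Rightarrow> real" and K :: "real \<Rightarrow> real" and L :: real +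
  fixes m \<xi>\<^sub>0 :: real and \<Xi> :: "real set" and h T :: "nat \<Rightarrow> real"
    and \<xi>_hat \<xi>_tilde :: "nat \<Rightarrow> 'w \<Rightarrow> real"
  assumes open_Xi: "open \<Xi>" and interval_Xi: "is_interval \<Xi>" and truth_in: "\<xi>\<^sub>0 \<in> \<Xi>"
    and h_pos: "\<And>n. n \<ge> 1 \<Longrightarrow> h n > 0"
    and T_eq: "\<And>n. T n = real n * h n"
    and h_lim: "h \<longlonglongrightarrow> 0"
    and T_lim: "filterlim T at_top sequentially"
    and hat: "\<And>n \<omega>. n \<ge> 1 \<Longrightarrow> \<omega> \<in> space M \<Longrightarrow>
           is_arg_min (contrast (drift m) (observed (drift m) \<xi>\<^sub>0 Z) h n \<omega>)
             (\<lambda>\<xi>. \<xi> \<in> closure \<Xi>) (\<xi>_hat n \<omega>)"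
    and tilde: "\<And>n \<omega>. n \<ge> 1 \<Longrightarrow> \<omega> \<in> space M \<Longrightarrow>
           is_arg_min (contrast (drift m) (observed (drift m) \<xi>\<^sub>0 Z) h n \<omega>)
             (\<lambda>\<xi>. \<xi> \<in> UNIV) (\<xi>_tilde n \<omega>)"
begin

definition design_mass :: "nat \<Rightarrow> real" where "design_mass n = weight_sum (2 * m) (h n) n"
definition noise_part :: "nat \<Rightarrow> 'w \<Rightarrow> real" where "noise_part n = noise_score Z m (h n) n"
definition bias_part :: "nat \<Rightarrow> real" where "bias_part n = bias_score m (h n) n"

lemma design_mass_pos: "1 \<le> n \<Longrightarrow> 0 < design_mass n"
  unfolding design_mass_def using h_pos by (intro weight_sum_pos) auto

lemma T_pos: "1 \<le> n \<Longrightarrow> 0 < T n"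
  using h_pos by (simp add: T_eq)

lemma noise_part_span: "noise_part n \<in> finite_span Z"
proof (cases "1 \<le> n")
  case True
  then show ?thesis unfolding noise_part_def by (intro noise_score_in_span h_pos)
next
  case False
  then have "noise_part n = (\<lambda>\<omega>. \<Sum>i\<in>{}. Z (real i) \<omega>)" by (simp add: noise_part_def noise_score_def[abs_def])
  then show ?thesis using finite_span_sum[of "{}" "\<lambda>i. Z (real i)" Z] by simp
qed

lemmas noise_part_law = finite_span_law[OF noise_part_span]

lemma contrast_parabola:
  assumes "1 \<le> n"
  shows "\<exists>c. \<forall>\<xi>. contrast (drift m) (observed (drift m) \<xi>\<^sub>0 Z) h n \<omega> \<xi>
    = c + h n * design_mass n * (\<xi> - (\<xi>\<^sub>0 + (noise_part n \<omega> + \<xi>\<^sub>0 * bias_part n) / design_mass n))\<^sup>2"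
proof -
  let ?R = "noise_part n \<omega> + \<xi>\<^sub>0 * bias_part n"
  have sq: "design_mass n * x\<^sup>2 - 2 * x * ?R = design_mass n * (x - ?R / design_mass n)\<^sup>2 - ?R\<^sup>2 / design_mass n" for x
    using design_mass_pos[OF assms] by (simp add: field_simps power2_eq_square)
  obtain C where C: "\<And>\<xi>. contrast (drift m) (observed (drift m) \<xi>\<^sub>0 Z) h n \<omega> \<xi>
      = C + h n * (design_mass n * (\<xi> - \<xi>\<^sub>0)\<^sup>2 - 2 * (\<xi> - \<xi>\<^sub>0) * ?R)"
    by (rule that) (unfold design_mass_def noise_part_def bias_part_def, rule contrast_quadratic[OF refl])
  have e: "\<xi> - \<xi>\<^sub>0 - ?R / design_mass n = \<xi> - (\<xi>\<^sub>0 + ?R / design_mass n)" for \<xi> by simp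
  show ?thesis
    unfolding C sq e by (intro exI[of _ "C - h n * (?R\<^sup>2 / design_mass n)"]) (simp add: right_diff_distrib)
qed

lemma tilde_eq:
  assumes "1 \<le> n" "\<omega> \<in> space M"
  shows "\<xi>_tilde n \<omega> = \<xi>\<^sub>0 + (noise_part n \<omega> + \<xi>\<^sub>0 * bias_part n) / design_mass n"
proof -
  let ?x = "\<xi>\<^sub>0 + (noise_part n \<omega> + \<xi>\<^sub>0 * bias_part n) / design_mass n"
  obtain c where c: "\<And>\<xi>. contrast (drift m) (observed (drift m) \<xi>\<^sub>0 Z) h n \<omega> \<xi> = c + h n * design_mass n * (\<xi> - ?x)\<^sup>2"
    using contrast_parabola[OF assms(1)] by blast
  from tilde[OF assms] have "c + h n * design_mass n * (\<xi>_tilde n \<omega> - ?x)\<^sup>2 \<le> c + h n * design_mass n * (?x - ?x)\<^sup>2"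
    unfolding is_arg_min_linorder c by blast
  moreover have "0 < h n * design_mass n" using design_mass_pos h_pos assms by simp
  ultimately have "(\<xi>_tilde n \<omega> - ?x)\<^sup>2 \<le> 0\<^sup>2"
    by (simp only: add_le_cancel_left diff_self mult_le_cancel_left_pos)
  then show ?thesis by simp
qed

lemma closure_facts: "convex (closure \<Xi>)" "closed (closure \<Xi>)" "closure \<Xi> \<noteq> {}" "\<xi>\<^sub>0 \<in> closure \<Xi>"
  using convex_closure[OF is_interval_convex[OF interval_Xi]] truth_in closure_subset by auto

text \<open>On any set a parabola is smallest at the point closest to its vertex.\<close>

lemma hat_eq:
  assumes "1 \<le> n" "\<omega> \<in> space M"
  shows "\<xi>_hat n \<omega> = closest_point (closure \<Xi>) (\<xi>_tilde n \<omega>)"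
proof (rule closest_point_unique[OF closure_facts(1,2)])
  let ?x = "\<xi>_tilde n \<omega>"
  obtain c where c: "\<And>\<xi>. contrast (drift m) (observed (drift m) \<xi>\<^sub>0 Z) h n \<omega> \<xi> = c + h n * design_mass n * (\<xi> - ?x)\<^sup>2"
    using contrast_parabola[OF assms(1)] tilde_eq[OF assms] by metis
  have hA: "0 < h n * design_mass n" using design_mass_pos h_pos assms by simp
  show "\<xi>_hat n \<omega> \<in> closure \<Xi>" using hat[OF assms] by (simp add: is_arg_min_def)
  show "\<forall>z\<in>closure \<Xi>. dist ?x (\<xi>_hat n \<omega>) \<le> dist ?x z"
  proof
    fix z assume "z \<in> closure \<Xi>"
    then have "h n * design_mass n * (\<xi>_hat n \<omega> - ?x)\<^sup>2 \<le> h n * design_mass n * (z - ?x)\<^sup>2"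
      using hat[OF assms] unfolding is_arg_min_linorder c by auto
    then have "(\<xi>_hat n \<omega> - ?x)\<^sup>2 \<le> (z - ?x)\<^sup>2" using hA by (simp only: mult_le_cancel_left_pos)
    then show "dist ?x (\<xi>_hat n \<omega>) \<le> dist ?x z"
      by (simp add: dist_real_def abs_le_square_iff power2_commute)
  qed
qed

lemma estimators_measurable:
  assumes "1 \<le> n"
  shows "\<xi>_tilde n \<in> borel_measurable M" "\<xi>_hat n \<in> borel_measurable M"
proof -
  have [measurable]: "noise_part n \<in> borel_measurable M" using noise_part_law(1) by (rule L2_rv_measurable)
  have "(\<lambda>\<omega>. \<xi>\<^sub>0 + (noise_part n \<omega> + \<xi>\<^sub>0 * bias_part n) / design_mass n) \<in> borel_measurable M" by measurable
  then show t: "\<xi>_tilde n \<in> borel_measurable M"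
    by (subst measurable_cong[OF tilde_eq[OF assms]])
  have "closest_point (closure \<Xi>) \<in> borel_measurable borel"
    by (intro borel_measurable_continuous_onI continuous_on_closest_point closure_facts)
  from measurable_compose[OF t this] show "\<xi>_hat n \<in> borel_measurable M"
    by (subst measurable_cong[OF hat_eq[OF assms]])
qed

lemma error_eq:
  assumes "1 \<le> n" "\<omega> \<in> space M"
  shows "\<xi>_tilde n \<omega> - \<xi>\<^sub>0 = \<xi>\<^sub>0 * (1 / design_mass n * bias_part n) + 1 / design_mass n * noise_part n \<omega>"
  using tilde_eq[OF assms] by (simp add: add_divide_distrib)

lemma tilde_error_L2:
  assumes n: "1 \<le> n"
  shows "L2_rv M (\<lambda>\<omega>. \<xi>_tilde n \<omega> - \<xi>\<^sub>0)"
    and "l2norm M (\<lambda>\<omega>. \<xi>_tilde n \<omega> - \<xi>\<^sub>0) \<le> \<bar>\<xi>\<^sub>0\<bar> * \<bar>1 / design_mass n * bias_part n\<bar> + \<bar>1 / design_mass n * l2norm M (noise_part n)\<bar>"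
proof -
  let ?X = "\<lambda>\<omega>. \<xi>\<^sub>0 * (1 / design_mass n * bias_part n) + 1 / design_mass n * noise_part n \<omega>"
  have cL2: "L2_rv M (\<lambda>\<omega>. c)" for c by (simp add: L2_rv_def)
  have XL2: "L2_rv M ?X" by (intro L2_rv_add cL2 L2_rv_cmult noise_part_law)
  have W: "(\<lambda>\<omega>. \<xi>_tilde n \<omega> - \<xi>\<^sub>0) \<in> borel_measurable M" using estimators_measurable[OF n] by measurable
  note dom = L2_rv_dominated[OF XL2 W]
  show "L2_rv M (\<lambda>\<omega>. \<xi>_tilde n \<omega> - \<xi>\<^sub>0)" by (rule dom(1)) (simp add: error_eq[OF n])
  have "l2norm M (\<lambda>\<omega>. \<xi>_tilde n \<omega> - \<xi>\<^sub>0) \<le> l2norm M ?X" by (rule dom(2)) (simp add: error_eq[OF n])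
  also have "\<dots> \<le> l2norm M (\<lambda>\<omega>. \<xi>\<^sub>0 * (1 / design_mass n * bias_part n)) + l2norm M (\<lambda>\<omega>. 1 / design_mass n * noise_part n \<omega>)"
    by (intro l2norm_triangle cL2 L2_rv_cmult noise_part_law)
  also have "\<dots> = \<bar>\<xi>\<^sub>0\<bar> * \<bar>1 / design_mass n * bias_part n\<bar> + \<bar>1 / design_mass n * l2norm M (noise_part n)\<bar>"
    by (simp only: l2norm_const[OF prob_space_axioms] l2norm_cmult abs_mult abs_of_nonneg[OF l2norm_nonneg])
  finally show "l2norm M (\<lambda>\<omega>. \<xi>_tilde n \<omega> - \<xi>\<^sub>0) \<le> \<bar>\<xi>\<^sub>0\<bar> * \<bar>1 / design_mass n * bias_part n\<bar> + \<bar>1 / design_mass n * l2norm M (noise_part n)\<bar>" .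
qed

text \<open>The unconstrained error times \<open>c n\<close> is an affine function of a centred normal variable, which settles its limit
law. As \<open>c n\<close> tends to infinity the error itself tends to zero in \<open>L\<^sup>2\<close>, so the estimator stays
in the open interval, where the projection is the identity, with probability tending to one.\<close>

lemma hat_limit_law:
  assumes c: "filterlim c at_top sequentially"
    and noise: "(\<lambda>n. c n / design_mass n * l2norm M (noise_part n)) \<longlonglongrightarrow> s" and s: "0 < s"
    and bias: "(\<lambda>n. c n / design_mass n * bias_part n) \<longlonglongrightarrow> 0"
  shows "converges_in_law M (\<lambda>n \<omega>. c n * (\<xi>_hat n \<omega> - \<xi>\<^sub>0)) (normal_law 0 (s\<^sup>2))"
proof (rule converges_in_law_eventually_equal)
  let ?Y = "\<lambda>n \<omega>. \<xi>\<^sub>0 * (c n / design_mass n * bias_part n) + c n / design_mass n * noise_part n \<omega>"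
  have Nm: "noise_part n \<in> borel_measurable M" for n using noise_part_law(1) by (rule L2_rv_measurable)
  show "converges_in_law M ?Y (normal_law 0 (s\<^sup>2))"
  proof (rule converges_in_law_affine_normal[OF Nm noise_part_law(3)])
    show "(\<lambda>n. (c n / design_mass n)\<^sup>2 * (l2norm M (noise_part n))\<^sup>2) \<longlonglongrightarrow> s\<^sup>2"
      using tendsto_power[OF noise, of 2] by (simp only: power_mult_distrib)
    show "(\<lambda>n. \<xi>\<^sub>0 * (c n / design_mass n * bias_part n)) \<longlonglongrightarrow> 0"
      using tendsto_mult_right_zero[OF bias] by simp
  qed (use s in auto)
  have ev1: "\<forall>\<^sub>F n in sequentially. 1 \<le> n" by (rule eventually_ge_at_top)
  have cpos: "\<forall>\<^sub>F n in sequentially. 0 < c n" using c by (simp add: filterlim_at_top_dense)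
  show "\<forall>\<^sub>F n in sequentially. ?Y n \<in> borel_measurable M \<and> (\<lambda>\<omega>. c n * (\<xi>_hat n \<omega> - \<xi>\<^sub>0)) \<in> borel_measurable M"
    using ev1
  proof eventually_elim
    case (elim n)
    note [measurable] = estimators_measurable[OF elim] Nm
    show ?case by measurable
  qed
  obtain r where r: "0 < r" "ball \<xi>\<^sub>0 r \<subseteq> \<Xi>" using open_Xi truth_in openE by blast
  have "(\<lambda>n. \<bar>\<xi>\<^sub>0\<bar> * \<bar>inverse (c n) * (c n / design_mass n * bias_part n)\<bar> + \<bar>inverse (c n) * (c n / design_mass n * l2norm M (noise_part n))\<bar>)
      \<longlonglongrightarrow> \<bar>\<xi>\<^sub>0\<bar> * \<bar>0 * 0\<bar> + \<bar>0 * s\<bar>"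
    by (intro tendsto_intros noise bias tendsto_inverse_0_at_top c)
  then have lim0: "(\<lambda>n. \<bar>\<xi>\<^sub>0\<bar> * \<bar>inverse (c n) * (c n / design_mass n * bias_part n)\<bar> + \<bar>inverse (c n) * (c n / design_mass n * l2norm M (noise_part n))\<bar>)
      \<longlonglongrightarrow> 0" by simp
  have err: "(\<lambda>n. l2norm M (\<lambda>\<omega>. \<xi>_tilde n \<omega> - \<xi>\<^sub>0)) \<longlonglongrightarrow> 0"
  proof (rule Lim_null_comparison[OF _ lim0])
    show "\<forall>\<^sub>F n in sequentially. norm (l2norm M (\<lambda>\<omega>. \<xi>_tilde n \<omega> - \<xi>\<^sub>0))
      \<le> \<bar>\<xi>\<^sub>0\<bar> * \<bar>inverse (c n) * (c n / design_mass n * bias_part n)\<bar> + \<bar>inverse (c n) * (c n / design_mass n * l2norm M (noise_part n))\<bar>"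
      using ev1 cpos
    proof eventually_elim
      case (elim n)
      have e: "inverse (c n) * (c n / design_mass n * x) = 1 / design_mass n * x" for x using elim(2) by simp
      show ?case using tilde_error_L2(2)[OF elim(1)]
        unfolding e real_norm_def abs_of_nonneg[OF l2norm_nonneg] .
    qed
  qed
  have "(\<lambda>n. (l2norm M (\<lambda>\<omega>. \<xi>_tilde n \<omega> - \<xi>\<^sub>0))\<^sup>2 / r\<^sup>2) \<longlonglongrightarrow> 0\<^sup>2 / r\<^sup>2"
    using r by (intro tendsto_intros err) auto
  then have lim1: "(\<lambda>n. (l2norm M (\<lambda>\<omega>. \<xi>_tilde n \<omega> - \<xi>\<^sub>0))\<^sup>2 / r\<^sup>2) \<longlonglongrightarrow> 0" by simp
  show "(\<lambda>n. prob {\<omega> \<in> space M. ?Y n \<omega> \<noteq> c n * (\<xi>_hat n \<omega> - \<xi>\<^sub>0)}) \<longlonglongrightarrow> 0"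
  proof (rule Lim_null_comparison[OF _ lim1])
    show "\<forall>\<^sub>F n in sequentially. norm (prob {\<omega> \<in> space M. ?Y n \<omega> \<noteq> c n * (\<xi>_hat n \<omega> - \<xi>\<^sub>0)})
      \<le> (l2norm M (\<lambda>\<omega>. \<xi>_tilde n \<omega> - \<xi>\<^sub>0))\<^sup>2 / r\<^sup>2"
      using ev1
    proof eventually_elim
      case (elim n)
      note [measurable] = estimators_measurable[OF elim]
      have "r \<le> \<bar>\<xi>_tilde n \<omega> - \<xi>\<^sub>0\<bar>" if \<omega>: "\<omega> \<in> space M" and ne: "?Y n \<omega> \<noteq> c n * (\<xi>_hat n \<omega> - \<xi>\<^sub>0)" for \<omega>
      proof (rule ccontr)
        assume "\<not> r \<le> \<bar>\<xi>_tilde n \<omega> - \<xi>\<^sub>0\<bar>"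
        then have "\<xi>_tilde n \<omega> \<in> ball \<xi>\<^sub>0 r" by (simp add: dist_real_def abs_minus_commute)
        then have "\<xi>_tilde n \<omega> \<in> closure \<Xi>" using r closure_subset by blast
        then have "\<xi>_hat n \<omega> = \<xi>_tilde n \<omega>" using hat_eq[OF elim \<omega>] closest_point_self by metis
        moreover have "c n * (\<xi>_tilde n \<omega> - \<xi>\<^sub>0) = ?Y n \<omega>"
          unfolding error_eq[OF elim \<omega>] by (simp add: algebra_simps)
        ultimately show False using ne by simp
      qed
      then have "prob {\<omega> \<in> space M. ?Y n \<omega> \<noteq> c n * (\<xi>_hat n \<omega> - \<xi>\<^sub>0)}
          \<le> prob {\<omega> \<in> space M. r \<le> \<bar>\<xi>_tilde n \<omega> - \<xi>\<^sub>0\<bar>}"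
        by (intro finite_measure_mono) auto
      also have "\<dots> \<le> (l2norm M (\<lambda>\<omega>. \<xi>_tilde n \<omega> - \<xi>\<^sub>0))\<^sup>2 / r\<^sup>2"
        by (rule prob_abs_ge_le_l2norm[OF tilde_error_L2(1)[OF elim] r(1)])
      finally show ?case by simp
    qed
  qed
qed

section \<open>Orders of growth of the design, the bias and the noise\<close>

lemma ev_ge_1: "\<forall>\<^sub>F n in sequentially. (1::nat) \<le> n"
  by (rule eventually_ge_at_top)

lemma noise_tendsto_S_inf:
  assumes "m < 0"
  shows "tendsto_L2 M noise_part (S_inf M Z m) sequentially"
proof -
  have "(\<lambda>n. 2 * (1 + T n) powr m * sqrt (K 0) + sqrt (2 * L * h n)) \<longlonglongrightarrow> 2 * 0 * sqrt (K 0) + sqrt (2 * L * 0)"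
    by (intro tendsto_intros h_lim filterlim_compose[OF powr_neg_tendsto_0_at_top[OF assms] T_lim])
  then have lim: "(\<lambda>n. 2 * (1 + T n) powr m * sqrt (K 0) + sqrt (2 * L * h n)) \<longlonglongrightarrow> 0" by simp
  have "(\<lambda>n. l2norm M (\<lambda>\<omega>. noise_part n \<omega> - S_inf M Z m \<omega>)) \<longlonglongrightarrow> 0"
  proof (rule Lim_null_comparison[OF _ lim])
    show "\<forall>\<^sub>F n in sequentially. norm (l2norm M (\<lambda>\<omega>. noise_part n \<omega> - S_inf M Z m \<omega>))
      \<le> 2 * (1 + T n) powr m * sqrt (K 0) + sqrt (2 * L * h n)"
      using ev_ge_1
    proof eventually_elim
      case (elim n)
      then show ?case using noise_score_near_S_inf[OF assms h_pos[OF elim], of n] by (simp add: noise_part_def T_eq)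
    qed
  qed
  then show ?thesis
    using S_inf_eq_path_integral(2)[OF assms] noise_part_law(1) by (simp add: tendsto_L2_iff_l2norm)
qed

text \<open>The limit variable is centred, being an \<open>L\<^sup>2\<close>-limit of centred scores.\<close>

lemma V_inf_eq:
  assumes "m < 0" shows "V_inf M Z m = (l2norm M (S_inf M Z m))\<^sup>2" and "0 < l2norm M (S_inf M Z m)"
proof -
  have "(\<lambda>n. 0) \<longlonglongrightarrow> expectation (S_inf M Z m)"
    using tendsto_L2_moments(1)[OF noise_tendsto_S_inf[OF assms]] noise_part_law(2) by simp
  then have "expectation (S_inf M Z m) = 0" by (simp add: LIMSEQ_const_iff)
  then show V: "V_inf M Z m = (l2norm M (S_inf M Z m))\<^sup>2" by (simp add: V_inf_def l2norm_power2)
  have "l2norm M (S_inf M Z m) \<noteq> 0" using V V_inf_pos[OF assms] by auto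
  then show "0 < l2norm M (S_inf M Z m)" using l2norm_nonneg[of M "S_inf M Z m"] by linarith
qed

lemma bias_le: "1 \<le> n \<Longrightarrow> \<bar>bias_part n\<bar> \<le> h n * (max 1 ((1 + T n) powr m))\<^sup>2"
  unfolding bias_part_def T_eq by (intro bias_score_bound h_pos)

lemma bias_tendsto_0:
  assumes "m \<le> 0" shows "bias_part \<longlonglongrightarrow> 0"
proof (rule Lim_null_comparison[OF _ h_lim])
  show "\<forall>\<^sub>F n in sequentially. norm (bias_part n) \<le> h n"
    using ev_ge_1
  proof eventually_elim
    case (elim n)
    have "(1 + T n) powr m \<le> 1 powr m" using assms T_pos[OF elim] by (intro powr_mono2') auto
    then show ?case using bias_le[OF elim] by (simp add: max_def split: if_splits)
  qed
qed

lemma design_mass_near_trend: "1 \<le> n \<Longrightarrow> \<bar>design_mass n - trend (2 * m) (T n)\<bar> \<le> h n * \<bar>(1 + T n) powr (2 * m) - 1\<bar>"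
  using weight_sum_trend[OF h_pos, of n "2 * m" n] by (simp add: design_mass_def T_eq abs_minus_commute)

text \<open>The exact integral of \<open>(1 + t)\<^sup>2\<^sup>m\<close> has the claimed order, and the discretisation error is of
smaller order.\<close>

lemma design_mass_growth:
  assumes m: "- 1 / 2 < m"
  shows "(\<lambda>n. T n powr (2 * m + 1) / design_mass n) \<longlonglongrightarrow> 2 * m + 1"
proof -
  let ?r = "2 * m + 1"
  have r: "0 < ?r" using m by simp
  have t1: "(\<lambda>n. (1 + T n) powr ?r / T n powr ?r) \<longlonglongrightarrow> 1" "(\<lambda>n. (1 + T n) powr (2 * m) / T n powr (2 * m)) \<longlonglongrightarrow> 1"
    by (intro filterlim_compose[OF powr_shift_ratio_tendsto_1 T_lim])+
  have inv: "(\<lambda>n. inverse (T n powr ?r)) \<longlonglongrightarrow> 0"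
    by (intro tendsto_inverse_0_at_top filterlim_compose[OF powr_at_top[OF r] T_lim])
  have invT: "(\<lambda>n. inverse (T n)) \<longlonglongrightarrow> 0"
    by (intro tendsto_inverse_0_at_top T_lim)
  have "(\<lambda>n. ((1 + T n) powr ?r / T n powr ?r - inverse (T n powr ?r)) / ?r) \<longlonglongrightarrow> (1 - 0) / ?r"
    using r by (intro tendsto_intros t1 inv) auto
  moreover have "\<forall>\<^sub>F n in sequentially. ((1 + T n) powr ?r / T n powr ?r - inverse (T n powr ?r)) / ?r
      = trend (2 * m) (T n) / T n powr ?r"
    using ev_ge_1
  proof eventually_elim
    case (elim n)
    have "trend (2 * m) (T n) = ((1 + T n) powr ?r - 1) / ?r"
      using trend_closed_form(1)[of "T n" "2 * m"] T_pos[OF elim] r by auto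
    moreover have "(x / y - inverse y) / z = (x - 1) / z / y" for x y z :: real
      by (simp add: divide_inverse algebra_simps)
    ultimately show ?case by (simp only:)
  qed
  ultimately have trend: "(\<lambda>n. trend (2 * m) (T n) / T n powr ?r) \<longlonglongrightarrow> 1 / ?r"
    by (auto intro: Lim_transform_eventually)
  have "(\<lambda>n. h n * ((1 + T n) powr (2 * m) / T n powr (2 * m) * inverse (T n) + inverse (T n powr ?r))) \<longlonglongrightarrow> 0 * (1 * 0 + 0)"
    by (intro tendsto_intros h_lim t1 invT inv)
  then have lim: "(\<lambda>n. h n * ((1 + T n) powr (2 * m) / T n powr (2 * m) * inverse (T n) + inverse (T n powr ?r))) \<longlonglongrightarrow> 0"
    by simp
  have "(\<lambda>n. (design_mass n - trend (2 * m) (T n)) / T n powr ?r) \<longlonglongrightarrow> 0"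
  proof (rule Lim_null_comparison[OF _ lim])
    show "\<forall>\<^sub>F n in sequentially. norm ((design_mass n - trend (2 * m) (T n)) / T n powr ?r)
      \<le> h n * ((1 + T n) powr (2 * m) / T n powr (2 * m) * inverse (T n) + inverse (T n powr ?r))"
      using ev_ge_1
    proof eventually_elim
      case (elim n)
      have Tn: "0 < T n" by (rule T_pos[OF elim])
      have p: "T n powr ?r = T n powr (2 * m) * T n" using Tn by (simp add: powr_add)
      have "\<bar>(1 + T n) powr (2 * m) - 1\<bar> \<le> (1 + T n) powr (2 * m) + 1"
        using powr_ge_zero[of "1 + T n" "2 * m"] by linarith
      then have "\<bar>design_mass n - trend (2 * m) (T n)\<bar> \<le> h n * ((1 + T n) powr (2 * m) + 1)"
        using design_mass_near_trend[OF elim] h_pos[OF elim] by (smt (verit) mult_left_mono)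
      then have "\<bar>design_mass n - trend (2 * m) (T n)\<bar> / T n powr ?r \<le> h n * ((1 + T n) powr (2 * m) + 1) / T n powr ?r"
        by (rule divide_right_mono) simp
      also have "\<dots> = h n * ((1 + T n) powr (2 * m) / T n powr (2 * m) * inverse (T n) + inverse (T n powr ?r))"
        using Tn unfolding p by (simp add: field_simps)
      finally show ?case by (simp add: abs_divide)
    qed
  qed
  from tendsto_add[OF this trend] have "(\<lambda>n. design_mass n / T n powr ?r) \<longlonglongrightarrow> 1 / ?r"
    by (simp add: add_divide_distrib[symmetric])
  from tendsto_inverse[OF this] show ?thesis using r by simp
qed

lemma design_mass_growth_log:
  assumes m: "m = - 1 / 2"
  shows "(\<lambda>n. ln (T n) / design_mass n) \<longlonglongrightarrow> 1"
proof -
  have ln_top: "filterlim (\<lambda>n. ln (T n)) at_top sequentially"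
    by (rule filterlim_compose[OF ln_at_top T_lim])
  have ev: "\<forall>\<^sub>F n in sequentially. 0 < ln (T n)" using ln_top by (simp add: filterlim_at_top_dense)
  have "(\<lambda>n. h n * inverse (ln (T n))) \<longlonglongrightarrow> 0 * 0"
    by (intro tendsto_intros h_lim tendsto_inverse_0_at_top ln_top)
  then have lim: "(\<lambda>n. h n * inverse (ln (T n))) \<longlonglongrightarrow> 0" by simp
  have "(\<lambda>n. (design_mass n - ln (1 + T n)) / ln (T n)) \<longlonglongrightarrow> 0"
  proof (rule Lim_null_comparison[OF _ lim])
    show "\<forall>\<^sub>F n in sequentially. norm ((design_mass n - ln (1 + T n)) / ln (T n)) \<le> h n * inverse (ln (T n))"
      using ev_ge_1 ev
    proof eventually_elim
      case (elim n)
      have Tn: "0 < T n" by (rule T_pos[OF elim(1)])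
      have "(1 + T n) powr (- 1) \<le> 1 powr (- 1)" using Tn by (intro powr_mono2') auto
      then have "\<bar>(1 + T n) powr (- 1) - 1\<bar> \<le> 1" by (simp add: abs_le_iff)
      then have "h n * \<bar>(1 + T n) powr (2 * m) - 1\<bar> \<le> h n * 1"
        using h_pos[OF elim(1)] m by (intro mult_left_mono) auto
      moreover have "trend (2 * m) (T n) = ln (1 + T n)" using trend_closed_form(2)[of "T n"] Tn m by simp
      ultimately have "\<bar>design_mass n - ln (1 + T n)\<bar> \<le> h n" using design_mass_near_trend[OF elim(1)] by simp
      then show ?case using elim(2) by (simp add: field_simps)
    qed
  qed
  from tendsto_add[OF this filterlim_compose[OF ln_shift_ratio_tendsto_1 T_lim]]
  have "(\<lambda>n. design_mass n / ln (T n)) \<longlonglongrightarrow> 1" by (simp add: add_divide_distrib[symmetric])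
  from tendsto_inverse[OF this] show ?thesis by simp
qed

lemma design_mass_tendsto_A_inf:
  assumes m: "m < - 1 / 2"
  shows "design_mass \<longlonglongrightarrow> A_inf m" "0 < A_inf m"
proof -
  let ?r = "2 * m + 1"
  have r: "?r < 0" using m by simp
  show "0 < A_inf m" using r by (simp add: A_inf_eq[OF m] divide_less_0_iff)
  have "(\<lambda>n. ((1 + T n) powr ?r - 1) / ?r) \<longlonglongrightarrow> (0 - 1) / ?r"
    using r by (intro tendsto_intros filterlim_compose[OF powr_neg_tendsto_0_at_top[OF r] T_lim]) auto
  moreover have "\<forall>\<^sub>F n in sequentially. ((1 + T n) powr ?r - 1) / ?r = trend (2 * m) (T n)"
    using ev_ge_1
  proof eventually_elim
    case (elim n)
    then show ?case using trend_closed_form(1)[of "T n" "2 * m"] T_pos[OF elim] r by auto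
  qed
  ultimately have trend: "(\<lambda>n. trend (2 * m) (T n)) \<longlonglongrightarrow> A_inf m"
    unfolding A_inf_eq[OF m] by (auto intro: Lim_transform_eventually)
  have "(\<lambda>n. design_mass n - trend (2 * m) (T n)) \<longlonglongrightarrow> 0"
  proof (rule Lim_null_comparison[OF _ h_lim])
    show "\<forall>\<^sub>F n in sequentially. norm (design_mass n - trend (2 * m) (T n)) \<le> h n"
      using ev_ge_1
    proof eventually_elim
      case (elim n)
      have "(1 + T n) powr (2 * m) \<le> 1 powr (2 * m)" using T_pos[OF elim] m by (intro powr_mono2') auto
      then have "\<bar>(1 + T n) powr (2 * m) - 1\<bar> \<le> 1" by (simp add: abs_le_iff)
      then have "h n * \<bar>(1 + T n) powr (2 * m) - 1\<bar> \<le> h n * 1"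
        using h_pos[OF elim] by (intro mult_left_mono) auto
      then show ?case using design_mass_near_trend[OF elim] by simp
    qed
  qed
  from tendsto_add[OF this trend] show "design_mass \<longlonglongrightarrow> A_inf m" by simp
qed

text \<open>The boundary term \<open>(1 + T)\<^sup>m Z\<^sub>T\<close> alone determines the norm; the remaining terms have norm \<open>O(T\<^sup>m\<^sup>/\<^sup>2)\<close>.\<close>

lemma noise_norm_growth:
  assumes m: "0 < m" "m \<le> 1"
    and decay: "\<And>u. 0 \<le> u \<Longrightarrow> K u \<le> C * exp (- (b * u))" and b: "0 < b"
  shows "(\<lambda>n. l2norm M (noise_part n) / T n powr m) \<longlonglongrightarrow> sqrt (K 0)"
proof -
  let ?w = "\<lambda>n. (1 + T n) powr m"
  have t1: "(\<lambda>n. ?w n / T n powr m) \<longlonglongrightarrow> 1"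
    by (rule filterlim_compose[OF powr_shift_ratio_tendsto_1 T_lim])
  have inv: "(\<lambda>n. inverse (T n powr m)) \<longlonglongrightarrow> 0"
    by (intro tendsto_inverse_0_at_top filterlim_compose[OF powr_at_top[OF m(1)] T_lim])
  \<comment> \<open>Bounds for the norms of \<open>Z\<^sub>0\<close> and of the sum over weight increments, relative to \<open>T\<^sup>m\<close>.\<close>
  let ?e = "\<lambda>n. sqrt (K 0) * inverse (T n powr m)
      + sqrt (2 * C * (h n + 1 / b) * (?w n / T n powr m) * inverse (T n powr m))"
  have "?e \<longlonglongrightarrow> sqrt (K 0) * 0 + sqrt (2 * C * (0 + 1 / b) * 1 * 0)"
    by (intro tendsto_intros t1 inv h_lim)
  then have lim: "?e \<longlonglongrightarrow> 0" by simp
  have "(\<lambda>n. l2norm M (noise_part n) / T n powr m - ?w n / T n powr m * sqrt (K 0)) \<longlonglongrightarrow> 0"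
  proof (rule Lim_null_comparison[OF _ lim])
    show "\<forall>\<^sub>F n in sequentially. norm (l2norm M (noise_part n) / T n powr m - ?w n / T n powr m * sqrt (K 0)) \<le> ?e n"
      using ev_ge_1
    proof eventually_elim
      case (elim n)
      note hn = h_pos[OF elim] and Tn = T_pos[OF elim]
      let ?S = "\<lambda>\<omega>. \<Sum>i=1..n. ((1 + real i * h n) powr m - (1 + (real i - 1) * h n) powr m) * Z (real i * h n) \<omega>"
      let ?X = "\<lambda>\<omega>. ?w n * Z (T n) \<omega>"
      have XL2: "L2_rv M ?X" using Tn by (intro L2_rv_cmult Z_L2) simp
      have SL2: "L2_rv M ?S" using hn by (intro L2_rv_sum L2_rv_cmult Z_L2) simp
      have ZL2: "L2_rv M (Z 0)" by (rule Z_L2) simp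
      have "\<bar>l2norm M (noise_part n) - l2norm M ?X\<bar> \<le> l2norm M (\<lambda>\<omega>. ?X \<omega> - noise_part n \<omega>)"
        using l2norm_reverse_triangle[OF noise_part_law(1) XL2] by (simp only: l2norm_minus_commute)
      also have "(\<lambda>\<omega>. ?X \<omega> - noise_part n \<omega>) = (\<lambda>\<omega>. Z 0 \<omega> + ?S \<omega>)"
        by (rule ext) (simp add: noise_part_def noise_score_Abel T_eq)
      also have "l2norm M (\<lambda>\<omega>. Z 0 \<omega> + ?S \<omega>) \<le> l2norm M (Z 0) + l2norm M ?S"
        by (rule l2norm_triangle[OF ZL2 SL2])
      also have "l2norm M (Z 0) = sqrt (K 0)" by (rule l2norm_Z) simp
      also have "l2norm M ?S \<le> sqrt (2 * C * (h n + 1 / b) * ?w n)"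
        using increment_sum_second_moment[OF m hn decay b, of n] by (intro real_le_rsqrt) (simp add: T_eq)
      also have "l2norm M ?X = ?w n * sqrt (K 0)"
        using l2norm_Z[of "T n"] Tn by (simp add: l2norm_cmult)
      finally have "\<bar>l2norm M (noise_part n) - ?w n * sqrt (K 0)\<bar> / T n powr m
          \<le> (sqrt (K 0) + sqrt (2 * C * (h n + 1 / b) * ?w n)) / T n powr m"
        by (intro divide_right_mono) simp_all
      also have "sqrt (2 * C * (h n + 1 / b) * ?w n) / T n powr m
          = sqrt (2 * C * (h n + 1 / b) * (?w n / T n powr m) * inverse (T n powr m))"
      proof -
        have "sqrt x / y = sqrt (x / y * inverse y)" if "0 < y" for x y :: real
        proof -
          have "x / y * inverse y = x / y\<^sup>2" by (simp add: power2_eq_square divide_inverse)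
          then show ?thesis using that by (simp add: real_sqrt_divide)
        qed
        from this[of "T n powr m" "2 * C * (h n + 1 / b) * ?w n"] show ?thesis
          using Tn by (simp only: powr_gt_zero times_divide_eq_right)
      qed
      then have "(sqrt (K 0) + sqrt (2 * C * (h n + 1 / b) * ?w n)) / T n powr m = ?e n"
        by (simp only: add_divide_distrib divide_inverse[of "sqrt (K 0)"])
      finally show ?case
        by (simp add: diff_divide_distrib[symmetric] abs_divide)
    qed
  qed
  from tendsto_add[OF this tendsto_mult[OF t1 tendsto_const[of "sqrt (K 0)"]]]
  show ?thesis by simp
qed

text \<open>This is where \<open>h T\<^sup>m \<rightarrow> 0\<close> enters: the bias is bounded by \<open>h (1 + T)\<^sup>2\<^sup>m\<close>, and it is compared with \<open>T\<^sup>m\<close>.\<close>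

lemma bias_growth:
  assumes m: "0 < m" and hT: "(\<lambda>n. h n * T n powr m) \<longlonglongrightarrow> 0"
  shows "(\<lambda>n. bias_part n / T n powr m) \<longlonglongrightarrow> 0"
proof -
  let ?w = "\<lambda>n. (1 + T n) powr m"
  have "(\<lambda>n. h n * T n powr m * (?w n / T n powr m)\<^sup>2) \<longlonglongrightarrow> 0 * 1\<^sup>2"
    by (intro tendsto_intros hT filterlim_compose[OF powr_shift_ratio_tendsto_1 T_lim])
  then have lim: "(\<lambda>n. h n * T n powr m * (?w n / T n powr m)\<^sup>2) \<longlonglongrightarrow> 0" by simp
  show ?thesis
  proof (rule Lim_null_comparison[OF _ lim])
    show "\<forall>\<^sub>F n in sequentially. norm (bias_part n / T n powr m) \<le> h n * T n powr m * (?w n / T n powr m)\<^sup>2"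
      using ev_ge_1
    proof eventually_elim
      case (elim n)
      note Tn = T_pos[OF elim]
      have "1 powr m \<le> ?w n" using m Tn by (intro powr_mono2) auto
      then have "max 1 (?w n) = ?w n" by simp
      then have "\<bar>bias_part n\<bar> \<le> h n * (?w n)\<^sup>2" using bias_le[OF elim] by simp
      then have "\<bar>bias_part n\<bar> / T n powr m \<le> h n * (?w n)\<^sup>2 / T n powr m" by (rule divide_right_mono) simp
      also have "\<dots> = h n * T n powr m * (?w n / T n powr m)\<^sup>2"
        using Tn by (simp add: power2_eq_square)
      finally show ?case by (simp add: abs_divide)
    qed
  qed
qed

text \<open>For a constant drift the score is \<open>Z\<^sub>T - Z\<^sub>0\<close>, with second moment \<open>2 (K 0 - K T)\<close>.\<close>

lemma noise_norm_constant_drift: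
  assumes m: "m = 0"
    and decay: "\<And>u. 0 \<le> u \<Longrightarrow> K u \<le> C * exp (- (b * u))" and b: "0 < b"
  shows "(\<lambda>n. l2norm M (noise_part n)) \<longlonglongrightarrow> sqrt (2 * K 0)"
proof -
  have "filterlim (\<lambda>n. b * T n) at_top sequentially"
    using b by (intro filterlim_tendsto_pos_mult_at_top[OF tendsto_const _ T_lim])
  then have "(\<lambda>n. exp (- (b * T n))) \<longlonglongrightarrow> 0"
    by (intro filterlim_compose[OF exp_at_bot]) (simp add: filterlim_uminus_at_bot)
  then have lim: "(\<lambda>n. C * exp (- (b * T n))) \<longlonglongrightarrow> 0" by (rule tendsto_mult_right_zero)
  have "(\<lambda>n. K (T n)) \<longlonglongrightarrow> 0"
  proof (rule Lim_null_comparison[OF _ lim])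
    show "\<forall>\<^sub>F n in sequentially. norm (K (T n)) \<le> C * exp (- (b * T n))"
      using ev_ge_1
    proof eventually_elim
      case (elim n)
      then show ?case using decay[of "T n"] K_nonneg[of "T n"] T_pos[OF elim] by simp
    qed
  qed
  then have "(\<lambda>n. sqrt (2 * (K 0 - K (T n)))) \<longlonglongrightarrow> sqrt (2 * (K 0 - 0))"
    by (intro tendsto_intros)
  moreover have "\<forall>\<^sub>F n in sequentially. sqrt (2 * (K 0 - K (T n))) = l2norm M (noise_part n)"
    using ev_ge_1
  proof eventually_elim
    case (elim n)
    have pos: "0 < 1 + real i * h n" "0 < 1 + (real i - 1) * h n" if "i \<in> {1..n}" for i
    proof -
      have "0 \<le> real i * h n" "0 \<le> (real i - 1) * h n" using h_pos[OF elim] that by auto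
      then show "0 < 1 + real i * h n" "0 < 1 + (real i - 1) * h n" by linarith+
    qed
    have zero: "(\<Sum>i=1..n. ((1 + real i * h n) powr m - (1 + (real i - 1) * h n) powr m) * Z (real i * h n) \<omega>) = 0" for \<omega>
    proof (rule sum.neutral, rule ballI)
      fix i assume "i \<in> {1..n}"
      then show "((1 + real i * h n) powr m - (1 + (real i - 1) * h n) powr m) * Z (real i * h n) \<omega> = 0"
        using pos[of i] m by simp
    qed
    have "noise_part n = (\<lambda>\<omega>. Z (T n) \<omega> - Z 0 \<omega>)"
      unfolding noise_part_def noise_score_Abel[abs_def] zero using T_pos[OF elim] m by (simp add: T_eq)
    then show ?case
      using Z_increment_moment[of "T n" 0] T_pos[OF elim] by (simp add: l2norm_def)
  qed
  ultimately show ?thesis by (auto intro: Lim_transform_eventually)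
qed

section \<open>Limits of the estimators\<close>

lemma tilde_tendsto_L2:
  assumes m: "m < - 1 / 2"
  shows "tendsto_L2 M \<xi>_tilde (\<lambda>\<omega>. \<xi>\<^sub>0 + S_inf M Z m \<omega> / A_inf m) sequentially"
proof -
  have m0: "m < 0" using m by simp
  let ?S = "S_inf M Z m"
  let ?L = "\<lambda>\<omega>. \<xi>\<^sub>0 + 1 / A_inf m * ?S \<omega>"
  have cL2: "L2_rv M (\<lambda>\<omega>. c)" for c by (simp add: L2_rv_def)
  note SL2 = S_inf_eq_path_integral(2)[OF m0]
  have LL2: "L2_rv M ?L" by (intro L2_rv_add cL2 L2_rv_cmult SL2)
  have tL2: "\<forall>\<^sub>F n in sequentially. L2_rv M (\<xi>_tilde n)"
    using ev_ge_1
  proof eventually_elim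
    case (elim n)
    show ?case using L2_rv_add[OF tilde_error_L2(1)[OF elim] cL2[of \<xi>\<^sub>0]] by simp
  qed
  have iA: "(\<lambda>n. 1 / design_mass n) \<longlonglongrightarrow> 1 / A_inf m"
    using design_mass_tendsto_A_inf[OF m] by (intro tendsto_intros) auto
  let ?e = "\<lambda>n. \<bar>\<xi>\<^sub>0 * (1 / design_mass n * bias_part n)\<bar> + (\<bar>1 / design_mass n\<bar> * l2norm M (\<lambda>\<omega>. noise_part n \<omega> - ?S \<omega>)
    + \<bar>1 / design_mass n - 1 / A_inf m\<bar> * l2norm M ?S)"
  have "(\<lambda>n. l2norm M (\<lambda>\<omega>. noise_part n \<omega> - ?S \<omega>)) \<longlonglongrightarrow> 0"
    using noise_tendsto_S_inf[OF m0] by (simp add: tendsto_L2_iff_l2norm)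
  moreover have "bias_part \<longlonglongrightarrow> 0" using m0 by (intro bias_tendsto_0) simp
  ultimately have "?e \<longlonglongrightarrow> \<bar>\<xi>\<^sub>0 * (1 / A_inf m * 0)\<bar> + (\<bar>1 / A_inf m\<bar> * 0
    + \<bar>1 / A_inf m - 1 / A_inf m\<bar> * l2norm M ?S)"
    by (intro tendsto_add tendsto_rabs tendsto_mult tendsto_diff tendsto_const iA)
  then have lim: "?e \<longlonglongrightarrow> 0" by simp
  have "(\<lambda>n. l2norm M (\<lambda>\<omega>. \<xi>_tilde n \<omega> - ?L \<omega>)) \<longlonglongrightarrow> 0"
  proof (rule Lim_null_comparison[OF _ lim])
    show "\<forall>\<^sub>F n in sequentially. norm (l2norm M (\<lambda>\<omega>. \<xi>_tilde n \<omega> - ?L \<omega>)) \<le> ?e n"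
      using ev_ge_1
    proof eventually_elim
      case (elim n)
      let ?b = "\<lambda>\<omega>. \<xi>\<^sub>0 * (1 / design_mass n * bias_part n)" and ?x = "\<lambda>\<omega>. 1 / design_mass n * (noise_part n \<omega> - ?S \<omega>)"
        and ?y = "\<lambda>\<omega>. (1 / design_mass n - 1 / A_inf m) * ?S \<omega>"
      have xL2: "L2_rv M ?x" and yL2: "L2_rv M ?y"
        by (intro L2_rv_cmult L2_rv_diff noise_part_law SL2)+
      have bxyL2: "L2_rv M (\<lambda>\<omega>. ?b \<omega> + (?x \<omega> + ?y \<omega>))" by (intro L2_rv_add cL2 xL2 yL2)
      have eq: "\<xi>_tilde n \<omega> - ?L \<omega> = ?b \<omega> + (?x \<omega> + ?y \<omega>)" if "\<omega> \<in> space M" for \<omega>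
        using error_eq[OF elim that] by (simp add: algebra_simps)
      have meas: "(\<lambda>\<omega>. \<xi>_tilde n \<omega> - ?L \<omega>) \<in> borel_measurable M"
        using estimators_measurable(1)[OF elim] L2_rv_measurable[OF LL2] by measurable
      have "l2norm M (\<lambda>\<omega>. \<xi>_tilde n \<omega> - ?L \<omega>) \<le> l2norm M (\<lambda>\<omega>. ?b \<omega> + (?x \<omega> + ?y \<omega>))"
        by (rule L2_rv_dominated(2)[OF bxyL2 meas]) (simp only: eq order_refl)
      also have "\<dots> \<le> l2norm M ?b + (l2norm M ?x + l2norm M ?y)"
        by (intro order_trans[OF l2norm_triangle] add_mono order_refl l2norm_triangle L2_rv_add cL2 xL2 yL2)
      also have "\<dots> = ?e n"
        by (simp only: l2norm_cmult l2norm_const[OF prob_space_axioms] abs_mult)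
      finally show ?case by (simp only: real_norm_def abs_of_nonneg[OF l2norm_nonneg])
    qed
  qed
  then have "tendsto_L2 M \<xi>_tilde ?L sequentially"
    using LL2 tL2 by (simp add: tendsto_L2_iff_l2norm)
  then show ?thesis by simp
qed

text \<open>The projection is 1-Lipschitz and therefore preserves \<open>L\<^sup>2\<close>-convergence.\<close>

lemma hat_tendsto_L2:
  assumes m: "m < - 1 / 2"
  shows "tendsto_L2 M \<xi>_hat
    (\<lambda>\<omega>. closest_point (closure \<Xi>) (\<xi>\<^sub>0 + S_inf M Z m \<omega> / A_inf m)) sequentially"
proof -
  let ?cp = "closest_point (closure \<Xi>)"
  let ?L = "\<lambda>\<omega>. \<xi>\<^sub>0 + S_inf M Z m \<omega> / A_inf m"
  note lip = closest_point_lipschitz[OF closure_facts(1-3), unfolded dist_real_def]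
  have cL2: "L2_rv M (\<lambda>\<omega>. c)" for c by (simp add: L2_rv_def)
  have cpm: "?cp \<in> borel_measurable borel"
    by (intro borel_measurable_continuous_onI continuous_on_closest_point closure_facts)
  have cpL2: "L2_rv M (\<lambda>\<omega>. ?cp (X \<omega>))" if X: "L2_rv M X" for X
  proof -
    have m: "(\<lambda>\<omega>. ?cp (X \<omega>)) \<in> borel_measurable M"
      using measurable_compose[OF L2_rv_measurable[OF X] cpm] .
    then have m': "(\<lambda>\<omega>. ?cp (X \<omega>) - ?cp 0) \<in> borel_measurable M" by measurable
    have "L2_rv M (\<lambda>\<omega>. ?cp (X \<omega>) - ?cp 0)"
      by (rule L2_rv_dominated(1)[OF X m']) (use lip[of _ 0] in simp)
    from L2_rv_add[OF this cL2[of "?cp 0"]] show ?thesis by simp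
  qed
  have t: "L2_rv M ?L" "\<forall>\<^sub>F n in sequentially. L2_rv M (\<xi>_tilde n)"
    "(\<lambda>n. l2norm M (\<lambda>\<omega>. \<xi>_tilde n \<omega> - ?L \<omega>)) \<longlonglongrightarrow> 0"
    using tilde_tendsto_L2[OF m] by (auto simp: tendsto_L2_iff_l2norm)
  have hL2: "L2_rv M (\<xi>_hat n)" if "1 \<le> n" "L2_rv M (\<xi>_tilde n)" for n
    by (rule L2_rv_AE_cong[OF _ estimators_measurable(2)[OF that(1)] cpL2[OF that(2)]])
      (use hat_eq[OF that(1)] in auto)
  have "(\<lambda>n. l2norm M (\<lambda>\<omega>. \<xi>_hat n \<omega> - ?cp (?L \<omega>))) \<longlonglongrightarrow> 0"
  proof (rule Lim_null_comparison[OF _ t(3)])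
    show "\<forall>\<^sub>F n in sequentially. norm (l2norm M (\<lambda>\<omega>. \<xi>_hat n \<omega> - ?cp (?L \<omega>)))
      \<le> l2norm M (\<lambda>\<omega>. \<xi>_tilde n \<omega> - ?L \<omega>)"
      using ev_ge_1 t(2)
    proof eventually_elim
      case (elim n)
      have "l2norm M (\<lambda>\<omega>. \<xi>_hat n \<omega> - ?cp (?L \<omega>)) \<le> l2norm M (\<lambda>\<omega>. \<xi>_tilde n \<omega> - ?L \<omega>)"
        by (rule L2_rv_dominated(2)[OF L2_rv_diff[OF elim(2) t(1)]
              L2_rv_measurable[OF L2_rv_diff[OF hL2[OF elim] cpL2[OF t(1)]]]])
          (simp only: hat_eq[OF elim(1)] lip)
      then show ?case by simp
    qed
  qed
  moreover have "\<forall>\<^sub>F n in sequentially. L2_rv M (\<xi>_hat n)"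
    using ev_ge_1 t(2) by eventually_elim (rule hL2)
  ultimately show ?thesis using cpL2[OF t(1)] by (simp add: tendsto_L2_iff_l2norm)
qed

text \<open>Limits in probability are unique, so consistency would force the projected limit to equal
the interior point \<open>\<xi>\<^sub>0\<close> almost surely. Then \<open>S_inf\<close> would vanish almost surely, although its
variance is positive.\<close>

lemma hat_inconsistent:
  assumes m: "m < - 1 / 2"
  shows "\<not> tendsto_prob M \<xi>_hat (\<lambda>_. \<xi>\<^sub>0) sequentially"
proof
  assume prob: "tendsto_prob M \<xi>_hat (\<lambda>_. \<xi>\<^sub>0) sequentially"
  have m0: "m < 0" using m by simp
  let ?P = "\<lambda>\<omega>. closest_point (closure \<Xi>) (\<xi>\<^sub>0 + S_inf M Z m \<omega> / A_inf m)"
  have P: "L2_rv M ?P" and hL2: "\<forall>\<^sub>F n in sequentially. L2_rv M (\<xi>_hat n)"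
    and lim: "(\<lambda>n. l2norm M (\<lambda>\<omega>. \<xi>_hat n \<omega> - ?P \<omega>)) \<longlonglongrightarrow> 0"
    using hat_tendsto_L2[OF m] by (auto simp: tendsto_L2_iff_l2norm)
  note [measurable] = L2_rv_measurable[OF P]
  \<comment> \<open>Either the estimator is far from \<open>\<xi>\<^sub>0\<close> or it is far from its \<open>L\<^sup>2\<close>-limit; both are asymptotically negligible.\<close>
  have null: "prob {\<omega> \<in> space M. 2 * e < \<bar>?P \<omega> - \<xi>\<^sub>0\<bar>} = 0" if e: "0 < e" for e
  proof -
    let ?D = "{\<omega> \<in> space M. 2 * e < \<bar>?P \<omega> - \<xi>\<^sub>0\<bar>}"
    have "(\<lambda>n. prob {\<omega> \<in> space M. e < \<bar>\<xi>_hat n \<omega> - \<xi>\<^sub>0\<bar>}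
        + (l2norm M (\<lambda>\<omega>. \<xi>_hat n \<omega> - ?P \<omega>))\<^sup>2 / e\<^sup>2) \<longlonglongrightarrow> 0 + 0\<^sup>2 / e\<^sup>2"
      using prob e by (intro tendsto_intros lim) (auto simp: tendsto_prob_def)
    then have lim0: "(\<lambda>n. prob {\<omega> \<in> space M. e < \<bar>\<xi>_hat n \<omega> - \<xi>\<^sub>0\<bar>}
        + (l2norm M (\<lambda>\<omega>. \<xi>_hat n \<omega> - ?P \<omega>))\<^sup>2 / e\<^sup>2) \<longlonglongrightarrow> 0" by simp
    have "\<forall>\<^sub>F n in sequentially. prob ?D \<le> prob {\<omega> \<in> space M. e < \<bar>\<xi>_hat n \<omega> - \<xi>\<^sub>0\<bar>}
        + (l2norm M (\<lambda>\<omega>. \<xi>_hat n \<omega> - ?P \<omega>))\<^sup>2 / e\<^sup>2"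
      using hL2
    proof eventually_elim
      case (elim n)
      note [measurable] = L2_rv_measurable[OF elim]
      let ?E = "{\<omega> \<in> space M. e < \<bar>\<xi>_hat n \<omega> - \<xi>\<^sub>0\<bar>}"
        and ?F = "{\<omega> \<in> space M. e \<le> \<bar>\<xi>_hat n \<omega> - ?P \<omega>\<bar>}"
      have "?E \<in> events" "?F \<in> events" by measurable
      moreover have "?D \<subseteq> ?E \<union> ?F" by auto
      ultimately have "prob ?D \<le> prob ?E + prob ?F"
        using measure_Un_le[of ?E M ?F] finite_measure_mono[of ?D "?E \<union> ?F"] by auto
      also have "prob ?F \<le> (l2norm M (\<lambda>\<omega>. \<xi>_hat n \<omega> - ?P \<omega>))\<^sup>2 / e\<^sup>2"
        by (rule prob_abs_ge_le_l2norm[OF L2_rv_diff[OF elim P] e])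
      finally show ?case by simp
    qed
    then have "prob ?D \<le> 0"
      by (rule tendsto_le[OF sequentially_bot lim0 tendsto_const])
    then show ?thesis using measure_nonneg[of M ?D] by linarith
  qed
  have "AE \<omega> in M. \<bar>?P \<omega> - \<xi>\<^sub>0\<bar> \<le> 2 / real (Suc k)" for k
  proof -
    have "{\<omega> \<in> space M. 2 * (1 / real (Suc k)) < \<bar>?P \<omega> - \<xi>\<^sub>0\<bar>} \<in> null_sets M"
      using null[of "1 / real (Suc k)"] by (intro null_setsI) (auto simp: emeasure_eq_measure)
    then show ?thesis by (rule AE_I') auto
  qed
  then have "AE \<omega> in M. \<forall>k. \<bar>?P \<omega> - \<xi>\<^sub>0\<bar> \<le> 2 / real (Suc k)" by (simp add: AE_all_countable)
  then have ae: "AE \<omega> in M. S_inf M Z m \<omega> = 0"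
  proof eventually_elim
    case (elim \<omega>)
    have "(\<lambda>k. 2 / real (Suc k)) \<longlonglongrightarrow> 0"
      using LIMSEQ_Suc[OF lim_const_over_n[of "2::real"]] by simp
    then have "\<bar>?P \<omega> - \<xi>\<^sub>0\<bar> \<le> 0"
      using elim by (intro LIMSEQ_le_const) auto
    then have cp: "?P \<omega> = \<xi>\<^sub>0" by simp
    obtain r where r: "0 < r" "ball \<xi>\<^sub>0 r \<subseteq> closure \<Xi>"
      using open_Xi truth_in closure_subset by (metis openE order_trans)
    have "\<xi>\<^sub>0 + S_inf M Z m \<omega> / A_inf m = \<xi>\<^sub>0"
      by (rule closest_point_eq_interior[OF closure_facts(2) r cp])
    then show ?case using design_mass_tendsto_A_inf(2)[OF m] by simp
  qed
  have "l2norm M (S_inf M Z m) = l2norm M (\<lambda>\<omega>. 0)"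
    by (rule l2norm_AE_cong[OF ae L2_rv_measurable[OF S_inf_eq_path_integral(2)[OF m0]]]) simp
  then show False using V_inf_eq(2)[OF m0] by (simp add: l2norm_def)
qed

lemma limit_law_increasing_drift:
  assumes m: "0 < m" "m \<le> 1"
    and decay: "\<And>u. 0 \<le> u \<Longrightarrow> K u \<le> C * exp (- (b * u))" and b: "0 < b"
    and hT: "(\<lambda>n. h n * T n powr m) \<longlonglongrightarrow> 0"
  shows "converges_in_law M (\<lambda>n \<omega>. T n powr (m + 1) * (\<xi>_hat n \<omega> - \<xi>\<^sub>0)) (normal_law 0 (K 0 * (2 * m + 1)\<^sup>2))"
proof -
  have G: "(\<lambda>n. T n powr (2 * m + 1) / design_mass n) \<longlonglongrightarrow> 2 * m + 1" using m by (intro design_mass_growth) simp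
  have split: "\<forall>\<^sub>F n in sequentially. \<forall>x. T n powr (2 * m + 1) / design_mass n * (x / T n powr m) = T n powr (m + 1) / design_mass n * x"
    using ev_ge_1
  proof eventually_elim
    case (elim n)
    have "T n powr (2 * m + 1) = T n powr (m + 1) * T n powr m"
      by (simp add: powr_add[symmetric] algebra_simps)
    then show ?case using T_pos[OF elim] by simp
  qed
  have "converges_in_law M (\<lambda>n \<omega>. T n powr (m + 1) * (\<xi>_hat n \<omega> - \<xi>\<^sub>0)) (normal_law 0 (((2 * m + 1) * sqrt (K 0))\<^sup>2))"
  proof (rule hat_limit_law)
    show "filterlim (\<lambda>n. T n powr (m + 1)) at_top sequentially"
      using m by (intro filterlim_compose[OF powr_at_top T_lim]) simp
    show "0 < (2 * m + 1) * sqrt (K 0)" using m K_pos by simp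
    show "(\<lambda>n. T n powr (m + 1) / design_mass n * l2norm M (noise_part n)) \<longlonglongrightarrow> (2 * m + 1) * sqrt (K 0)"
      by (rule Lim_transform_eventually[OF tendsto_mult[OF G noise_norm_growth[OF m decay b]]])
        (use split in \<open>auto elim: eventually_mono\<close>)
    have "(\<lambda>n. T n powr (m + 1) / design_mass n * bias_part n) \<longlonglongrightarrow> (2 * m + 1) * 0"
      by (rule Lim_transform_eventually[OF tendsto_mult[OF G bias_growth[OF m(1) hT]]])
        (use split in \<open>auto elim: eventually_mono\<close>)
    then show "(\<lambda>n. T n powr (m + 1) / design_mass n * bias_part n) \<longlonglongrightarrow> 0" by simp
  qed
  moreover have "((2 * m + 1) * sqrt (K 0))\<^sup>2 = K 0 * (2 * m + 1)\<^sup>2"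
    using K_pos by (simp add: power_mult_distrib)
  ultimately show ?thesis by (simp only:)
qed

lemma limit_law_constant_drift:
  assumes m: "m = 0"
    and decay: "\<And>u. 0 \<le> u \<Longrightarrow> K u \<le> C * exp (- (b * u))" and b: "0 < b"
  shows "converges_in_law M (\<lambda>n \<omega>. T n * (\<xi>_hat n \<omega> - \<xi>\<^sub>0)) (normal_law 0 (2 * K 0))"
proof -
  have G: "(\<lambda>n. T n / design_mass n) \<longlonglongrightarrow> 1"
  proof (rule Lim_transform_eventually)
    show "(\<lambda>n. T n powr (2 * m + 1) / design_mass n) \<longlonglongrightarrow> 1"
      using design_mass_growth m by simp
    show "\<forall>\<^sub>F n in sequentially. T n powr (2 * m + 1) / design_mass n = T n / design_mass n"
      using ev_ge_1 by eventually_elim (use T_pos m in \<open>simp add: less_imp_le\<close>)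
  qed
  have "converges_in_law M (\<lambda>n \<omega>. T n * (\<xi>_hat n \<omega> - \<xi>\<^sub>0)) (normal_law 0 ((sqrt (2 * K 0))\<^sup>2))"
  proof (rule hat_limit_law[OF T_lim])
    show "(\<lambda>n. T n / design_mass n * l2norm M (noise_part n)) \<longlonglongrightarrow> sqrt (2 * K 0)"
      using tendsto_mult[OF G noise_norm_constant_drift[OF m decay b]] by simp
    show "(\<lambda>n. T n / design_mass n * bias_part n) \<longlonglongrightarrow> 0"
      using tendsto_mult[OF G bias_tendsto_0] m by simp
  qed (use K_pos in simp)
  then show ?thesis using K_pos by simp
qed

text \<open>The rate \<open>c\<close> is left open because \<open>design_mass\<close> grows like a power for \<open>m > -1/2\<close> and
like a logarithm for \<open>m = -1/2\<close>.\<close>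

lemma limit_law_decreasing_drift:
  assumes m: "m < 0" and c: "filterlim c at_top sequentially"
    and G: "(\<lambda>n. c n / design_mass n) \<longlonglongrightarrow> g" "0 < g"
  shows "converges_in_law M (\<lambda>n \<omega>. c n * (\<xi>_hat n \<omega> - \<xi>\<^sub>0)) (normal_law 0 (g\<^sup>2 * V_inf M Z m))"
proof -
  have "converges_in_law M (\<lambda>n \<omega>. c n * (\<xi>_hat n \<omega> - \<xi>\<^sub>0)) (normal_law 0 ((g * l2norm M (S_inf M Z m))\<^sup>2))"
  proof (rule hat_limit_law[OF c])
    show "(\<lambda>n. c n / design_mass n * l2norm M (noise_part n)) \<longlonglongrightarrow> g * l2norm M (S_inf M Z m)"
      by (intro tendsto_mult G tendsto_L2_moments noise_tendsto_S_inf m)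
    show "0 < g * l2norm M (S_inf M Z m)" using G V_inf_eq[OF m] by simp
    show "(\<lambda>n. c n / design_mass n * bias_part n) \<longlonglongrightarrow> 0"
      using tendsto_mult[OF G(1) bias_tendsto_0] m by simp
  qed
  then show ?thesis by (simp add: V_inf_eq[OF m] power_mult_distrib)
qed

end

text \<open>For the Gaussian kernel the Lipschitz bound follows from \<open>1 - e\<^sup>-\<^sup>x \<le> x\<close> when \<open>u \<le> 1\<close> and from \<open>1 - e\<^sup>-\<^sup>x \<le> 1 \<le> u\<close>
otherwise; its exponential decay follows from \<open>2 u \<le> u\<^sup>2 + 1\<close>.\<close>

lemma kernel_bounds:
  fixes a b :: real
  assumes ab: "0 < a" "0 < b"
    and K: "K = (\<lambda>t. a * exp (- b * t\<^sup>2 / 2)) \<or> K = (\<lambda>t. a * exp (- b * \<bar>t\<bar>))"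
  shows "0 < K 0" "\<And>u. 0 \<le> u \<Longrightarrow> 0 \<le> K u" "\<And>u. 0 < u \<Longrightarrow> K u < K 0"
    and "\<And>u. 0 \<le> u \<Longrightarrow> K 0 - K u \<le> a * (b + 1) * u"
    and "\<And>u. 0 \<le> u \<Longrightarrow> K u \<le> a * exp (b / 2) * exp (- (b * u))"
proof -
  show "0 < K 0" "\<And>u. 0 \<le> u \<Longrightarrow> 0 \<le> K u" "\<And>u. 0 < u \<Longrightarrow> K u < K 0"
    using K ab by auto
  fix u :: real assume u: "0 \<le> u"
  have "1 - exp (- (b * u)) \<le> (b + 1) * u"
    using exp_ge_add_one_self[of "- (b * u)"] u by (simp add: algebra_simps)
  moreover have "1 - exp (- b * u\<^sup>2 / 2) \<le> (b + 1) * u"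
  proof (cases "u \<le> 1")
    case True
    then have "u\<^sup>2 \<le> u" using u by (simp add: power2_eq_square mult_left_le)
    then have "b * u\<^sup>2 \<le> b * u" using ab by (intro mult_left_mono) auto
    moreover have "0 \<le> b * u" using ab u by simp
    ultimately show ?thesis
      using exp_ge_add_one_self[of "- b * u\<^sup>2 / 2"] u by (simp add: algebra_simps)
  next
    case False
    have "0 \<le> b * u" using ab u by simp
    moreover have "0 \<le> exp (- b * u\<^sup>2 / 2)" by (rule exp_ge_zero)
    ultimately show ?thesis using False unfolding distrib_right by linarith
  qed
  ultimately have "a * (1 - exp (- (b * u))) \<le> a * ((b + 1) * u)"
    "a * (1 - exp (- b * u\<^sup>2 / 2)) \<le> a * ((b + 1) * u)"
    using ab by (auto intro!: mult_left_mono)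
  then show "K 0 - K u \<le> a * (b + 1) * u"
    using K u by (auto simp: right_diff_distrib mult.assoc)
  have "2 * u * 1 \<le> u\<^sup>2 + 1\<^sup>2" by (rule sum_squares_bound)
  then have "b * (2 * u) \<le> b * (u\<^sup>2 + 1)" using ab by (intro mult_left_mono) auto
  then have "- b * u\<^sup>2 / 2 \<le> b / 2 + - (b * u)" by (simp add: algebra_simps)
  then have "exp (- b * u\<^sup>2 / 2) \<le> exp (b / 2) * exp (- (b * u))"
    by (simp add: exp_add[symmetric])
  moreover have "exp (- (b * u)) \<le> exp (b / 2) * exp (- (b * u))"
    using ab by (simp add: mult_le_cancel_right1)
  ultimately have "a * exp (- b * u\<^sup>2 / 2) \<le> a * (exp (b / 2) * exp (- (b * u)))"
    "a * exp (- (b * u)) \<le> a * (exp (b / 2) * exp (- (b * u)))"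
    using ab by (auto intro!: mult_left_mono)
  then show "K u \<le> a * exp (b / 2) * exp (- (b * u))"
    using K u by (auto simp: mult.assoc)
qed

theorem proposition3p1:
  fixes M :: "'w measure" and Z :: "real \<Rightarrow> 'w \<Rightarrow> real" and K :: "real \<Rightarrow> real"
    and a b m \<xi>\<^sub>0 :: real and \<Xi> :: "real set"
    and h T :: "nat \<Rightarrow> real"
    and \<xi>_hat \<xi>_tilde :: "nat \<Rightarrow> 'w \<Rightarrow> real"
  assumes "prob_space M"
    and "a > 0" and "b > 0"
    and "K = (\<lambda>t. a * exp (- b * t\<^sup>2 / 2)) \<or> K = (\<lambda>t. a * exp (- b * \<bar>t\<bar>))"
    and "centered_stationary_gaussian M Z K"
    and "m \<le> 1"
    and "\<Xi> \<noteq> {}" and "open \<Xi>" and "bounded \<Xi>" and "is_interval \<Xi>"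
    and "\<xi>\<^sub>0 \<in> \<Xi>"
    and "\<And>n. n \<ge> 1 \<Longrightarrow> h n > 0"
    and "\<And>n. T n = real n * h n"
    and "h \<longlonglongrightarrow> 0"
    and "filterlim T at_top sequentially"
    and "\<And>n \<omega>. n \<ge> 1 \<Longrightarrow> \<omega> \<in> space M \<Longrightarrow>
           is_arg_min (contrast (drift m) (observed (drift m) \<xi>\<^sub>0 Z) h n \<omega>)
             (\<lambda>\<xi>. \<xi> \<in> closure \<Xi>) (\<xi>_hat n \<omega>)"
    and "\<And>n \<omega>. n \<ge> 1 \<Longrightarrow> \<omega> \<in> space M \<Longrightarrow>
           is_arg_min (contrast (drift m) (observed (drift m) \<xi>\<^sub>0 Z) h n \<omega>)
             (\<lambda>\<xi>. \<xi> \<in> UNIV) (\<xi>_tilde n \<omega>)"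
  shows "(\<forall>p<0. V_inf M Z p > 0) \<and>
    (0 < m \<and> (\<lambda>n. h n * T n powr m) \<longlonglongrightarrow> 0 \<longrightarrow>
      converges_in_law M (\<lambda>n \<omega>. T n powr (m + 1) * (\<xi>_hat n \<omega> - \<xi>\<^sub>0))
        (normal_law 0 (K 0 * (2 * m + 1)\<^sup>2))) \<and>
    (m = 0 \<longrightarrow>
      converges_in_law M (\<lambda>n \<omega>. T n * (\<xi>_hat n \<omega> - \<xi>\<^sub>0)) (normal_law 0 (2 * K 0))) \<and>
    (- 1 / 2 < m \<and> m < 0 \<longrightarrow>
      converges_in_law M (\<lambda>n \<omega>. T n powr (2 * m + 1) * (\<xi>_hat n \<omega> - \<xi>\<^sub>0))
        (normal_law 0 ((2 * m + 1)\<^sup>2 * V_inf M Z m))) \<and>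
    (m = - 1 / 2 \<longrightarrow>
      converges_in_law M (\<lambda>n \<omega>. ln (T n) * (\<xi>_hat n \<omega> - \<xi>\<^sub>0))
        (normal_law 0 (V_inf M Z (- 1 / 2)))) \<and>
    (m < - 1 / 2 \<longrightarrow>
      tendsto_L2 M \<xi>_tilde (\<lambda>\<omega>. \<xi>\<^sub>0 + S_inf M Z m \<omega> / A_inf m) sequentially \<and>
      tendsto_L2 M \<xi>_hat
        (\<lambda>\<omega>. closest_point (closure \<Xi>) (\<xi>\<^sub>0 + S_inf M Z m \<omega> / A_inf m)) sequentially \<and>
      \<not> tendsto_prob M \<xi>_hat (\<lambda>_. \<xi>\<^sub>0) sequentially)"
proof -
  interpret prob_space M by fact
  have "lipschitz_gaussian M Z K (a * (b + 1))"
    by (unfold_locales; (rule kernel_bounds[OF assms(2-4)] assms(5)); assumption?)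
  then interpret lipschitz_gaussian M Z K "a * (b + 1)" .
  interpret drift_estimation M Z K "a * (b + 1)" m \<xi>\<^sub>0 \<Xi> h T \<xi>_hat \<xi>_tilde
    by unfold_locales (use assms in auto)
  note decay = kernel_bounds(5)[OF assms(2-4)]
  have 1: "\<forall>p<0. V_inf M Z p > 0" using V_inf_pos by blast
  have 2: "0 < m \<and> (\<lambda>n. h n * T n powr m) \<longlonglongrightarrow> 0 \<longrightarrow>
      converges_in_law M (\<lambda>n \<omega>. T n powr (m + 1) * (\<xi>_hat n \<omega> - \<xi>\<^sub>0))
        (normal_law 0 (K 0 * (2 * m + 1)\<^sup>2))"
    using limit_law_increasing_drift[OF _ assms(6) decay assms(3)] by blast
  have 3: "m = 0 \<longrightarrow> converges_in_law M (\<lambda>n \<omega>. T n * (\<xi>_hat n \<omega> - \<xi>\<^sub>0)) (normal_law 0 (2 * K 0))"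
    using limit_law_constant_drift[OF _ decay assms(3)] by blast
  have 4: "- 1 / 2 < m \<and> m < 0 \<longrightarrow>
      converges_in_law M (\<lambda>n \<omega>. T n powr (2 * m + 1) * (\<xi>_hat n \<omega> - \<xi>\<^sub>0))
        (normal_law 0 ((2 * m + 1)\<^sup>2 * V_inf M Z m))"
  proof (intro impI, elim conjE)
    assume m: "- 1 / 2 < m" "m < 0"
    show "converges_in_law M (\<lambda>n \<omega>. T n powr (2 * m + 1) * (\<xi>_hat n \<omega> - \<xi>\<^sub>0))
        (normal_law 0 ((2 * m + 1)\<^sup>2 * V_inf M Z m))"
      using m by (intro limit_law_decreasing_drift design_mass_growth filterlim_compose[OF powr_at_top T_lim]) auto
  qed
  have 5: "m = - 1 / 2 \<longrightarrow> converges_in_law M (\<lambda>n \<omega>. ln (T n) * (\<xi>_hat n \<omega> - \<xi>\<^sub>0))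
        (normal_law 0 (V_inf M Z (- 1 / 2)))"
  proof
    assume m: "m = - 1 / 2"
    have "converges_in_law M (\<lambda>n \<omega>. ln (T n) * (\<xi>_hat n \<omega> - \<xi>\<^sub>0)) (normal_law 0 (1\<^sup>2 * V_inf M Z m))"
      using m by (intro limit_law_decreasing_drift design_mass_growth_log filterlim_compose[OF ln_at_top T_lim]) auto
    then show "converges_in_law M (\<lambda>n \<omega>. ln (T n) * (\<xi>_hat n \<omega> - \<xi>\<^sub>0)) (normal_law 0 (V_inf M Z (- 1 / 2)))"
      by (simp only: m power_one mult_1)
  qed
  show ?thesis
    using 1 2 3 4 5 tilde_tendsto_L2 hat_tendsto_L2 hat_inconsistent by blast
qed

end
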